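(* Let $\mathscr{Cont}_{fun}$ be the multicategory whose objects are the small contextual categories, whose multi-hom sets are $$\mathscr{Cont}_{fun}(\mathcal A_1,\dots,\mathcal A_n;\mathcal B)=\mathrm{Fun}(|\mathcal A_1|\times\cdots\times|\mathcal A_n|,|\mathcal B|)\qquad(n\ge0),$$ the set of functors between underlying categories (for $n=0$, functors from the terminal category $\mathbf 1$ to $|\mathcal B|$), with composition $G\circ(F_1,\dots,F_n)=G(F_1(-,\dots,-),\dots,F_n(-,\dots,-))$. Then the subsets $$\mathrm{Hom}(\mathcal A_1,\dots,\mathcal A_n;\mathcal B)\subset\mathscr{Cont}_{fun}(\mathcal A_1,\dots,\mathcal A_n;\mathcal B),$$ with $n\ge0$ and $\mathcal A_1,\dots,\mathcal A_n,\mathcal B$ ranging over all small contextual categories, are closed under multi-composition in $\mathscr{Cont}_{fun}$. In particular, they define a sub-multicategory of $\mathscr{Cont}_{fun}$. Here for $n\ge1$, $\mathrm{Hom}(\mathcal A_1,\dots,\mathcal A_n;\mathcal B)$ is the set of multimorphisms from $(\mathcal A_1,\dots,\mathcal A_n)$ to $\mathcal B$, and for $n=0$, $\mathrm{Hom}(\;;\mathcal B)$ is the set of functors $\mathbf 1\to|\mathcal B|$ whose value is a length-1 object of $\mathcal B$.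
   Context: A precontextual category $\mathcal C$ consists of: a category $|\mathcal C|$ (with a set of objects); a length function $\ell$ from objects to $\mathbb N$; a function $\partial$ from objects to objects with $\ell(\partial a)=\ell(a)-1$ if $\ell(a)\ge 1$ and $\partial a=a$ if $\ell(a)=0$; for each object $a$ with $\ell(a)\ge1$ a morphism $\mathbf p_a:a\to\partial a$; and a set $\mathbf Q$ of commutative squares in $|\mathcal C|$ having left side some $\mathbf p_a$ and right side some $\mathbf p_b$. A display map (written $\twoheadrightarrow$) is a finite, possibly empty, composite of maps $\mathbf p_a$; its length is $\ell(\text{domain})-\ell(\text{codomain})$. A distinguished square is a finite vertical composite of elements of $\mathbf Q$; length-1 distinguished squares are the elements of $\mathbf Q$. $\mathcal C$ is a contextual category if moreover: there is a unique object $1_{\mathcal C}$ of length $0$, and it is terminal; every element of $\mathbf Q$ is a pullback; $\mathbf Q$ contains the identity square of every $\mathbf p_a$ and is closed under horizontal composition; for every $a$ with $\ell(a)\ge 1$ and $f:b\to\partial a$ there is a unique element of $\mathbf Q$ with right side $\mathbf p_a$ and bottom $f$. Cellular diagrams. A sieve in a poset is a downward closed subset; $x^{\le}=\{y: y\le x\}$, $\partial x=\{y:y<x\}$. For a finite poset $(P,\le)$ with a linear order $\vartriangleleft$ refining $\le$, a functor $F:(P,\le)^{op}\to|\mathcal C|$ ($\mathcal C$ contextual) is cellular if one can choose for each sieve $X$ a limit cone $a^X\Rightarrow F|_X$ such that: $a^\varnothing=1_{\mathcal C}$; $a^{x^\le}=F(x)$ with cone given by $F$; if $X\subset Y$ are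 sieves with $Y\setminus X=\{y\}$ and $x\vartriangleleft y$ for all $x\in X$, then $a^Y\to a^X$ is a length-1 display map; if $X\subset X'$, $Y\subset Y'$, $X\subset Y$, $X'\subset Y'$ are sieves with $Y\setminus X=\{y\}=Y'\setminus X'$ and $x\vartriangleleft y$ for all $x\in X'$, then the induced square with top $a^{Y'}\to a^Y$ and bottom $a^{X'}\to a^X$ is distinguished. Such a choice is unique, and $F[X]:=a^X$. For a poset $P$ with all $x^\le$ finite, a local linearization is a relation $\vartriangleleft$, contained in the set of pairs having a common upper bound, that restricts on each $x^{\le}$ to a linear order refining $\le$; $F:P^{op}\to|\mathcal C|$ is cellular if each restriction to $(x^\le)^{op}$ is; for a sieve $X$ contained in some $x^\le$, $F[X]$ is the object $a^X$ for the restriction to $x^\le$. Multimorphisms. $T(\mathcal A)$ is the poset of objects of $\mathcal A$ of length $\ge1$, with $x\le y$ iff there is a display map $y\twoheadrightarrow x$; thus $T(\mathcal A)^{op}$ maps to $|\mathcal A|$ via display maps. The product poset $T(\mathcal A_1)\times\cdots\times T(\mathcal A_n)$ carries the lexicographic local linearization: $(x_i)\blacktriangleleft(y_i)$ iff $(x_i)=(y_i)$, or for some $i$: $x_j=y_j$ for $j<i$, $x_i<y_i$, and $x_j,y_j$ comparable for $j>i$. A multimorphism from $(\mathcal A_1,\dots,\mathcal A_n)$, $n\ge1$, to a contextual category $\mathcal C$ is a functor $F:|\mathcal A_1|\times\cdots\times|\mathcal A_n|\to|\mathcal C|$ such that: $F(x_1,\dots,x_n)=1_{\mathcal C}$ whenever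 some $\ell(x_i)=0$; its restriction to $(T(\mathcal A_1)\times\cdots\times T(\mathcal A_n))^{op}$ is cellular for $\blacktriangleleft$; and for all length-1 distinguished squares $Q_i$ in $\mathcal A_i$ with top $f_i^0:x_i^0\to y_i^0$, bottom $f_i^1:x_i^1=\partial x_i^0\to y_i^1=\partial y_i^0$, the square with top $F(f^0_1,\dots,f^0_n)$, vertical sides the length-1 display maps $F(x^0_1,\dots,x^0_n)\to F[\partial(x^0_1,\dots,x^0_n)]$ and $F(y^0_1,\dots,y^0_n)\to F[\partial(y^0_1,\dots,y^0_n)]$, and bottom the map of limits induced by the maps $F(f_1^{\chi_I(1)},\dots,f_n^{\chi_I(n)})$, is distinguished; here $F[\partial(x^0_1,\dots,x_n^0)]$ is the limit over nonempty $I\subset\{1,\dots,n\}$ (ordered oppositely to inclusion) of $F(x_1^{\chi_I(1)},\dots,x_n^{\chi_I(n)})$, with $\chi_I$ the characteristic function of $I$. *)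

theory Defs
  imports Main "HOL-Library.FuncSet"
begin

section \<open>Categories, functors, finite products\<close>

record ('o, 'm) cat =
  Obj :: "'o set"
  Arr :: "'m set"
  Dom :: "'m \<Rightarrow> 'o"
  Cod :: "'m \<Rightarrow> 'o"
  Ide :: "'o \<Rightarrow> 'm"
  Comp :: "'m \<Rightarrow> 'm \<Rightarrow> 'm"  \<comment> \<open>\<open>Comp C g f\<close> is \<open>g \<circ> f\<close>\<close>

definition in_hom :: "('o, 'm, 'z) cat_scheme \<Rightarrow> 'm \<Rightarrow> 'o \<Rightarrow> 'o \<Rightarrow> bool" where
  "in_hom C f a b \<longleftrightarrow> f \<in> Arr C \<and> Dom C f = a \<and> Cod C f = b"

definition category :: "('o, 'm, 'z) cat_scheme \<Rightarrow> bool" where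
  "category C \<longleftrightarrow>
     (\<forall>f\<in>Arr C. Dom C f \<in> Obj C \<and> Cod C f \<in> Obj C) \<and>
     (\<forall>a\<in>Obj C. in_hom C (Ide C a) a a) \<and>
     (\<forall>f\<in>Arr C. \<forall>g\<in>Arr C. Cod C f = Dom C g \<longrightarrow>
        in_hom C (Comp C g f) (Dom C f) (Cod C g)) \<and>
     (\<forall>f\<in>Arr C. Comp C f (Ide C (Dom C f)) = f \<and> Comp C (Ide C (Cod C f)) f = f) \<and>
     (\<forall>f\<in>Arr C. \<forall>g\<in>Arr C. \<forall>h\<in>Arr C. Cod C f = Dom C g \<longrightarrow> Cod C g = Dom C h \<longrightarrow>
        Comp C h (Comp C g f) = Comp C (Comp C h g) f)"

definition is_functor ::
  "('o, 'm, 'z) cat_scheme \<Rightarrow> ('p, 'n, 'y) cat_scheme \<Rightarrow> ('o \<Rightarrow> 'p) \<Rightarrow> ('m \<Rightarrow> 'n) \<Rightarrow> bool" where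
  "is_functor C D Fo Fm \<longleftrightarrow>
     (\<forall>a\<in>Obj C. Fo a \<in> Obj D) \<and>
     (\<forall>f\<in>Arr C. in_hom D (Fm f) (Fo (Dom C f)) (Fo (Cod C f))) \<and>
     (\<forall>a\<in>Obj C. Fm (Ide C a) = Ide D (Fo a)) \<and>
     (\<forall>f\<in>Arr C. \<forall>g\<in>Arr C. Cod C f = Dom C g \<longrightarrow>
        Fm (Comp C g f) = Comp D (Fm g) (Fm f))"

text \<open>The product of a list of categories: objects and arrows are lists, with the \<open>i\<close>-th entry
  in the \<open>i\<close>-th category.  The product of the empty list is the terminal category, with the
  single object \<open>[]\<close> and the single arrow \<open>[]\<close>.\<close>

definition prod_cat :: "('o, 'm, 'z) cat_scheme list \<Rightarrow> ('o list, 'm list) cat" where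
  "prod_cat As =
     \<lparr> Obj = {xs. length xs = length As \<and> (\<forall>i<length As. xs ! i \<in> Obj (As ! i))},
       Arr = {fs. length fs = length As \<and> (\<forall>i<length As. fs ! i \<in> Arr (As ! i))},
       Dom = (\<lambda>fs. map2 Dom As fs),
       Cod = (\<lambda>fs. map2 Cod As fs),
       Ide = (\<lambda>xs. map2 Ide As xs),
       Comp = (\<lambda>gs fs. map (\<lambda>i. Comp (As ! i) (gs ! i) (fs ! i)) [0..<length As]) \<rparr>"


section \<open>Commutative squares and pullbacks\<close>

datatype 'm square = Square (sq_top: 'm) (sq_left: 'm) (sq_right: 'm) (sq_bot: 'm)

definition commutative_square :: "('o, 'm, 'z) cat_scheme \<Rightarrow> 'm square \<Rightarrow> bool" where
  "commutative_square C s \<longleftrightarrow>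
     sq_top s \<in> Arr C \<and> sq_left s \<in> Arr C \<and> sq_right s \<in> Arr C \<and> sq_bot s \<in> Arr C \<and>
     Dom C (sq_top s) = Dom C (sq_left s) \<and> Cod C (sq_top s) = Dom C (sq_right s) \<and>
     Cod C (sq_left s) = Dom C (sq_bot s) \<and> Cod C (sq_right s) = Cod C (sq_bot s) \<and>
     Comp C (sq_right s) (sq_top s) = Comp C (sq_bot s) (sq_left s)"

definition pullback_square :: "('o, 'm, 'z) cat_scheme \<Rightarrow> 'm square \<Rightarrow> bool" where
  "pullback_square C s \<longleftrightarrow> commutative_square C s \<and>
     (\<forall>u\<in>Arr C. \<forall>v\<in>Arr C.
        Dom C u = Dom C v \<longrightarrow> Cod C u = Dom C (sq_right s) \<longrightarrow> Cod C v = Dom C (sq_bot s) \<longrightarrow>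
        Comp C (sq_right s) u = Comp C (sq_bot s) v \<longrightarrow>
        (\<exists>!w. in_hom C w (Dom C u) (Dom C (sq_top s)) \<and>
              Comp C (sq_top s) w = u \<and> Comp C (sq_left s) w = v))"


section \<open>Contextual categories\<close>

record ('o, 'm) ctxcat = "('o, 'm) cat" +
  Len :: "'o \<Rightarrow> nat"
  Par :: "'o \<Rightarrow> 'o"  \<comment> \<open>the operation \<open>\<partial>\<close> on objects\<close>
  Pr :: "'o \<Rightarrow> 'm"  \<comment> \<open>\<open>Pr C a : a \<rightarrow> \<partial>a\<close>, meaningful for \<open>Len C a \<ge> 1\<close>\<close>
  SqQ :: "'m square set"

definition precontextual :: "('o, 'm) ctxcat \<Rightarrow> bool" where
  "precontextual C \<longleftrightarrow> category C \<and>
     (\<forall>a\<in>Obj C. Par C a \<in> Obj C \<and>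
        (Len C a \<ge> 1 \<longrightarrow> Len C (Par C a) = Len C a - 1) \<and>
        (Len C a = 0 \<longrightarrow> Par C a = a) \<and>
        (Len C a \<ge> 1 \<longrightarrow> in_hom C (Pr C a) a (Par C a))) \<and>
     (\<forall>s\<in>SqQ C. commutative_square C s \<and>
        (\<exists>a\<in>Obj C. Len C a \<ge> 1 \<and> sq_left s = Pr C a) \<and>
        (\<exists>b\<in>Obj C. Len C b \<ge> 1 \<and> sq_right s = Pr C b))"

definition terminal_object :: "('o, 'm, 'z) cat_scheme \<Rightarrow> 'o \<Rightarrow> bool" where
  "terminal_object C t \<longleftrightarrow> t \<in> Obj C \<and> (\<forall>a\<in>Obj C. \<exists>!f. in_hom C f a t)"

definition contextual :: "('o, 'm) ctxcat \<Rightarrow> bool" where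
  "contextual C \<longleftrightarrow> precontextual C \<and>
     (\<exists>!t. t \<in> Obj C \<and> Len C t = 0) \<and>
     (\<forall>t\<in>Obj C. Len C t = 0 \<longrightarrow> terminal_object C t) \<and>
     (\<forall>s\<in>SqQ C. pullback_square C s) \<and>
     (\<forall>a\<in>Obj C. Len C a \<ge> 1 \<longrightarrow>
        Square (Ide C a) (Pr C a) (Pr C a) (Ide C (Par C a)) \<in> SqQ C) \<and>
     (\<forall>t l m b t' r b'. Square t l m b \<in> SqQ C \<longrightarrow> Square t' m r b' \<in> SqQ C \<longrightarrow>
        Square (Comp C t' t) l r (Comp C b' b) \<in> SqQ C) \<and>
     (\<forall>a\<in>Obj C. \<forall>f\<in>Arr C. Len C a \<ge> 1 \<longrightarrow> Cod C f = Par C a \<longrightarrow>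
        (\<exists>!s. s \<in> SqQ C \<and> sq_right s = Pr C a \<and> sq_bot s = f))"

definition ctx_one :: "('o, 'm) ctxcat \<Rightarrow> 'o" where
  "ctx_one C = (THE t. t \<in> Obj C \<and> Len C t = 0)"

definition to_one :: "('o, 'm) ctxcat \<Rightarrow> 'o \<Rightarrow> 'm" where
  "to_one C a = (THE f. in_hom C f a (ctx_one C))"

inductive display_map :: "('o, 'm) ctxcat \<Rightarrow> 'm \<Rightarrow> bool" for C where
  display_ide: "a \<in> Obj C \<Longrightarrow> display_map C (Ide C a)"
| display_step: "display_map C f \<Longrightarrow> Len C (Cod C f) \<ge> 1 \<Longrightarrow>
    display_map C (Comp C (Pr C (Cod C f)) f)"

definition display_map_len1 :: "('o, 'm) ctxcat \<Rightarrow> 'm \<Rightarrow> bool" where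
  "display_map_len1 C f \<longleftrightarrow> display_map C f \<and> Len C (Dom C f) = Len C (Cod C f) + 1"

text \<open>\<open>vcomp_squares C k s\<close>: \<open>s\<close> is the vertical composite of \<open>k\<close> elements of \<open>SqQ C\<close>.
  The empty composites are the squares whose vertical sides are identities.\<close>

inductive vcomp_squares :: "('o, 'm) ctxcat \<Rightarrow> nat \<Rightarrow> 'm square \<Rightarrow> bool" for C where
  vcomp_empty: "f \<in> Arr C \<Longrightarrow>
    vcomp_squares C 0 (Square f (Ide C (Dom C f)) (Ide C (Cod C f)) f)"
| vcomp_step: "vcomp_squares C k (Square t l r m) \<Longrightarrow> Square m l' r' b \<in> SqQ C \<Longrightarrow>
    vcomp_squares C (Suc k) (Square t (Comp C l' l) (Comp C r' r) b)"

definition distinguished :: "('o, 'm) ctxcat \<Rightarrow> 'm square \<Rightarrow> bool" where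
  "distinguished C s \<longleftrightarrow> (\<exists>k. vcomp_squares C k s)"


section \<open>Cellular diagrams\<close>

text \<open>A poset is given by a carrier \<open>P\<close> and a relation \<open>le\<close>; only the values of \<open>le\<close> on \<open>P\<close>
  matter.  The letter \<open>lin\<close> stands for a (reflexive) linear order or local linearization.\<close>

definition rel_on :: "'p set \<Rightarrow> ('p \<Rightarrow> 'p \<Rightarrow> bool) \<Rightarrow> ('p \<times> 'p) set" where
  "rel_on P le = {(x, y). x \<in> P \<and> y \<in> P \<and> le x y}"

definition down :: "'p set \<Rightarrow> ('p \<Rightarrow> 'p \<Rightarrow> bool) \<Rightarrow> 'p \<Rightarrow> 'p set" where
  "down P le x = {y \<in> P. le y x}"

definition bdry :: "'p set \<Rightarrow> ('p \<Rightarrow> 'p \<Rightarrow> bool) \<Rightarrow> 'p \<Rightarrow> 'p set" where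
  "bdry P le x = {y \<in> P. le y x \<and> y \<noteq> x}"

definition sieve :: "'p set \<Rightarrow> ('p \<Rightarrow> 'p \<Rightarrow> bool) \<Rightarrow> 'p set \<Rightarrow> bool" where
  "sieve P le X \<longleftrightarrow> X \<subseteq> P \<and> (\<forall>x\<in>X. \<forall>y\<in>P. le y x \<longrightarrow> y \<in> X)"

definition local_linearization ::
  "'p set \<Rightarrow> ('p \<Rightarrow> 'p \<Rightarrow> bool) \<Rightarrow> ('p \<Rightarrow> 'p \<Rightarrow> bool) \<Rightarrow> bool" where
  "local_linearization P le lin \<longleftrightarrow>
     (\<forall>x\<in>P. \<forall>y\<in>P. lin x y \<longrightarrow> (\<exists>z\<in>P. le x z \<and> le y z)) \<and>
     (\<forall>z\<in>P. linear_order_on (down P le z) (rel_on (down P le z) lin) \<and>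
        rel_on (down P le z) le \<subseteq> rel_on (down P le z) lin)"

text \<open>A functor from the opposite of \<open>(P, le)\<close> consists of objects \<open>Do x\<close> and arrows
  \<open>Dm y x : Do y \<rightarrow> Do x\<close> for \<open>le x y\<close>.\<close>

definition poset_op_functor ::
  "('o, 'm, 'z) cat_scheme \<Rightarrow> 'p set \<Rightarrow> ('p \<Rightarrow> 'p \<Rightarrow> bool) \<Rightarrow> ('p \<Rightarrow> 'o) \<Rightarrow> ('p \<Rightarrow> 'p \<Rightarrow> 'm) \<Rightarrow> bool" where
  "poset_op_functor C P le Do Dm \<longleftrightarrow>
     (\<forall>x\<in>P. Do x \<in> Obj C) \<and>
     (\<forall>x\<in>P. \<forall>y\<in>P. le x y \<longrightarrow> in_hom C (Dm y x) (Do y) (Do x)) \<and>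
     (\<forall>x\<in>P. Dm x x = Ide C (Do x)) \<and>
     (\<forall>x\<in>P. \<forall>y\<in>P. \<forall>z\<in>P. le x y \<longrightarrow> le y z \<longrightarrow> Dm z x = Comp C (Dm y x) (Dm z y))"

definition cone ::
  "('o, 'm, 'z) cat_scheme \<Rightarrow> 'p set \<Rightarrow> ('p \<Rightarrow> 'p \<Rightarrow> bool) \<Rightarrow> ('p \<Rightarrow> 'o) \<Rightarrow> ('p \<Rightarrow> 'p \<Rightarrow> 'm) \<Rightarrow>
   'o \<Rightarrow> ('p \<Rightarrow> 'm) \<Rightarrow> bool" where
  "cone C X le Do Dm a c \<longleftrightarrow> a \<in> Obj C \<and>
     (\<forall>x\<in>X. in_hom C (c x) a (Do x)) \<and>
     (\<forall>x\<in>X. \<forall>y\<in>X. le x y \<longrightarrow> Comp C (Dm y x) (c y) = c x)"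

definition limit_cone ::
  "('o, 'm, 'z) cat_scheme \<Rightarrow> 'p set \<Rightarrow> ('p \<Rightarrow> 'p \<Rightarrow> bool) \<Rightarrow> ('p \<Rightarrow> 'o) \<Rightarrow> ('p \<Rightarrow> 'p \<Rightarrow> 'm) \<Rightarrow>
   'o \<Rightarrow> ('p \<Rightarrow> 'm) \<Rightarrow> bool" where
  "limit_cone C X le Do Dm a c \<longleftrightarrow> cone C X le Do Dm a c \<and>
     (\<forall>b d. cone C X le Do Dm b d \<longrightarrow>
        (\<exists>!u. in_hom C u b a \<and> (\<forall>x\<in>X. Comp C (c x) u = d x)))"

text \<open>The map \<open>a\<^sup>Y \<rightarrow> a\<^sup>X\<close> induced by the limit cones, for sieves \<open>X \<subseteq> Y\<close>.\<close>

definition restr_map ::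
  "('o, 'm, 'z) cat_scheme \<Rightarrow> ('p set \<Rightarrow> 'o) \<Rightarrow> ('p set \<Rightarrow> 'p \<Rightarrow> 'm) \<Rightarrow> 'p set \<Rightarrow> 'p set \<Rightarrow> 'm" where
  "restr_map C a c Y X =
     (THE u. in_hom C u (a Y) (a X) \<and> (\<forall>x\<in>X. Comp C (c X x) u = c Y x))"

definition cellular_choice ::
  "('o, 'm) ctxcat \<Rightarrow> 'p set \<Rightarrow> ('p \<Rightarrow> 'p \<Rightarrow> bool) \<Rightarrow> ('p \<Rightarrow> 'p \<Rightarrow> bool) \<Rightarrow>
   ('p \<Rightarrow> 'o) \<Rightarrow> ('p \<Rightarrow> 'p \<Rightarrow> 'm) \<Rightarrow> ('p set \<Rightarrow> 'o) \<Rightarrow> ('p set \<Rightarrow> 'p \<Rightarrow> 'm) \<Rightarrow> bool" where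
  "cellular_choice C P le lin Do Dm a c \<longleftrightarrow>
     (\<forall>X. sieve P le X \<longrightarrow> limit_cone C X le Do Dm (a X) (c X)) \<and>
     a {} = ctx_one C \<and>
     (\<forall>x\<in>P. a (down P le x) = Do x \<and> (\<forall>y\<in>down P le x. c (down P le x) y = Dm x y)) \<and>
     (\<forall>X Y y. sieve P le X \<longrightarrow> sieve P le Y \<longrightarrow> X \<subseteq> Y \<longrightarrow> Y - X = {y} \<longrightarrow> (\<forall>x\<in>X. lin x y) \<longrightarrow>
        display_map_len1 C (restr_map C a c Y X)) \<and>
     (\<forall>X X' Y Y' y. sieve P le X \<longrightarrow> sieve P le X' \<longrightarrow> sieve P le Y \<longrightarrow> sieve P le Y' \<longrightarrow>
        X \<subseteq> X' \<longrightarrow> Y \<subseteq> Y' \<longrightarrow> X \<subseteq> Y \<longrightarrow> X' \<subseteq> Y' \<longrightarrow>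
        Y - X = {y} \<longrightarrow> Y' - X' = {y} \<longrightarrow> (\<forall>x\<in>X'. lin x y) \<longrightarrow>
        distinguished C (Square (restr_map C a c Y' Y) (restr_map C a c Y' X')
          (restr_map C a c Y X) (restr_map C a c X' X)))"

text \<open>Cellularity of a functor on the opposite of a poset \<open>P\<close> with all \<open>down P le x\<close> finite and
  with local linearization \<open>lin\<close>.\<close>

definition cellular ::
  "('o, 'm) ctxcat \<Rightarrow> 'p set \<Rightarrow> ('p \<Rightarrow> 'p \<Rightarrow> bool) \<Rightarrow> ('p \<Rightarrow> 'p \<Rightarrow> bool) \<Rightarrow>
   ('p \<Rightarrow> 'o) \<Rightarrow> ('p \<Rightarrow> 'p \<Rightarrow> 'm) \<Rightarrow> bool" where
  "cellular C P le lin Do Dm \<longleftrightarrow>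
     partial_order_on P (rel_on P le) \<and> (\<forall>x\<in>P. finite (down P le x)) \<and>
     local_linearization P le lin \<and>
     poset_op_functor C P le Do Dm \<and>
     (\<forall>x\<in>P. \<exists>a c. cellular_choice C (down P le x) le lin Do Dm a c)"

text \<open>The object \<open>F[X]\<close> and its limit cone, for a sieve \<open>X\<close> in the finite poset \<open>P\<close>; they are
  well defined on sieves because a cellular choice is unique there.\<close>

definition cell_obj ::
  "('o, 'm) ctxcat \<Rightarrow> 'p set \<Rightarrow> ('p \<Rightarrow> 'p \<Rightarrow> bool) \<Rightarrow> ('p \<Rightarrow> 'p \<Rightarrow> bool) \<Rightarrow>
   ('p \<Rightarrow> 'o) \<Rightarrow> ('p \<Rightarrow> 'p \<Rightarrow> 'm) \<Rightarrow> 'p set \<Rightarrow> 'o" where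
  "cell_obj C P le lin Do Dm X =
     (THE b. \<exists>a c. cellular_choice C P le lin Do Dm a c \<and> a X = b)"

definition cell_cone ::
  "('o, 'm) ctxcat \<Rightarrow> 'p set \<Rightarrow> ('p \<Rightarrow> 'p \<Rightarrow> bool) \<Rightarrow> ('p \<Rightarrow> 'p \<Rightarrow> bool) \<Rightarrow>
   ('p \<Rightarrow> 'o) \<Rightarrow> ('p \<Rightarrow> 'p \<Rightarrow> 'm) \<Rightarrow> 'p set \<Rightarrow> 'p \<Rightarrow> 'm" where
  "cell_cone C P le lin Do Dm X x =
     (THE g. \<exists>a c. cellular_choice C P le lin Do Dm a c \<and> c X x = g)"


section \<open>Multimorphisms\<close>

definition T_obj :: "('o, 'm) ctxcat \<Rightarrow> 'o set" where
  "T_obj A = {x \<in> Obj A. Len A x \<ge> 1}"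

definition T_le :: "('o, 'm) ctxcat \<Rightarrow> 'o \<Rightarrow> 'o \<Rightarrow> bool" where
  "T_le A x y \<longleftrightarrow> (\<exists>f. display_map A f \<and> Dom A f = y \<and> Cod A f = x)"

definition T_map :: "('o, 'm) ctxcat \<Rightarrow> 'o \<Rightarrow> 'o \<Rightarrow> 'm" where
  "T_map A y x = (THE f. display_map A f \<and> Dom A f = y \<and> Cod A f = x)"

definition TP_obj :: "('o, 'm) ctxcat list \<Rightarrow> 'o list set" where
  "TP_obj As = {xs. length xs = length As \<and> (\<forall>i<length As. xs ! i \<in> T_obj (As ! i))}"

definition TP_le :: "('o, 'm) ctxcat list \<Rightarrow> 'o list \<Rightarrow> 'o list \<Rightarrow> bool" where
  "TP_le As xs ys \<longleftrightarrow> (\<forall>i<length As. T_le (As ! i) (xs ! i) (ys ! i))"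

definition TP_lex :: "('o, 'm) ctxcat list \<Rightarrow> 'o list \<Rightarrow> 'o list \<Rightarrow> bool" where
  "TP_lex As xs ys \<longleftrightarrow> xs = ys \<or>
     (\<exists>i<length As. (\<forall>j<i. xs ! j = ys ! j) \<and>
        T_le (As ! i) (xs ! i) (ys ! i) \<and> xs ! i \<noteq> ys ! i \<and>
        (\<forall>j. i < j \<longrightarrow> j < length As \<longrightarrow>
           T_le (As ! j) (xs ! j) (ys ! j) \<or> T_le (As ! j) (ys ! j) (xs ! j)))"

text \<open>The morphism part of the restriction of a functor on \<open>prod_cat As\<close> to the opposite of
  the poset \<open>TP_obj As\<close>.\<close>

definition TP_fun :: "('o, 'm) ctxcat list \<Rightarrow> ('m list \<Rightarrow> 'm) \<Rightarrow> 'o list \<Rightarrow> 'o list \<Rightarrow> 'm" where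
  "TP_fun As Fm ys xs = Fm (map (\<lambda>i. T_map (As ! i) (ys ! i) (xs ! i)) [0..<length As])"

text \<open>\<open>F[\<partial>(x\<^sub>1,\<dots>,x\<^sub>n)]\<close>, computed in the finite poset of elements \<open>\<le> (x\<^sub>1,\<dots>,x\<^sub>n)\<close>, and its
  limit cone.\<close>

definition bdry_obj ::
  "('o, 'm) ctxcat list \<Rightarrow> ('o, 'm) ctxcat \<Rightarrow> ('o list \<Rightarrow> 'o) \<Rightarrow> ('m list \<Rightarrow> 'm) \<Rightarrow> 'o list \<Rightarrow> 'o" where
  "bdry_obj As C Fo Fm xs =
     cell_obj C (down (TP_obj As) (TP_le As) xs) (TP_le As) (TP_lex As) Fo (TP_fun As Fm)
       (bdry (TP_obj As) (TP_le As) xs)"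

definition bdry_cone ::
  "('o, 'm) ctxcat list \<Rightarrow> ('o, 'm) ctxcat \<Rightarrow> ('o list \<Rightarrow> 'o) \<Rightarrow> ('m list \<Rightarrow> 'm) \<Rightarrow>
   'o list \<Rightarrow> 'o list \<Rightarrow> 'm" where
  "bdry_cone As C Fo Fm xs zs =
     cell_cone C (down (TP_obj As) (TP_le As) xs) (TP_le As) (TP_lex As) Fo (TP_fun As Fm)
       (bdry (TP_obj As) (TP_le As) xs) zs"

definition bdry_proj ::
  "('o, 'm) ctxcat list \<Rightarrow> ('o, 'm) ctxcat \<Rightarrow> ('o list \<Rightarrow> 'o) \<Rightarrow> ('m list \<Rightarrow> 'm) \<Rightarrow> 'o list \<Rightarrow> 'm" where
  "bdry_proj As C Fo Fm xs =
     (THE u. in_hom C u (Fo xs) (bdry_obj As C Fo Fm xs) \<and>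
        (\<forall>zs\<in>bdry (TP_obj As) (TP_le As) xs.
           Comp C (bdry_cone As C Fo Fm xs zs) u = TP_fun As Fm xs zs))"

text \<open>\<open>pick n I ws0 ws1\<close> is \<open>(w\<^sub>1,\<dots>,w\<^sub>n)\<close> with upper indices \<open>\<chi>\<^sub>I\<close>, for \<open>I\<close> a set of (0-based)
  indices.\<close>

definition pick :: "nat \<Rightarrow> nat set \<Rightarrow> 'a list \<Rightarrow> 'a list \<Rightarrow> 'a list" where
  "pick n I ws0 ws1 = map (\<lambda>i. if i \<in> I then ws1 ! i else ws0 ! i) [0..<n]"

text \<open>The component at a nonempty \<open>I\<close> of the limit cone exhibiting \<open>F[\<partial>(x\<^sub>1,\<dots>,x\<^sub>n)]\<close> as the
  limit of the objects \<open>F(pick n I xs (map2 Par As xs))\<close>.  If some entry of the tuple at \<open>I\<close> has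
  length 0, that tuple lies outside the poset \<open>TP_obj As\<close>, but then the value of \<open>F\<close> at it is
  the terminal object.\<close>

definition face_cone ::
  "('o, 'm) ctxcat list \<Rightarrow> ('o, 'm) ctxcat \<Rightarrow> ('o list \<Rightarrow> 'o) \<Rightarrow> ('m list \<Rightarrow> 'm) \<Rightarrow>
   'o list \<Rightarrow> nat set \<Rightarrow> 'm" where
  "face_cone As C Fo Fm xs I =
     (let zs = pick (length As) I xs (map2 Par As xs) in
      if zs \<in> TP_obj As then bdry_cone As C Fo Fm xs zs
      else to_one C (bdry_obj As C Fo Fm xs))"

text \<open>The map \<open>F[\<partial>xs] \<rightarrow> F[\<partial>ys]\<close> induced on limits by top maps \<open>fs0 : xs \<rightarrow> ys\<close> and bottom
  maps \<open>fs1\<close>.\<close>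

definition bdry_map ::
  "('o, 'm) ctxcat list \<Rightarrow> ('o, 'm) ctxcat \<Rightarrow> ('o list \<Rightarrow> 'o) \<Rightarrow> ('m list \<Rightarrow> 'm) \<Rightarrow>
   'o list \<Rightarrow> 'o list \<Rightarrow> 'm list \<Rightarrow> 'm list \<Rightarrow> 'm" where
  "bdry_map As C Fo Fm xs ys fs0 fs1 =
     (THE u. in_hom C u (bdry_obj As C Fo Fm xs) (bdry_obj As C Fo Fm ys) \<and>
        (\<forall>I. I \<subseteq> {..<length As} \<longrightarrow> I \<noteq> {} \<longrightarrow>
           Comp C (face_cone As C Fo Fm ys I) u =
           Comp C (Fm (pick (length As) I fs0 fs1)) (face_cone As C Fo Fm xs I)))"

definition multimorphism ::
  "('o, 'm) ctxcat list \<Rightarrow> ('o, 'm) ctxcat \<Rightarrow> ('o list \<Rightarrow> 'o) \<Rightarrow> ('m list \<Rightarrow> 'm) \<Rightarrow> bool" where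
  "multimorphism As C Fo Fm \<longleftrightarrow>
     is_functor (prod_cat As) C Fo Fm \<and>
     (\<forall>xs\<in>Obj (prod_cat As). (\<exists>i<length As. Len (As ! i) (xs ! i) = 0) \<longrightarrow> Fo xs = ctx_one C) \<and>
     cellular C (TP_obj As) (TP_le As) (TP_lex As) Fo (TP_fun As Fm) \<and>
     (\<forall>ss. length ss = length As \<longrightarrow> (\<forall>i<length As. ss ! i \<in> SqQ (As ! i)) \<longrightarrow>
        (let fs0 = map sq_top ss;
             fs1 = map sq_bot ss;
             xs = map2 Dom As fs0;
             ys = map2 Cod As fs0
         in distinguished C (Square (Fm fs0) (bdry_proj As C Fo Fm xs) (bdry_proj As C Fo Fm ys)
              (bdry_map As C Fo Fm xs ys fs0 fs1))))"


section \<open>Multicategories\<close>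

record ('c, 'f) multicat =
  MObj :: "'c set"
  MHom :: "'c list \<Rightarrow> 'c \<Rightarrow> 'f set"
  MIde :: "'c \<Rightarrow> 'f"
  MComp :: "'c list list \<Rightarrow> 'c list \<Rightarrow> 'c \<Rightarrow> 'f \<Rightarrow> 'f list \<Rightarrow> 'f"

text \<open>\<open>MComp M Ass Bs C g fs\<close> is \<open>g \<circ> (f\<^sub>1,\<dots>,f\<^sub>n)\<close> for \<open>g\<close> from \<open>Bs\<close> to \<open>C\<close> and \<open>f\<^sub>i\<close> from the
  \<open>i\<close>-th list of \<open>Ass\<close> to the \<open>i\<close>-th entry of \<open>Bs\<close>.  The following predicate says that
  \<open>g, fs\<close> are composable of this shape, with all arrows taken from the family \<open>H\<close>.\<close>

definition mcomposable ::
  "('c, 'f) multicat \<Rightarrow> ('c list \<Rightarrow> 'c \<Rightarrow> 'f set) \<Rightarrow>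
   'c list list \<Rightarrow> 'c list \<Rightarrow> 'c \<Rightarrow> 'f \<Rightarrow> 'f list \<Rightarrow> bool" where
  "mcomposable M H Ass Bs C g fs \<longleftrightarrow>
     (\<forall>As\<in>set Ass. set As \<subseteq> MObj M) \<and> set Bs \<subseteq> MObj M \<and> C \<in> MObj M \<and>
     length Ass = length Bs \<and> length fs = length Bs \<and>
     g \<in> H Bs C \<and> (\<forall>i<length Bs. fs ! i \<in> H (Ass ! i) (Bs ! i))"

definition closed_under_mcomp ::
  "('c, 'f) multicat \<Rightarrow> ('c list \<Rightarrow> 'c \<Rightarrow> 'f set) \<Rightarrow> bool" where
  "closed_under_mcomp M H \<longleftrightarrow>
     (\<forall>Ass Bs C g fs. mcomposable M H Ass Bs C g fs \<longrightarrow>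
        MComp M Ass Bs C g fs \<in> H (concat Ass) C)"

definition multicategory :: "('c, 'f) multicat \<Rightarrow> bool" where
  "multicategory M \<longleftrightarrow>
     (\<forall>A\<in>MObj M. MIde M A \<in> MHom M [A] A) \<and>
     closed_under_mcomp M (MHom M) \<and>
     (\<forall>As B f. set As \<subseteq> MObj M \<longrightarrow> B \<in> MObj M \<longrightarrow> f \<in> MHom M As B \<longrightarrow>
        MComp M [As] [B] B (MIde M B) [f] = f \<and>
        MComp M (map (\<lambda>A. [A]) As) As B f (map (MIde M) As) = f) \<and>
     (\<forall>Asss Bss Cs D h gs fss.
        mcomposable M (MHom M) Bss Cs D h gs \<longrightarrow>
        length Asss = length Cs \<longrightarrow> length fss = length Cs \<longrightarrow>
        (\<forall>i<length Cs. mcomposable M (MHom M) (Asss ! i) (Bss ! i) (Cs ! i) (gs ! i) (fss ! i)) \<longrightarrow>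
        MComp M (concat Asss) (concat Bss) D (MComp M Bss Cs D h gs) (concat fss) =
        MComp M (map concat Asss) Cs D h
          (map (\<lambda>i. MComp M (Asss ! i) (Bss ! i) (Cs ! i) (gs ! i) (fss ! i)) [0..<length Cs]))"

text \<open>\<open>H\<close> defines a sub-multicategory of \<open>M\<close> with the same objects.\<close>

definition sub_multicategory ::
  "('c, 'f) multicat \<Rightarrow> ('c list \<Rightarrow> 'c \<Rightarrow> 'f set) \<Rightarrow> bool" where
  "sub_multicategory M H \<longleftrightarrow> multicategory M \<and>
     (\<forall>As B. set As \<subseteq> MObj M \<longrightarrow> B \<in> MObj M \<longrightarrow> H As B \<subseteq> MHom M As B) \<and>
     (\<forall>A\<in>MObj M. MIde M A \<in> H [A] A) \<and>
     closed_under_mcomp M H"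


section \<open>The multicategory of contextual categories and functors\<close>

text \<open>A functor is stored as its pair of object and arrow maps.  To make equality of such pairs
  coincide with equality of functors, both maps are required to be \<open>undefined\<close> off the domain
  category.\<close>

type_synonym ('o, 'm) nfun = "('o list \<Rightarrow> 'o) \<times> ('m list \<Rightarrow> 'm)"

definition Fun_set :: "('o, 'm) ctxcat list \<Rightarrow> ('o, 'm) ctxcat \<Rightarrow> ('o, 'm) nfun set" where
  "Fun_set As B = {(Fo, Fm). is_functor (prod_cat As) B Fo Fm \<and>
     Fo \<in> extensional (Obj (prod_cat As)) \<and> Fm \<in> extensional (Arr (prod_cat As))}"

text \<open>\<open>split_by Ass xs\<close> cuts a list with entries indexed by \<open>concat Ass\<close> into blocks indexed by
  the lists in \<open>Ass\<close>.\<close>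

fun split_by :: "'a list list \<Rightarrow> 'b list \<Rightarrow> 'b list list" where
  "split_by [] xs = []"
| "split_by (As # Ass) xs = take (length As) xs # split_by Ass (drop (length As) xs)"

definition Fun_ide :: "('o, 'm) ctxcat \<Rightarrow> ('o, 'm) nfun" where
  "Fun_ide A = (restrict hd (Obj (prod_cat [A])), restrict hd (Arr (prod_cat [A])))"

definition Fun_comp ::
  "('o, 'm) ctxcat list list \<Rightarrow> ('o, 'm) nfun \<Rightarrow> ('o, 'm) nfun list \<Rightarrow> ('o, 'm) nfun" where
  "Fun_comp Ass G Fs =
     (restrict (\<lambda>xs. fst G (map2 (\<lambda>F ys. fst F ys) Fs (split_by Ass xs))) (Obj (prod_cat (concat Ass))),
      restrict (\<lambda>fs. snd G (map2 (\<lambda>F gs. snd F gs) Fs (split_by Ass fs))) (Arr (prod_cat (concat Ass))))"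

definition Cont_fun :: "(('o, 'm) ctxcat, ('o, 'm) nfun) multicat" where
  "Cont_fun =
     \<lparr> MObj = {A. contextual A},
       MHom = Fun_set,
       MIde = Fun_ide,
       MComp = (\<lambda>Ass Bs C G Fs. Fun_comp Ass G Fs) \<rparr>"

definition Cont_Hom :: "('o, 'm) ctxcat list \<Rightarrow> ('o, 'm) ctxcat \<Rightarrow> ('o, 'm) nfun set" where
  "Cont_Hom As B =
     (if As = [] then {(Fo, Fm) \<in> Fun_set [] B. Len B (Fo []) = 1}
      else {(Fo, Fm) \<in> Fun_set As B. multimorphism As B Fo Fm})"

end

theory Submission
  imports Defs
begin

text \<open>A cellular choice is unique, and it exists as soon as every induced map \<open>F(x) \<rightarrow> F[\<partial>x]\<close> is a
  display map of length 1: if \<open>m\<close> is the largest element of a sieve \<open>X\<close> for the linear order, then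
  \<open>F[X]\<close> is the canonical pullback of \<open>F(m) \<rightarrow> F[\<partial>m]\<close> along \<open>F[X - {m}] \<rightarrow> F[\<partial>m]\<close>.

  For a composite \<open>H = G(F\<^sub>1,\<dots>,F\<^sub>n)\<close>, the map \<open>u \<mapsto> F\<^sub>i[{v. v \<le> u in the linear order}]\<close> is an isomorphism
  from the linearly ordered set of elements below \<open>x\<^sub>i\<close> to the chain of elements below \<open>F\<^sub>i(x\<^sub>i)\<close>, so that
  every sieve \<open>Z\<close> below \<open>F(x)\<close> corresponds to a sieve below \<open>x\<close>.  By induction on \<open>Z\<close>, removing its
  lexicographically largest element, this sieve has limit \<open>G[Z]\<close>: the two objects arise from squares
  with the same right side and the same bottom, because \<open>G\<close> preserves the distinguished squares
  relating the initial segments in the \<open>i\<close>-th variable to the boundaries there.  In particular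
  \<open>H[\<partial>x] = G[\<partial>F(x)]\<close>, which gives both the cellularity of \<open>H\<close> and its condition on squares.

  A functor without arguments satisfies the conditions on multimorphisms exactly if its value has
  length 1, so arity 0 needs no separate treatment in the composition.\<close>


section \<open>Contextual categories\<close>

text \<open>What has to be shown is equality of objects, not isomorphism: the limits of a cellular
  composite must be objects of \<open>C\<close> linked by the maps \<open>Pr\<close>. The engine is
  therefore that right side and bottom determine an element of \<open>SqQ\<close>: two squares
  sharing them have equal tops and equal left sides. The obstacle is that the objects of positive
  length below F_i(x_i) are not the values F_i(u) with u below x_i, but the limits F_i[S] over
  nonempty initial segments S. The cell structure of G below F(x) thus involves G at tuples of such
  partial limits, which need not be values of H. The bridge is the square with top F_i[S] -> F_i(u),
  where u is the largest element of S. It lies in \<open>SqQ\<close> because F_i is cellular, so the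
  condition of G on squares applies to it and relates G at the partial limits to G at F(u). Hence
  the cellularity of H rests on the condition of G on squares as well as on its cellularity. Two
  inductions are nested: an outer one over x, which identifies the boundaries, and an inner one over
  the sieves below F(x).\<close>

lemma in_hom_arr: "in_hom C f a b \<Longrightarrow> f \<in> Arr C"
  by (simp add: in_hom_def)

lemma in_hom_cod: "in_hom C f a b \<Longrightarrow> Cod C f = b"
  by (simp add: in_hom_def)

lemma distinguished_if_SqQ:
  assumes "category C" "commutative_square C s" "s \<in> SqQ C"
  shows "distinguished C s"
proof -
  obtain t l r b where s: "s = Square t l r b" by (cases s)
  have c: "t \<in> Arr C" "l \<in> Arr C" "r \<in> Arr C" "Dom C t = Dom C l" "Cod C t = Dom C r"
    using assms(2) by (auto simp: commutative_square_def s)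
  have "vcomp_squares C (Suc 0) (Square t (Comp C l (Ide C (Dom C t))) (Comp C r (Ide C (Cod C t))) b)"
    using assms(3) unfolding s by (intro vcomp_step[OF vcomp_empty] c)
  moreover have "Comp C l (Ide C (Dom C t)) = l" "Comp C r (Ide C (Cod C t)) = r"
    using assms(1) c by (auto simp: category_def)
  ultimately show ?thesis by (auto simp: distinguished_def s)
qed

section \<open>The axioms of a contextual category in elementwise form\<close>

locale ctx =
  fixes C :: "('o, 'm) ctxcat"
  assumes contextual: "contextual C"
begin

lemma precontextual: "precontextual C"
  using contextual by (simp add: contextual_def)

lemma category: "category C"
  using precontextual by (simp add: precontextual_def)

lemma in_homI: "f \<in> Arr C \<Longrightarrow> in_hom C f (Dom C f) (Cod C f)"
  by (simp add: in_hom_def)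

lemma in_hom_obj: "in_hom C f a b \<Longrightarrow> a \<in> Obj C" "in_hom C f a b \<Longrightarrow> b \<in> Obj C"
  using category by (auto simp: category_def in_hom_def)

lemma ide_hom: "a \<in> Obj C \<Longrightarrow> in_hom C (Ide C a) a a"
  using category by (auto simp: category_def)

lemma comp_hom: "in_hom C g b c \<Longrightarrow> in_hom C f a b \<Longrightarrow> in_hom C (Comp C g f) a c"
  using category by (auto simp: category_def in_hom_def)

lemma comp_ide: "in_hom C f a b \<Longrightarrow> Comp C f (Ide C a) = f"
  using category by (auto simp: category_def in_hom_def)

lemma ide_comp: "in_hom C f a b \<Longrightarrow> Comp C (Ide C b) f = f"
  using category by (auto simp: category_def in_hom_def)

lemma comp_assoc:
  "in_hom C h c d \<Longrightarrow> in_hom C g b c \<Longrightarrow> in_hom C f a b \<Longrightarrow>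
   Comp C (Comp C h g) f = Comp C h (Comp C g f)"
  using category by (auto simp: category_def in_hom_def)

lemma Par_obj: "a \<in> Obj C \<Longrightarrow> Par C a \<in> Obj C"
  using precontextual by (auto simp: precontextual_def)

lemma Len_Par: "a \<in> Obj C \<Longrightarrow> Len C (Par C a) = Len C a - 1"
  using precontextual unfolding precontextual_def by (cases "Len C a = 0") auto

lemma Par_Len0: "a \<in> Obj C \<Longrightarrow> Len C a = 0 \<Longrightarrow> Par C a = a"
  using precontextual by (auto simp: precontextual_def)

lemma Pr_hom: "a \<in> Obj C \<Longrightarrow> 1 \<le> Len C a \<Longrightarrow> in_hom C (Pr C a) a (Par C a)"
  using precontextual by (auto simp: precontextual_def)

lemma one_obj: "ctx_one C \<in> Obj C" and Len_one: "Len C (ctx_one C) = 0"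
proof -
  have "\<exists>!t. t \<in> Obj C \<and> Len C t = 0" using contextual by (simp add: contextual_def)
  from theI'[OF this] show "ctx_one C \<in> Obj C" "Len C (ctx_one C) = 0" by (auto simp: ctx_one_def)
qed

lemma Len0_one: "a \<in> Obj C \<Longrightarrow> Len C a = 0 \<Longrightarrow> a = ctx_one C"
proof -
  have "\<exists>!t. t \<in> Obj C \<and> Len C t = 0" using contextual by (simp add: contextual_def)
  then show "a \<in> Obj C \<Longrightarrow> Len C a = 0 \<Longrightarrow> a = ctx_one C" using one_obj Len_one by blast
qed

lemma one_terminal: "a \<in> Obj C \<Longrightarrow> \<exists>!f. in_hom C f a (ctx_one C)"
  using contextual one_obj Len_one by (auto simp: contextual_def terminal_object_def)

lemma to_one_hom: "a \<in> Obj C \<Longrightarrow> in_hom C (to_one C a) a (ctx_one C)"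
  unfolding to_one_def by (rule theI', rule one_terminal)

lemma to_one_unique:
  "in_hom C f a (ctx_one C) \<Longrightarrow> in_hom C g a (ctx_one C) \<Longrightarrow> f = g"
  using one_terminal in_hom_obj by blast

lemma SqQ_commutative: "s \<in> SqQ C \<Longrightarrow> commutative_square C s"
  using precontextual by (auto simp: precontextual_def)

lemma SqQ_cases:
  assumes "Square t l r b \<in> SqQ C"
  obtains a e where "l = Pr C a" "r = Pr C e" "a \<in> Obj C" "e \<in> Obj C" "1 \<le> Len C a" "1 \<le> Len C e"
    "in_hom C t a e" "in_hom C b (Par C a) (Par C e)" "Comp C r t = Comp C b l"
proof -
  from assms have "commutative_square C (Square t l r b)" by (rule SqQ_commutative)
  moreover from assms obtain a e where "a \<in> Obj C" "e \<in> Obj C" "1 \<le> Len C a" "1 \<le> Len C e"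
    "l = Pr C a" "r = Pr C e"
    using precontextual unfolding precontextual_def by (metis square.sel(2,3))
  moreover from this have "in_hom C l a (Par C a)" "in_hom C r e (Par C e)"
    by (auto intro: Pr_hom)
  ultimately show thesis
    by (intro that[of a e]) (auto simp: commutative_square_def in_hom_def)
qed

text \<open>An arrow has only one domain. This is the passage from equal maps, as
  \<open>SqQ_unique\<close> supplies them, to equal objects.\<close>

lemma Pr_inj:
  assumes "Pr C a = Pr C b" "a \<in> Obj C" "b \<in> Obj C" "1 \<le> Len C a" "1 \<le> Len C b"
  shows "a = b"
  using Pr_hom[OF assms(2,4)] Pr_hom[OF assms(3,5)] assms(1) by (auto simp: in_hom_def)

lemma SqQ_Pr_hom:
  assumes "Square t (Pr C a) (Pr C e) b \<in> SqQ C" "a \<in> Obj C" "1 \<le> Len C a" "e \<in> Obj C" "1 \<le> Len C e"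
  shows "in_hom C t a e" "in_hom C b (Par C a) (Par C e)" "Comp C (Pr C e) t = Comp C b (Pr C a)"
proof -
  from assms(1) obtain a' e' where q: "Pr C a = Pr C a'" "Pr C e = Pr C e'" "a' \<in> Obj C" "e' \<in> Obj C"
    "1 \<le> Len C a'" "1 \<le> Len C e'" "in_hom C t a' e'" "in_hom C b (Par C a') (Par C e')"
    "Comp C (Pr C e) t = Comp C b (Pr C a)"
    by (rule SqQ_cases)
  have "a = a'" "e = e'" using Pr_inj[OF q(1)] Pr_inj[OF q(2)] q assms by auto
  with q show "in_hom C t a e" "in_hom C b (Par C a) (Par C e)" "Comp C (Pr C e) t = Comp C b (Pr C a)"
    by auto
qed

lemma SqQ_pullback:
  assumes "Square t (Pr C a) (Pr C e) b \<in> SqQ C" "a \<in> Obj C" "1 \<le> Len C a" "e \<in> Obj C" "1 \<le> Len C e"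
    and "in_hom C u x e" "in_hom C v x (Par C a)" "Comp C (Pr C e) u = Comp C b v"
  shows "\<exists>!w. in_hom C w x a \<and> Comp C t w = u \<and> Comp C (Pr C a) w = v"
proof -
  have "pullback_square C (Square t (Pr C a) (Pr C e) b)"
    using contextual assms(1) by (auto simp: contextual_def)
  then have "\<forall>u\<in>Arr C. \<forall>v\<in>Arr C. Dom C u = Dom C v \<longrightarrow> Cod C u = Dom C (Pr C e) \<longrightarrow>
      Cod C v = Dom C b \<longrightarrow> Comp C (Pr C e) u = Comp C b v \<longrightarrow>
      (\<exists>!w. in_hom C w (Dom C u) (Dom C t) \<and> Comp C t w = u \<and> Comp C (Pr C a) w = v)"
    unfolding pullback_square_def square.sel by (rule conjunct2)
  from this[rule_format, OF in_hom_arr[OF assms(6)] in_hom_arr[OF assms(7)] _ _ _ assms(8)]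
  have "\<exists>!w. in_hom C w (Dom C u) (Dom C t) \<and> Comp C t w = u \<and> Comp C (Pr C a) w = v"
    using assms(6,7) SqQ_Pr_hom(2)[OF assms(1-5)] Pr_hom[OF assms(4,5)] by (simp add: in_hom_def)
  moreover have "Dom C u = x" "Dom C t = a"
    using assms(6) SqQ_Pr_hom(1)[OF assms(1-5)] by (auto simp: in_hom_def)
  ultimately show ?thesis by simp
qed

lemma SqQ_ide:
  "a \<in> Obj C \<Longrightarrow> 1 \<le> Len C a \<Longrightarrow> Square (Ide C a) (Pr C a) (Pr C a) (Ide C (Par C a)) \<in> SqQ C"
  using contextual by (auto simp: contextual_def)

lemma SqQ_hcomp:
  "Square t l m b \<in> SqQ C \<Longrightarrow> Square t' m r b' \<in> SqQ C \<Longrightarrow>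
   Square (Comp C t' t) l r (Comp C b' b) \<in> SqQ C"
  using contextual unfolding contextual_def by blast

lemma SqQ_ex1:
  "e \<in> Obj C \<Longrightarrow> 1 \<le> Len C e \<Longrightarrow> in_hom C f x (Par C e) \<Longrightarrow>
   \<exists>!s. s \<in> SqQ C \<and> sq_right s = Pr C e \<and> sq_bot s = f"
  using contextual unfolding contextual_def in_hom_def by blast

lemma SqQ_exists:
  assumes "e \<in> Obj C" "1 \<le> Len C e" "in_hom C f x (Par C e)"
  obtains t a where "Square t (Pr C a) (Pr C e) f \<in> SqQ C" "a \<in> Obj C" "1 \<le> Len C a"
    "Par C a = x" "in_hom C t a e"
proof -
  obtain s where s: "s \<in> SqQ C" "sq_right s = Pr C e" "sq_bot s = f"
    using SqQ_ex1[OF assms] by blast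
  obtain t l where st: "s = Square t l (Pr C e) f" using s by (cases s) auto
  from s(1) obtain a e' where q: "l = Pr C a" "Pr C e = Pr C e'" "a \<in> Obj C" "e' \<in> Obj C"
    "1 \<le> Len C a" "1 \<le> Len C e'" "in_hom C t a e'" "in_hom C f (Par C a) (Par C e')"
    unfolding st by (rule SqQ_cases)
  have "e = e'" by (rule Pr_inj[OF q(2) assms(1) q(4) assms(2) q(6)])
  moreover have "Par C a = x" using q(8) assms(3) by (simp add: in_hom_def)
  ultimately show thesis
    using q s(1) unfolding st by (intro that[of t a]) simp_all
qed

text \<open>Instance of unique existence in the axiom on canonical pullbacks. All strict equalities
  between limit objects and between their projections are eventually derived from it.\<close>

lemma SqQ_unique:
  assumes "Square t l r b \<in> SqQ C" "Square t' l' r b \<in> SqQ C"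
  shows "t = t'" "l = l'"
proof -
  from assms(1) obtain a e where "r = Pr C e" "e \<in> Obj C" "1 \<le> Len C e" "in_hom C b (Par C a) (Par C e)"
    by (rule SqQ_cases)
  then have "Square t l r b = Square t' l' r b"
    using SqQ_ex1[of e b "Par C a"] assms by (metis square.sel(3,4))
  then show "t = t'" "l = l'" by auto
qed

lemma SqQ_distinguished: "s \<in> SqQ C \<Longrightarrow> distinguished C s"
  by (intro distinguished_if_SqQ category SqQ_commutative)

section \<open>Display maps and the chain of objects below an object\<close>

primrec dsp :: "'o \<Rightarrow> nat \<Rightarrow> 'm" where
  "dsp a 0 = Ide C a"
| "dsp a (Suc k) = Comp C (Pr C ((Par C ^^ k) a)) (dsp a k)"

lemma Par_pow_obj: "a \<in> Obj C \<Longrightarrow> (Par C ^^ k) a \<in> Obj C"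
  by (induction k) (auto intro: Par_obj)

lemma Len_Par_pow: "a \<in> Obj C \<Longrightarrow> Len C ((Par C ^^ k) a) = Len C a - k"
  by (induction k) (auto simp: Len_Par Par_pow_obj)

lemma dsp_hom: "a \<in> Obj C \<Longrightarrow> k \<le> Len C a \<Longrightarrow> in_hom C (dsp a k) a ((Par C ^^ k) a)"
proof (induction k)
  case (Suc k)
  then show ?case
    using Pr_hom[OF Par_pow_obj, of a k] by (auto intro!: comp_hom simp: Len_Par_pow)
qed (auto intro: ide_hom)

lemma dsp_display: "a \<in> Obj C \<Longrightarrow> k \<le> Len C a \<Longrightarrow> display_map C (dsp a k)"
proof (induction k)
  case (Suc k)
  have "in_hom C (dsp a k) a ((Par C ^^ k) a)" by (rule dsp_hom) (use Suc in auto)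
  then have cod: "Cod C (dsp a k) = (Par C ^^ k) a" by (rule in_hom_cod)
  have "display_map C (dsp a k)" using Suc by auto
  then show ?case
    using display_step[of C "dsp a k"] cod Suc.prems by (auto simp: Len_Par_pow)
qed (auto intro: display_ide)

text \<open>Normal form of display maps: a start and a number of steps. It shows that a display map
  is fixed by its endpoints, so that the description in \<open>T_map\<close> is single-valued, and
  it reduces the order below an object to arithmetic with exponents.\<close>

lemma display_dsp:
  "display_map C f \<Longrightarrow> \<exists>a k. a \<in> Obj C \<and> k \<le> Len C a \<and> f = dsp a k"
proof (induction rule: display_map.induct)
  case (display_ide a)
  then show ?case by (intro exI[of _ a] exI[of _ 0]) auto
next
  case (display_step f)
  then obtain a k where f: "a \<in> Obj C" "k \<le> Len C a" "f = dsp a k" by auto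
  have "Cod C f = (Par C ^^ k) a" using dsp_hom[OF f(1,2)] f(3) by (auto simp: in_hom_def)
  with f display_step show ?case
    by (intro exI[of _ a] exI[of _ "Suc k"]) (auto simp: Len_Par_pow)
qed

lemma T_le_iff: "T_le C x y \<longleftrightarrow> y \<in> Obj C \<and> (\<exists>k\<le>Len C y. x = (Par C ^^ k) y)"
proof
  assume "T_le C x y"
  then obtain f where f: "display_map C f" "Dom C f = y" "Cod C f = x" by (auto simp: T_le_def)
  then obtain a k where ak: "a \<in> Obj C" "k \<le> Len C a" "f = dsp a k" using display_dsp by blast
  with dsp_hom[OF ak(1,2)] f show "y \<in> Obj C \<and> (\<exists>k\<le>Len C y. x = (Par C ^^ k) y)"
    by (auto simp: in_hom_def)
next
  assume "y \<in> Obj C \<and> (\<exists>k\<le>Len C y. x = (Par C ^^ k) y)"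
  then obtain k where k: "y \<in> Obj C" "k \<le> Len C y" "x = (Par C ^^ k) y" by blast
  with dsp_hom[OF k(1,2)] dsp_display[OF k(1,2)] show "T_le C x y"
    unfolding T_le_def by (intro exI[of _ "dsp y k"]) (auto simp: in_hom_def)
qed

lemma T_le_obj: "T_le C x y \<Longrightarrow> x \<in> Obj C" "T_le C x y \<Longrightarrow> y \<in> Obj C"
  by (auto simp: T_le_iff Par_pow_obj)

lemma T_le_Len: "T_le C x y \<Longrightarrow> Len C x \<le> Len C y"
  by (auto simp: T_le_iff Len_Par_pow)

lemma T_le_pow: "T_le C x y \<Longrightarrow> x = (Par C ^^ (Len C y - Len C x)) y"
  by (auto simp: T_le_iff Len_Par_pow)

text \<open>Both elements are iterates of \<open>Par\<close> on \<open>z\<close> with the same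
  exponent. Below a fixed object the length thus serves as a coordinate.\<close>

lemma T_le_Len_eq: "T_le C x z \<Longrightarrow> T_le C y z \<Longrightarrow> Len C x = Len C y \<Longrightarrow> x = y"
  using T_le_pow by metis

lemma T_map_dsp:
  assumes "T_le C x y"
  shows "T_map C y x = dsp y (Len C y - Len C x)"
  unfolding T_map_def
proof (rule the_equality)
  have y: "y \<in> Obj C" using assms by (rule T_le_obj)
  show "display_map C (dsp y (Len C y - Len C x)) \<and> Dom C (dsp y (Len C y - Len C x)) = y \<and>
      Cod C (dsp y (Len C y - Len C x)) = x"
    using dsp_hom[OF y, of "Len C y - Len C x"] dsp_display[OF y] T_le_pow[OF assms]
    by (auto simp: in_hom_def)
next
  fix f assume f: "display_map C f \<and> Dom C f = y \<and> Cod C f = x"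
  then obtain a k where ak: "a \<in> Obj C" "k \<le> Len C a" "f = dsp a k" using display_dsp by blast
  from dsp_hom[OF ak(1,2)] f ak have "a = y" "x = (Par C ^^ k) y" by (auto simp: in_hom_def)
  then show "f = dsp y (Len C y - Len C x)" using ak by (auto simp: Len_Par_pow)
qed

lemma T_map_hom: "T_le C x y \<Longrightarrow> in_hom C (T_map C y x) y x"
  using dsp_hom[of y "Len C y - Len C x"] T_le_pow[of x y]
  by (auto simp: T_map_dsp T_le_obj)

lemma T_le_refl: "x \<in> Obj C \<Longrightarrow> T_le C x x"
  by (auto simp: T_le_iff intro!: exI[of _ 0])

lemma T_map_refl: "x \<in> Obj C \<Longrightarrow> T_map C x x = Ide C x"
  by (simp add: T_map_dsp T_le_refl)

lemma dsp_add:
  assumes "a \<in> Obj C" "k + l \<le> Len C a"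
  shows "dsp a (k + l) = Comp C (dsp ((Par C ^^ k) a) l) (dsp a k)"
  using assms(2)
proof (induction l)
  case 0
  then show ?case using ide_comp[OF dsp_hom[OF assms(1), of k]] by simp
next
  case (Suc l)
  have 1: "in_hom C (dsp a k) a ((Par C ^^ k) a)" using Suc assms by (intro dsp_hom) auto
  have 2: "in_hom C (dsp ((Par C ^^ k) a) l) ((Par C ^^ k) a) ((Par C ^^ (l + k)) a)"
    using dsp_hom[of "(Par C ^^ k) a" l] Suc assms by (auto simp: Par_pow_obj Len_Par_pow funpow_add)
  have 3: "in_hom C (Pr C ((Par C ^^ (l + k)) a)) ((Par C ^^ (l + k)) a) (Par C ((Par C ^^ (l + k)) a))"
    using Suc assms by (intro Pr_hom) (auto simp: Par_pow_obj Len_Par_pow)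
  have "dsp a (k + Suc l) = Comp C (Pr C ((Par C ^^ (l + k)) a)) (Comp C (dsp ((Par C ^^ k) a) l) (dsp a k))"
    using Suc by (simp add: add.commute)
  also have "\<dots> = Comp C (dsp ((Par C ^^ k) a) (Suc l)) (dsp a k)"
    using comp_assoc[OF 3 2 1] by (simp add: funpow_add)
  finally show ?case .
qed

lemma T_le_trans: "T_le C x y \<Longrightarrow> T_le C y z \<Longrightarrow> T_le C x z"
proof -
  assume "T_le C x y" "T_le C y z"
  then obtain k l where k: "y = (Par C ^^ k) z" "k \<le> Len C z" "x = (Par C ^^ l) y" "l \<le> Len C y" "z \<in> Obj C"
    by (auto simp: T_le_iff)
  then have "x = (Par C ^^ (l + k)) z" "l + k \<le> Len C z"
    by (auto simp: funpow_add Len_Par_pow)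
  with k(5) show ?thesis unfolding T_le_iff by blast
qed

lemma T_map_comp:
  assumes "T_le C x y" "T_le C y z"
  shows "Comp C (T_map C y x) (T_map C z y) = T_map C z x"
proof -
  have z: "z \<in> Obj C" using assms by (auto dest: T_le_obj)
  have "Len C x \<le> Len C y" "Len C y \<le> Len C z" using assms T_le_Len by auto
  then have "Len C z - Len C y + (Len C y - Len C x) = Len C z - Len C x" by simp
  then show ?thesis
    using dsp_add[OF z, of "Len C z - Len C y" "Len C y - Len C x"] T_le_pow[OF assms(2)]
      T_map_dsp[OF assms(1)] T_map_dsp[OF assms(2)] T_map_dsp[OF T_le_trans[OF assms]]
    by simp
qed

lemma T_le_antisym: "T_le C x y \<Longrightarrow> T_le C y x \<Longrightarrow> x = y"
  by (meson T_le_Len T_le_Len_eq T_le_refl T_le_obj le_antisym)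

lemma T_le_Par: "y \<in> Obj C \<Longrightarrow> T_le C (Par C y) y"
  by (cases "Len C y = 0") (auto simp: T_le_iff Par_Len0 intro: exI[of _ 0] intro!: exI[of _ 1])

lemma T_le_strict: "T_le C x y \<Longrightarrow> x \<noteq> y \<Longrightarrow> Len C x < Len C y"
  by (metis T_le_Len T_le_Len_eq T_le_obj(2) T_le_refl le_neq_implies_less)

lemma T_le_ParI:
  assumes "T_le C x y" "x \<noteq> y"
  shows "T_le C x (Par C y)"
proof -
  from assms(1) obtain k where k: "y \<in> Obj C" "k \<le> Len C y" "x = (Par C ^^ k) y" by (auto simp: T_le_iff)
  with assms(2) obtain k' where "k = Suc k'" by (cases k) auto
  then have "x = (Par C ^^ k') (Par C y)" "k' \<le> Len C (Par C y)"
    using k by (auto simp: funpow_swap1 Len_Par)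
  then show ?thesis using k by (auto simp: T_le_iff Par_obj)
qed

lemma T_map_Par: "y \<in> Obj C \<Longrightarrow> 1 \<le> Len C y \<Longrightarrow> T_map C y (Par C y) = Pr C y"
  using comp_ide[OF Pr_hom, of y] by (simp add: T_map_dsp T_le_Par Len_Par)

text \<open>The iteration of \<open>Par\<close> from \<open>z\<close> down to the shorter element
  passes through the longer one, so the elements below \<open>z\<close> form a chain ordered by
  length.\<close>

lemma T_le_chain:
  assumes "T_le C x z" "T_le C y z"
  shows "T_le C x y \<longleftrightarrow> Len C x \<le> Len C y"
proof
  assume le: "Len C x \<le> Len C y"
  have l: "Len C y \<le> Len C z" using assms T_le_Len by auto
  have "x = (Par C ^^ ((Len C y - Len C x) + (Len C z - Len C y))) z"
    using T_le_pow[OF assms(1)] le l by simp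
  then have "x = (Par C ^^ (Len C y - Len C x)) y"
    using T_le_pow[OF assms(2)] by (simp add: funpow_add)
  then show "T_le C x y" unfolding T_le_iff using T_le_obj[OF assms(2)] diff_le_self by blast
qed (rule T_le_Len)

lemma T_le_total: "T_le C x z \<Longrightarrow> T_le C y z \<Longrightarrow> T_le C x y \<or> T_le C y x"
  using T_le_chain by (meson nle_le)

lemma finite_T_le: "finite {x. T_le C x y}"
proof -
  have "{x. T_le C x y} \<subseteq> (\<lambda>k. (Par C ^^ k) y) ` {..Len C y}" by (auto simp: T_le_iff)
  then show ?thesis by (rule finite_subset) auto
qed

lemma display_len1_iff:
  "display_map_len1 C f \<longleftrightarrow> (\<exists>a\<in>Obj C. 1 \<le> Len C a \<and> f = Pr C a)"
proof
  assume "display_map_len1 C f"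
  then have f: "display_map C f" "Len C (Dom C f) = Len C (Cod C f) + 1"
    by (auto simp: display_map_len1_def)
  then obtain a k where ak: "a \<in> Obj C" "k \<le> Len C a" "f = dsp a k" using display_dsp by blast
  \<comment> \<open>The subtraction is not truncated because \<open>k \<le> Len C a\<close>, so this
    equation forces \<open>k = 1\<close>.\<close>
  with dsp_hom[OF ak(1,2)] f have "Len C a = Len C a - k + 1" by (auto simp: in_hom_def Len_Par_pow)
  with ak have k: "k = 1" "1 \<le> Len C a" by auto
  with ak have "f = Pr C a" using comp_ide[OF Pr_hom, of a] by simp
  with ak k show "\<exists>a\<in>Obj C. 1 \<le> Len C a \<and> f = Pr C a" by blast
next
  assume "\<exists>a\<in>Obj C. 1 \<le> Len C a \<and> f = Pr C a"
  then obtain a where a: "a \<in> Obj C" "1 \<le> Len C a" "f = Pr C a" by blast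
  have "f = dsp a 1" using a comp_ide[OF Pr_hom, of a] by simp
  then have "display_map C f" using dsp_display[of a 1] a by simp
  then show "display_map_len1 C f"
    using a Pr_hom[of a] by (auto simp: display_map_len1_def in_hom_def Len_Par)
qed

section \<open>Distinguished squares of length 1\<close>

lemma vcomp_squares_Len:
  assumes "vcomp_squares C k s"
  shows "commutative_square C s \<and> Len C (Dom C (sq_left s)) = Len C (Cod C (sq_left s)) + k"
  using assms
proof (induction rule: vcomp_squares.induct)
  case (vcomp_empty f)
  have f: "in_hom C f (Dom C f) (Cod C f)" using vcomp_empty by (rule in_homI)
  note h = ide_hom[OF in_hom_obj(1)[OF f]] ide_hom[OF in_hom_obj(2)[OF f]]
  show ?case using f h comp_ide[OF f] ide_comp[OF f]
    by (auto simp: commutative_square_def in_hom_def)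
next
  case (vcomp_step k t l r m l' r' b)
  obtain a e where q: "l' = Pr C a" "r' = Pr C e" "a \<in> Obj C" "e \<in> Obj C" "1 \<le> Len C a" "1 \<le> Len C e"
    "in_hom C m a e" "in_hom C b (Par C a) (Par C e)" "Comp C r' m = Comp C b l'"
    using vcomp_step by (elim SqQ_cases)
  have l': "in_hom C l' a (Par C a)" and r': "in_hom C r' e (Par C e)" using q by (auto intro: Pr_hom)
  have t: "in_hom C t (Dom C t) (Cod C t)" "in_hom C l (Dom C t) a" "in_hom C r (Cod C t) e"
      "Comp C r t = Comp C m l" "Len C (Dom C t) = Len C a + k"
    using vcomp_step.IH q(7) by (auto simp: commutative_square_def in_hom_def)
  have "Comp C (Comp C r' r) t = Comp C r' (Comp C m l)" using comp_assoc[OF r' t(3,1)] t by simp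
  also have "\<dots> = Comp C (Comp C b l') l" using comp_assoc[OF r' q(7) t(2)] q by simp
  also have "\<dots> = Comp C b (Comp C l' l)" using comp_assoc[OF q(8) l' t(2)] .
  finally show ?case
    using comp_hom[OF l' t(2)] comp_hom[OF r' t(3)] q t
    by (auto simp: commutative_square_def in_hom_def Len_Par)
qed

text \<open>The number of factors of a vertical composite equals the drop in length along its left
  side. The left side \<open>Pr C a\<close> lowers the length by 1, so there is exactly one
  factor.\<close>

lemma distinguished_SqQ:
  assumes "distinguished C (Square t (Pr C a) r b)" "a \<in> Obj C" "1 \<le> Len C a"
  shows "Square t (Pr C a) r b \<in> SqQ C"
proof -
  from assms(1) obtain k where v: "vcomp_squares C k (Square t (Pr C a) r b)"
    by (auto simp: distinguished_def)
  have "k = 1"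
    using vcomp_squares_Len[OF v] Pr_hom[OF assms(2,3)] assms(3) by (auto simp: in_hom_def Len_Par assms(2))
  with v have "vcomp_squares C (Suc 0) (Square t (Pr C a) r b)" by simp
  then show ?thesis
  proof cases
    case (vcomp_step l r' m l' r'')
    \<comment> \<open>The remaining composite has 0 factors, so its vertical sides are identities
      and the unit laws leave the sides of the single factor.\<close>
    from vcomp_step(3) have m: "l = Ide C (Dom C t)" "r' = Ide C (Cod C t)" "m = t"
      by (cases rule: vcomp_squares.cases; simp)+
    from vcomp_step(4) obtain c e where q: "l' = Pr C c" "r'' = Pr C e" "in_hom C t c e"
      "c \<in> Obj C" "e \<in> Obj C" "1 \<le> Len C c" "1 \<le> Len C e"
      unfolding m by (rule SqQ_cases)
    have "Comp C l' l = l'" "Comp C r'' r' = r''"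
      using comp_ide[OF Pr_hom, OF q(4,6)] comp_ide[OF Pr_hom, OF q(5,7)] q(1-3) m
      by (auto simp: in_hom_def)
    with vcomp_step m show ?thesis by simp
  qed
qed

end

section \<open>Cellular diagrams\<close>

lemma restr_map_spec:
  assumes "limit_cone C X le Do Dm (a X) (c X)" "cone C Y le Do Dm (a Y) (c Y)" "X \<subseteq> Y"
  shows restr_map_hom: "in_hom C (restr_map C a c Y X) (a Y) (a X)"
    and restr_map_comp: "x \<in> X \<Longrightarrow> Comp C (c X x) (restr_map C a c Y X) = c Y x"
    and restr_map_eqI: "in_hom C u (a Y) (a X) \<Longrightarrow> (\<And>x. x \<in> X \<Longrightarrow> Comp C (c X x) u = c Y x) \<Longrightarrow>
      restr_map C a c Y X = u"
proof -
  have "cone C X le Do Dm (a Y) (c Y)" using assms(2,3) by (auto simp: cone_def)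
  then have ex: "\<exists>!u. in_hom C u (a Y) (a X) \<and> (\<forall>x\<in>X. Comp C (c X x) u = c Y x)"
    using assms(1) by (auto simp: limit_cone_def)
  from theI'[OF ex] show "in_hom C (restr_map C a c Y X) (a Y) (a X)"
    "x \<in> X \<Longrightarrow> Comp C (c X x) (restr_map C a c Y X) = c Y x"
    by (auto simp: restr_map_def)
  show "in_hom C u (a Y) (a X) \<Longrightarrow> (\<And>x. x \<in> X \<Longrightarrow> Comp C (c X x) u = c Y x) \<Longrightarrow>
      restr_map C a c Y X = u"
    unfolding restr_map_def using ex by (intro the1_equality) auto
qed

text \<open>A choice is a total function whose values off the sieve are arbitrary. The description
  of the restriction map consults both cones only on \<open>X\<close>, so agreement there
  suffices.\<close>

lemma restr_map_cong:
  assumes "a X = a' X" "a Y = a' Y" "\<And>x. x \<in> X \<Longrightarrow> c X x = c' X x" "\<And>x. x \<in> X \<Longrightarrow> c Y x = c' Y x"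
  shows "restr_map C a c Y X = restr_map C a' c' Y X"
proof -
  have "(\<forall>x\<in>X. Comp C (c X x) u = c Y x) = (\<forall>x\<in>X. Comp C (c' X x) u = c' Y x)" for u
    using assms by auto
  with assms show ?thesis unfolding restr_map_def by simp
qed

lemma limit_cone_cong:
  assumes "\<And>x. x \<in> X \<Longrightarrow> c x = c' x"
  shows "limit_cone C X le Do Dm a c = limit_cone C X le Do Dm a c'"
proof -
  have "cone C X le Do Dm a c = cone C X le Do Dm a c'" using assms unfolding cone_def by auto
  moreover have "(\<forall>x\<in>X. Comp C (c x) u = d x) = (\<forall>x\<in>X. Comp C (c' x) u = d x)" for u d
    using assms by auto
  ultimately show ?thesis unfolding limit_cone_def by simp
qed

locale celldiag = ctx C for C :: "('o, 'm) ctxcat" +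
  fixes P :: "'p set" and le lin :: "'p \<Rightarrow> 'p \<Rightarrow> bool" and Do :: "'p \<Rightarrow> 'o" and Dm :: "'p \<Rightarrow> 'p \<Rightarrow> 'm"
  assumes partial_order: "partial_order_on P (rel_on P le)"
    and finite_down: "\<And>x. x \<in> P \<Longrightarrow> finite (down P le x)"
    and local_lin: "local_linearization P le lin"
    and diagram: "poset_op_functor C P le Do Dm"
begin

section \<open>Bounded sieves in a locally linearized poset\<close>

abbreviation "dn x \<equiv> down P le x"
abbreviation "bd x \<equiv> bdry P le x"
abbreviation "restr \<equiv> restr_map C"

lemma le_refl: "x \<in> P \<Longrightarrow> le x x"
  using partial_order by (auto simp: partial_order_on_def preorder_on_def refl_on_def rel_on_def)

lemma le_antisym: "x \<in> P \<Longrightarrow> y \<in> P \<Longrightarrow> le x y \<Longrightarrow> le y x \<Longrightarrow> x = y"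
  using partial_order by (auto simp: partial_order_on_def antisym_def rel_on_def)

lemma le_trans: "x \<in> P \<Longrightarrow> y \<in> P \<Longrightarrow> z \<in> P \<Longrightarrow> le x y \<Longrightarrow> le y z \<Longrightarrow> le x z"
  using partial_order unfolding partial_order_on_def preorder_on_def trans_def rel_on_def by blast

lemma lin_order: "z \<in> P \<Longrightarrow> linear_order_on (dn z) (rel_on (dn z) lin)"
  using local_lin by (auto simp: local_linearization_def)

lemma le_lin: "z \<in> P \<Longrightarrow> x \<in> dn z \<Longrightarrow> y \<in> dn z \<Longrightarrow> le x y \<Longrightarrow> lin x y"
  using local_lin unfolding local_linearization_def rel_on_def by blast

lemma Do_obj: "x \<in> P \<Longrightarrow> Do x \<in> Obj C"
  using diagram by (auto simp: poset_op_functor_def)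

lemma Dm_hom: "x \<in> P \<Longrightarrow> y \<in> P \<Longrightarrow> le x y \<Longrightarrow> in_hom C (Dm y x) (Do y) (Do x)"
  using diagram by (auto simp: poset_op_functor_def)

lemma Dm_ide: "x \<in> P \<Longrightarrow> Dm x x = Ide C (Do x)"
  using diagram by (auto simp: poset_op_functor_def)

text \<open>Sieves with an upper bound in \<open>P\<close> are those for which F[X] is defined, and
  on which a local linearization is sure to be a linear order.\<close>

definition bsieve :: "'p set \<Rightarrow> bool" where
  "bsieve X \<longleftrightarrow> sieve P le X \<and> (\<exists>z\<in>P. X \<subseteq> dn z)"

lemma bsieve_P: "bsieve X \<Longrightarrow> x \<in> X \<Longrightarrow> x \<in> P"
  by (auto simp: bsieve_def sieve_def)

lemma bsieve_closed: "bsieve X \<Longrightarrow> x \<in> X \<Longrightarrow> y \<in> P \<Longrightarrow> le y x \<Longrightarrow> y \<in> X"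
  by (auto simp: bsieve_def sieve_def)

lemma bsieve_finite: "bsieve X \<Longrightarrow> finite X"
  unfolding bsieve_def using finite_down finite_subset by blast

lemma bsieve_subI: "bsieve X \<Longrightarrow> sieve P le Y \<Longrightarrow> Y \<subseteq> X \<Longrightarrow> bsieve Y"
  unfolding bsieve_def by blast

lemma bsieve_lin_total: "bsieve X \<Longrightarrow> x \<in> X \<Longrightarrow> y \<in> X \<Longrightarrow> lin x y \<or> lin y x"
proof -
  assume "bsieve X" and xy: "x \<in> X" "y \<in> X"
  then obtain z where z: "z \<in> P" "X \<subseteq> dn z" by (auto simp: bsieve_def)
  have r: "refl_on (dn z) (rel_on (dn z) lin)" "total_on (dn z) (rel_on (dn z) lin)"
    using lin_order[OF z(1)] by (auto simp: linear_order_on_def partial_order_on_def preorder_on_def)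
  show ?thesis using r xy z(2) unfolding refl_on_def total_on_def rel_on_def by (cases "x = y") blast+
qed

lemma bsieve_lin_refl: "bsieve X \<Longrightarrow> x \<in> X \<Longrightarrow> lin x x"
  using bsieve_lin_total by blast

lemma bsieve_lin_antisym: "bsieve X \<Longrightarrow> x \<in> X \<Longrightarrow> y \<in> X \<Longrightarrow> lin x y \<Longrightarrow> lin y x \<Longrightarrow> x = y"
proof -
  assume "bsieve X" and xy: "x \<in> X" "y \<in> X" "lin x y" "lin y x"
  then obtain z where z: "z \<in> P" "X \<subseteq> dn z" by (auto simp: bsieve_def)
  have "antisym (rel_on (dn z) lin)"
    using lin_order[OF z(1)] by (auto simp: linear_order_on_def partial_order_on_def)
  then show ?thesis using xy z(2) unfolding antisym_def rel_on_def by blast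
qed

lemma bsieve_lin_trans:
  "bsieve X \<Longrightarrow> x \<in> X \<Longrightarrow> y \<in> X \<Longrightarrow> z \<in> X \<Longrightarrow> lin x y \<Longrightarrow> lin y z \<Longrightarrow> lin x z"
proof -
  assume "bsieve X" and xy: "x \<in> X" "y \<in> X" "z \<in> X" "lin x y" "lin y z"
  then obtain w where w: "w \<in> P" "X \<subseteq> dn w" by (auto simp: bsieve_def)
  have "trans (rel_on (dn w) lin)"
    using lin_order[OF w(1)] by (auto simp: linear_order_on_def partial_order_on_def preorder_on_def)
  then show ?thesis using xy w(2) unfolding trans_def rel_on_def by blast
qed

lemma bsieve_le_lin: "bsieve X \<Longrightarrow> x \<in> X \<Longrightarrow> y \<in> X \<Longrightarrow> le x y \<Longrightarrow> lin x y"
  unfolding bsieve_def using le_lin by blast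

lemma bsieve_down: "x \<in> P \<Longrightarrow> bsieve (dn x)"
  unfolding bsieve_def sieve_def down_def using le_trans by blast

lemma bsieve_bdry: "x \<in> P \<Longrightarrow> bsieve (bd x)"
  by (rule bsieve_subI[OF bsieve_down])
    (auto simp: sieve_def bdry_def down_def intro: le_trans dest: le_antisym)

lemma down_sub: "bsieve X \<Longrightarrow> x \<in> X \<Longrightarrow> dn x \<subseteq> X"
  unfolding down_def using bsieve_closed by blast

lemma bdry_down: "x \<in> P \<Longrightarrow> bd x = dn x - {x}"
  by (auto simp: bdry_def down_def)

lemma down_self: "x \<in> P \<Longrightarrow> x \<in> dn x"
  by (auto simp: down_def le_refl)

text \<open>As \<open>le\<close> implies \<open>lin\<close> inside a bounded sieve, no element lies
  strictly above the \<open>lin\<close>-largest one for \<open>le\<close>. Removing it therefore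
  keeps the set downward closed.\<close>

lemma bsieve_Diff_max: "bsieve X \<Longrightarrow> m \<in> X \<Longrightarrow> (\<And>x. x \<in> X \<Longrightarrow> lin x m) \<Longrightarrow> bsieve (X - {m})"
  by (rule bsieve_subI, assumption)
    (auto simp: sieve_def dest: bsieve_P bsieve_closed bsieve_le_lin bsieve_lin_antisym)

lemma bdry_sub_Diff: "bsieve X \<Longrightarrow> m \<in> X \<Longrightarrow> bd m \<subseteq> X - {m}"
  using down_sub[of X m] bsieve_P by (auto simp: bdry_down)

lemma bsieve_max: "bsieve X \<Longrightarrow> X \<noteq> {} \<Longrightarrow> \<exists>m\<in>X. \<forall>x\<in>X. lin x m"
proof -
  assume X: "bsieve X" "X \<noteq> {}"
  have "finite A \<Longrightarrow> A \<noteq> {} \<Longrightarrow> A \<subseteq> X \<Longrightarrow> \<exists>m\<in>A. \<forall>x\<in>A. lin x m" for A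
  proof (induction A rule: finite_ne_induct)
    case (singleton x)
    then show ?case using bsieve_lin_refl[OF X(1)] by auto
  next
    case (insert x F)
    then obtain m where m: "m \<in> F" "\<forall>y\<in>F. lin y m" by auto
    show ?case
    proof (cases "lin x m")
      case True then show ?thesis using m by auto
    next
      case False
      then have "lin m x" using insert m bsieve_lin_total[OF X(1), of x m] by auto
      have "lin y x" if "y \<in> F" for y
        using bsieve_lin_trans[OF X(1), of y m x] \<open>lin m x\<close> m that insert.prems by auto
      then show ?thesis using insert bsieve_lin_refl[OF X(1)] by auto
    qed
  qed
  then show ?thesis using bsieve_finite[OF X(1)] X(2) by blast
qed

text \<open>\<open>S\<close> is itself downward closed, so being a sieve does not depend on the
  ambient set. This allows choices on different sets \<open>S\<close> to be compared and
  restricted.\<close>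

lemma sieve_sub_iff: "bsieve S \<Longrightarrow> sieve S le X \<longleftrightarrow> bsieve X \<and> X \<subseteq> S"
proof
  assume S: "bsieve S" and X: "sieve S le X"
  then have "sieve P le X" "X \<subseteq> S" unfolding sieve_def bsieve_def by blast+
  with S show "bsieve X \<and> X \<subseteq> S" by (auto intro: bsieve_subI)
next
  assume "bsieve S" "bsieve X \<and> X \<subseteq> S"
  then show "sieve S le X" unfolding sieve_def bsieve_def by blast
qed

lemma down_sub_eq: "bsieve S \<Longrightarrow> x \<in> S \<Longrightarrow> down S le x = dn x"
  using down_sub[of S x] bsieve_P by (auto simp: down_def)

section \<open>Cellular choices and their uniqueness\<close>

abbreviation choice :: "'p set \<Rightarrow> ('p set \<Rightarrow> 'o) \<Rightarrow> ('p set \<Rightarrow> 'p \<Rightarrow> 'm) \<Rightarrow> bool" where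
  "choice S a c \<equiv> cellular_choice C S le lin Do Dm a c"

abbreviation lim :: "'p set \<Rightarrow> 'o \<Rightarrow> ('p \<Rightarrow> 'm) \<Rightarrow> bool" where
  "lim X a c \<equiv> limit_cone C X le Do Dm a c"

lemma choice_iff:
  assumes S: "bsieve S"
  shows "choice S a c \<longleftrightarrow>
     (\<forall>X. bsieve X \<and> X \<subseteq> S \<longrightarrow> lim X (a X) (c X)) \<and>
     a {} = ctx_one C \<and>
     (\<forall>x\<in>S. a (dn x) = Do x \<and> (\<forall>y\<in>dn x. c (dn x) y = Dm x y)) \<and>
     (\<forall>X Y y. bsieve X \<and> X \<subseteq> S \<longrightarrow> bsieve Y \<and> Y \<subseteq> S \<longrightarrow> X \<subseteq> Y \<longrightarrow> Y - X = {y} \<longrightarrow> (\<forall>x\<in>X. lin x y) \<longrightarrow>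
        display_map_len1 C (restr a c Y X)) \<and>
     (\<forall>X X' Y Y' y. bsieve X \<and> X \<subseteq> S \<longrightarrow> bsieve X' \<and> X' \<subseteq> S \<longrightarrow> bsieve Y \<and> Y \<subseteq> S \<longrightarrow> bsieve Y' \<and> Y' \<subseteq> S \<longrightarrow>
        X \<subseteq> X' \<longrightarrow> Y \<subseteq> Y' \<longrightarrow> X \<subseteq> Y \<longrightarrow> X' \<subseteq> Y' \<longrightarrow>
        Y - X = {y} \<longrightarrow> Y' - X' = {y} \<longrightarrow> (\<forall>x\<in>X'. lin x y) \<longrightarrow>
        distinguished C (Square (restr a c Y' Y) (restr a c Y' X')
          (restr a c Y X) (restr a c X' X)))"
  unfolding cellular_choice_def sieve_sub_iff[OF S]
  using down_sub_eq[OF S] by (auto cong: ball_cong)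

lemma choice_lim:
  assumes "choice S a c" "bsieve S" "bsieve X" "X \<subseteq> S"
  shows "lim X (a X) (c X)"
  using assms(1,3,4) unfolding choice_iff[OF assms(2)] by blast

lemma choice_cone:
  assumes "choice S a c" "bsieve S" "bsieve X" "X \<subseteq> S"
  shows "cone C X le Do Dm (a X) (c X)"
  using choice_lim[OF assms] by (simp add: limit_cone_def)

lemma choice_obj:
  assumes "choice S a c" "bsieve S" "bsieve X" "X \<subseteq> S"
  shows "a X \<in> Obj C"
  using choice_cone[OF assms] by (simp add: cone_def)

lemma choice_hom:
  assumes "choice S a c" "bsieve S" "bsieve X" "X \<subseteq> S" "x \<in> X"
  shows "in_hom C (c X x) (a X) (Do x)"
  using choice_cone[OF assms(1-4)] assms(5) by (simp add: cone_def)

lemma choice_comp: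
  assumes "choice S a c" "bsieve S" "bsieve X" "X \<subseteq> S" "y \<in> X" "x \<in> P" "le x y"
  shows "Comp C (Dm y x) (c X y) = c X x"
  using choice_cone[OF assms(1-4)] assms(5-7) bsieve_closed[OF assms(3,5,6,7)] by (simp add: cone_def)

lemma choice_empty:
  assumes "choice S a c"
  shows "a {} = ctx_one C"
  using assms unfolding cellular_choice_def by blast

lemma choice_down:
  assumes "choice S a c" "bsieve S" "x \<in> S"
  shows "a (dn x) = Do x" "y \<in> dn x \<Longrightarrow> c (dn x) y = Dm x y"
  using assms(1,3) unfolding choice_iff[OF assms(2)] by blast+

lemma choice_restr:
  assumes "choice S a c" "bsieve S" "bsieve X" "bsieve Y" "X \<subseteq> Y" "Y \<subseteq> S"
  shows choice_restr_hom: "in_hom C (restr a c Y X) (a Y) (a X)"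
    and choice_restr_comp: "x \<in> X \<Longrightarrow> Comp C (c X x) (restr a c Y X) = c Y x"
    and choice_restr_eqI: "in_hom C u (a Y) (a X) \<Longrightarrow> (\<And>x. x \<in> X \<Longrightarrow> Comp C (c X x) u = c Y x) \<Longrightarrow>
      restr a c Y X = u"
  using restr_map_spec[where C = C and a = a and c = c, OF choice_lim choice_cone, OF assms(1,2,3) _ assms(1,2,4,6,5)]
    assms(5,6) by blast+

lemma choice_sub:
  assumes "choice S a c" "bsieve S" "bsieve S'" "S' \<subseteq> S"
  shows "choice S' a c"
proof -
  have t: "X \<subseteq> S" if "X \<subseteq> S'" for X using that assms(4) by (rule order_trans)
  show ?thesis
    unfolding choice_iff[OF assms(3)]
    using assms(1)[unfolded choice_iff[OF assms(2)]] t subsetD[OF assms(4)]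
    by (intro conjI; elim conjE) simp_all
qed

text \<open>The components \<open>k x\<close> composed with \<open>u\<close> form a cone, and both
  arrows mediate it.\<close>

lemma lim_ext:
  assumes "lim X A k" "X \<subseteq> P" "in_hom C u b A" "in_hom C v b A" "\<And>x. x \<in> X \<Longrightarrow> Comp C (k x) u = Comp C (k x) v"
  shows "u = v"
proof -
  have k: "x \<in> X \<Longrightarrow> in_hom C (k x) A (Do x)" for x
    using assms(1) by (auto simp: limit_cone_def cone_def)
  have kk: "Comp C (Dm y x) (k y) = k x" if "x \<in> X" "y \<in> X" "le x y" for x y
    using assms(1) that by (auto simp: limit_cone_def cone_def)
  have "cone C X le Do Dm b (\<lambda>x. Comp C (k x) u)"
    unfolding cone_def
  proof (intro conjI ballI impI)
    show "b \<in> Obj C" using in_hom_obj(1)[OF assms(3)] .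
    show "in_hom C (Comp C (k x) u) b (Do x)" if "x \<in> X" for x using k[OF that] assms(3) by (rule comp_hom)
    show "Comp C (Dm y x) (Comp C (k y) u) = Comp C (k x) u" if "x \<in> X" "y \<in> X" "le x y" for x y
      using comp_assoc[OF Dm_hom k assms(3), of x y] that assms(2) kk[OF that] by (simp add: subset_iff)
  qed
  then have "\<exists>!w. in_hom C w b A \<and> (\<forall>x\<in>X. Comp C (k x) w = Comp C (k x) u)"
    using assms(1) by (auto simp: limit_cone_def)
  with assms(3-5) show ?thesis by metis
qed

lemma choice_ext:
  assumes "choice S a c" "bsieve S" "bsieve X" "X \<subseteq> S" "in_hom C u b (a X)" "in_hom C v b (a X)"
    "\<And>x. x \<in> X \<Longrightarrow> Comp C (c X x) u = Comp C (c X x) v"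
  shows "u = v"
  using lim_ext[OF choice_lim[OF assms(1-4)] _ assms(5-7)] bsieve_P[OF assms(3)] by blast

text \<open>A length-1 display map has the form \<open>Pr C e\<close>, and its domain and codomain
  identify \<open>e\<close> and \<open>Par C e\<close>.\<close>

lemma choice_display:
  assumes "choice S a c" "bsieve S" "bsieve X" "X \<subseteq> S" "m \<in> X" "\<And>x. x \<in> X \<Longrightarrow> lin x m"
  shows "restr a c X (X - {m}) = Pr C (a X)" "1 \<le> Len C (a X)" "Par C (a X) = a (X - {m})"
proof -
  have b: "bsieve (X - {m})" using assms by (intro bsieve_Diff_max)
  have "display_map_len1 C (restr a c X (X - {m}))"
    using assms(1,4-6) b assms(3) unfolding choice_iff[OF assms(2)]
    by (auto simp: double_diff)
  then obtain e where e: "e \<in> Obj C" "1 \<le> Len C e" "restr a c X (X - {m}) = Pr C e"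
    by (auto simp: display_len1_iff)
  have h: "in_hom C (restr a c X (X - {m})) (a X) (a (X - {m}))"
    using assms b by (intro choice_restr_hom) auto
  have "e = a X" "Par C e = a (X - {m})" using Pr_hom[OF e(1,2)] h e(3) by (auto simp: in_hom_def)
  with e show "restr a c X (X - {m}) = Pr C (a X)" "1 \<le> Len C (a X)" "Par C (a X) = a (X - {m})"
    by auto
qed

lemma choice_display_down:
  assumes "choice S a c" "bsieve S" "m \<in> S"
  shows "restr a c (dn m) (bd m) = Pr C (Do m)" "1 \<le> Len C (Do m)"
    "Par C (Do m) = a (bd m)"
proof -
  have m: "m \<in> P" using assms bsieve_P by auto
  have "m \<in> dn m" by (rule down_self[OF m])
  moreover have "lin x m" if "x \<in> dn m" for x
    using le_lin[OF m that down_self[OF m]] that by (auto simp: down_def)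
  ultimately show "restr a c (dn m) (bd m) = Pr C (Do m)" "1 \<le> Len C (Do m)"
    "Par C (Do m) = a (bd m)"
    using choice_display[OF assms(1,2) bsieve_down[OF m] down_sub[OF assms(2,3)], of m]
      choice_down(1)[OF assms] by (auto simp: bdry_down[OF m])
qed

lemma choice_sq:
  assumes "choice S a c" "bsieve S" "bsieve X" "bsieve X'" "bsieve Y" "bsieve Y'" "Y' \<subseteq> S"
    "X \<subseteq> X'" "Y \<subseteq> Y'" "X \<subseteq> Y" "X' \<subseteq> Y'" "Y - X = {y}" "Y' - X' = {y}" "\<forall>x\<in>X'. lin x y"
  shows "distinguished C (Square (restr a c Y' Y) (restr a c Y' X')
          (restr a c Y X) (restr a c X' X))"
proof -
  have sub: "X \<subseteq> S" "X' \<subseteq> S" "Y \<subseteq> S" using assms(7-11) by auto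
  have "\<forall>X X' Y Y' y. bsieve X \<and> X \<subseteq> S \<longrightarrow> bsieve X' \<and> X' \<subseteq> S \<longrightarrow> bsieve Y \<and> Y \<subseteq> S \<longrightarrow> bsieve Y' \<and> Y' \<subseteq> S \<longrightarrow>
        X \<subseteq> X' \<longrightarrow> Y \<subseteq> Y' \<longrightarrow> X \<subseteq> Y \<longrightarrow> X' \<subseteq> Y' \<longrightarrow>
        Y - X = {y} \<longrightarrow> Y' - X' = {y} \<longrightarrow> (\<forall>x\<in>X'. lin x y) \<longrightarrow>
        distinguished C (Square (restr a c Y' Y) (restr a c Y' X')
          (restr a c Y X) (restr a c X' X))"
    using assms(1) unfolding choice_iff[OF assms(2)] by (elim conjE)
  from this[rule_format, of X X' Y Y' y] assms sub show ?thesis by simp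
qed

text \<open>The pairs \<open>bd m\<close>, \<open>dn m\<close> and \<open>X - {m}\<close>,
  \<open>X\<close> differ by the same largest element, so cellularity gives a distinguished square;
  its left side is a map \<open>Pr\<close>, which puts it into \<open>SqQ C\<close>. It computes the
  value at \<open>X\<close> from values at \<open>X - {m}\<close>, \<open>dn m\<close> and
  \<open>bd m\<close>.\<close>

lemma choice_square:
  assumes "choice S a c" "bsieve S" "bsieve X" "X \<subseteq> S" "m \<in> X" "\<And>x. x \<in> X \<Longrightarrow> lin x m"
  shows "Square (restr a c X (dn m)) (Pr C (a X)) (Pr C (Do m))
     (restr a c (X - {m}) (bd m)) \<in> SqQ C"
proof -
  have m: "m \<in> P" "m \<in> S" using assms bsieve_P by auto
  note d = choice_display[OF assms] choice_display_down[OF assms(1,2) m(2)]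
  have b: "bsieve (X - {m})" using assms by (intro bsieve_Diff_max)
  have e: "dn m - bd m = {m}" "X - (X - {m}) = {m}"
    using assms down_self[OF m(1)] by (auto simp: bdry_down[OF m(1)])
  have "distinguished C (Square (restr a c X (dn m)) (restr a c X (X - {m}))
     (restr a c (dn m) (bd m)) (restr a c (X - {m}) (bd m)))"
  proof (rule choice_sq[OF assms(1,2) bsieve_bdry[OF m(1)] b bsieve_down[OF m(1)] assms(3)])
    show "bd m \<subseteq> X - {m}"
      using bdry_sub_Diff[OF assms(3,5)] .
    show "dn m - bd m = {m}" "X - (X - {m}) = {m}" by (fact e)+
  qed (use assms(4,6) down_sub[OF assms(3,5)] in \<open>auto simp: bdry_down[OF m(1)]\<close>)
  then show ?thesis
    using distinguished_SqQ d(1-4) choice_obj[OF assms(1-4)] by metis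
qed

text \<open>Induction on the size of \<open>X\<close> with \<open>SqQ_unique\<close> applied to the
  two instances of \<open>choice_square\<close>: the left sides give the objects, the tops give the
  projections to \<open>m\<close>, and the other projections factor through \<open>X - {m}\<close>.
  Allowing different domains \<open>S\<close> and \<open>S'\<close> makes F[X] independent of the
  upper bound used for \<open>X\<close>.\<close>

lemma choice_unique:
  assumes "choice S a c" "choice S' a' c'" "bsieve S" "bsieve S'"
  shows "bsieve X \<Longrightarrow> X \<subseteq> S \<Longrightarrow> X \<subseteq> S' \<Longrightarrow> a X = a' X \<and> (\<forall>x\<in>X. c X x = c' X x)"
proof (induction "card X" arbitrary: X rule: less_induct)
  case less
  show ?case
  proof (cases "X = {}")
    case True
    then show ?thesis using choice_empty[OF assms(1)] choice_empty[OF assms(2)] by simp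
  next
    case False
    then obtain m where m: "m \<in> X" "\<And>x. x \<in> X \<Longrightarrow> lin x m" using bsieve_max[OF less(2)] by blast
    have mP: "m \<in> P" "m \<in> S" "m \<in> S'" using less m bsieve_P by auto
    have finX: "finite X" by (rule bsieve_finite[OF less(2)])
    have b: "bsieve (X - {m})" using m less by (intro bsieve_Diff_max)
    show ?thesis
    \<comment> \<open>For \<open>X = dn m\<close> the sieve \<open>dn m\<close> is not smaller than
      \<open>X\<close>, so the induction hypothesis is silent about it; there the value is
      prescribed by the diagram.\<close>
    proof (cases "X = dn m")
      case True
      then show ?thesis
        using choice_down[OF assms(1,3) mP(2)] choice_down[OF assms(2,4) mP(3)] by auto
    next
      case False
      let ?X' = "X - {m}" and ?b = "bd m" and ?d = "dn m"
      have sub: "?d \<subset> X" "?b \<subseteq> ?X'" using False down_sub[OF less(2) m(1)] bdry_sub_Diff[OF less(2) m(1)] by auto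
      have card: "card ?X' < card X" "card ?b < card X" "card ?d < card X"
        using m(1) sub by (auto intro!: psubset_card_mono[OF finX] simp del: card_Diff_insert card_Diff_singleton)
      have eX': "a ?X' = a' ?X' \<and> (\<forall>x\<in>?X'. c ?X' x = c' ?X' x)"
        using less card b by blast
      have eb: "a ?b = a' ?b \<and> (\<forall>x\<in>?b. c ?b x = c' ?b x)"
        using less.hyps[OF card(2) bsieve_bdry[OF mP(1)]] less.prems sub by blast
      have ed: "a ?d = a' ?d \<and> (\<forall>x\<in>?d. c ?d x = c' ?d x)"
        using less.hyps[OF card(3) bsieve_down[OF mP(1)]] less.prems sub by blast
      have r: "restr a c ?X' ?b = restr a' c' ?X' ?b"
        using eX' eb sub by (intro restr_map_cong) auto
      note s = SqQ_unique[OF choice_square[OF assms(1,3) less(2,3) m]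
          choice_square[OF assms(2,4) less(2,4) m, folded r]]
      have aX: "a X = a' X"
        using s(2) choice_obj[OF assms(1,3) less(2,3)] choice_obj[OF assms(2,4) less(2,4)]
          choice_display(2)[OF assms(1,3) less(2,3) m] choice_display(2)[OF assms(2,4) less(2,4) m]
        by (rule Pr_inj)
      have "c X x = c' X x" if x: "x \<in> X" for x
      proof (cases "x = m")
        case True
        have md: "m \<in> ?d" by (rule down_self[OF mP(1)])
        have "c X m = Comp C (c ?d m) (restr a c X ?d)"
          using choice_restr_comp[OF assms(1,3) bsieve_down[OF mP(1)] less(2) _ less(3)] sub md by auto
        moreover have "c' X m = Comp C (c' ?d m) (restr a' c' X ?d)"
          using choice_restr_comp[OF assms(2,4) bsieve_down[OF mP(1)] less(2) _ less(4)] sub md by auto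
        ultimately show ?thesis using s(1) ed md True by simp
      next
        case False
        then have x': "x \<in> ?X'" using x by auto
        have "c X x = Comp C (c ?X' x) (restr a c X ?X')"
          using choice_restr_comp[OF assms(1,3) b less(2) _ less(3)] x' by auto
        moreover have "c' X x = Comp C (c' ?X' x) (restr a' c' X ?X')"
          using choice_restr_comp[OF assms(2,4) b less(2) _ less(4)] x' by auto
        ultimately show ?thesis
          using eX' x' aX choice_display(1)[OF assms(1,3) less(2,3) m] choice_display(1)[OF assms(2,4) less(2,4) m]
          by simp
      qed
      with aX show ?thesis by blast
    qed
  qed
qed

lemma choice_restr_trans:
  assumes "choice S a c" "bsieve S" "bsieve X" "bsieve Y" "bsieve Z" "X \<subseteq> Y" "Y \<subseteq> Z" "Z \<subseteq> S"
  shows "Comp C (restr a c Y X) (restr a c Z Y) = restr a c Z X"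
proof -
  have sub: "X \<subseteq> Z" "Y \<subseteq> S" "X \<subseteq> S" using assms by auto
  note yx = choice_restr_hom[OF assms(1-4,6) sub(2)]
    and zy = choice_restr_hom[OF assms(1,2,4,5,7,8)]
  show ?thesis
  proof (rule choice_restr_eqI[OF assms(1,2,3,5) sub(1) assms(8), symmetric])
    show "in_hom C (Comp C (restr a c Y X) (restr a c Z Y)) (a Z) (a X)"
      using yx zy by (rule comp_hom)
    fix x assume x: "x \<in> X"
    have "Comp C (c X x) (Comp C (restr a c Y X) (restr a c Z Y)) =
      Comp C (Comp C (c X x) (restr a c Y X)) (restr a c Z Y)"
      by (rule comp_assoc[OF choice_hom[OF assms(1,2,3) sub(3) x] yx zy, symmetric])
    also have "\<dots> = c Z x"
      using choice_restr_comp[OF assms(1-4,6) sub(2) x] choice_restr_comp[OF assms(1,2,4,5,7,8)] x assms(6)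
      by auto
    finally show "Comp C (c X x) (Comp C (restr a c Y X) (restr a c Z Y)) = c Z x" .
  qed
qed

lemma choice_restr_refl:
  assumes "choice S a c" "bsieve S" "bsieve X" "X \<subseteq> S"
  shows "restr a c X X = Ide C (a X)"
  using assms choice_obj[OF assms] comp_ide[OF choice_hom[OF assms]]
  by (intro choice_restr_eqI[where S = S]) (auto intro: ide_hom)

text \<open>Any sieve in \<open>S\<close> that contains \<open>m\<close> has \<open>m\<close> as its
  largest element, and removing \<open>m\<close> leads back to the given choice. The limit property
  then comes from the pullback property, and the squares adding \<open>m\<close> come from composing
  canonical pullbacks horizontally.\<close>

lemma choice_extend:
  assumes S: "bsieve S" and m: "m \<in> S" "\<And>x. x \<in> S \<Longrightarrow> lin x m"
    and c0: "choice (S - {m}) a c"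
    and u: "display_map_len1 C u" "in_hom C u (Do m) (a (bd m))"
      "\<And>z. z \<in> bd m \<Longrightarrow> Comp C (c (bd m) z) u = Dm m z"
  shows "\<exists>a' c'. choice S a' c'"
proof -
  let ?S0 = "S - {m}" and ?b = "bd m" and ?d = "dn m"
  have mP: "m \<in> P" using S m bsieve_P by auto
  have S0: "bsieve ?S0" using S m by (intro bsieve_Diff_max)
  have b: "bsieve ?b" by (rule bsieve_bdry[OF mP])
  \<comment> \<open>The \<open>lin\<close>-largest element is also maximal for
    \<open>le\<close>.\<close>
  have le_m: "x = m" if "x \<in> S" "le m x" for x
    using bsieve_lin_antisym[OF S that(1) m(1)] bsieve_le_lin[OF S m(1) that] m(2)[OF that(1)] by blast
  obtain e where "e \<in> Obj C" "1 \<le> Len C e" "u = Pr C e" using u(1) by (auto simp: display_len1_iff)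
  with u(2) Pr_hom[of e] have e: "u = Pr C (Do m)" "1 \<le> Len C (Do m)" "Par C (Do m) = a ?b" "Do m \<in> Obj C"
    by (auto simp: in_hom_def)
  have bX: "?b \<subseteq> X - {m}" if "bsieve X" "m \<in> X" for X using bdry_sub_Diff[OF that] .
  have Xm: "bsieve (X - {m})" if "bsieve X" "X \<subseteq> S" "m \<in> X" for X
    using that m(2) by (intro bsieve_Diff_max) auto
  have X0: "X - {m} \<subseteq> ?S0" if "X \<subseteq> S" for X using that by auto
  txt \<open>For \<open>m \<in> X\<close> the new value is the pullback along \<open>r X\<close>.  No separate clause is needed for
    \<open>X = dn m\<close>: there \<open>r X\<close> is an identity, and so is its canonical pullback.\<close>
  define r where "r X = restr a c (X - {m}) ?b" for X
  have r: "in_hom C (r X) (a (X - {m})) (a ?b)" if X: "bsieve X" "X \<subseteq> S" "m \<in> X" for X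
    unfolding r_def using choice_restr_hom[OF c0 S0 b Xm[OF X] bX[OF X(1,3)] X0[OF X(2)]] .
  have rc: "Comp C (c ?b z) (r X) = c (X - {m}) z" if X: "bsieve X" "X \<subseteq> S" "m \<in> X" and z: "z \<in> ?b" for X z
    unfolding r_def using choice_restr_comp[OF c0 S0 b Xm[OF X] bX[OF X(1,3)] X0[OF X(2)] z] .
  \<comment> \<open>The object and the top map must belong to the same square, hence one choice of a
    pair.\<close>
  define Q where "Q X p \<longleftrightarrow> Square (fst p) (Pr C (snd p)) (Pr C (Do m)) (r X) \<in> SqQ C \<and> snd p \<in> Obj C \<and>
      1 \<le> Len C (snd p) \<and> Par C (snd p) = a (X - {m}) \<and> in_hom C (fst p) (snd p) (Do m)" for X p
  define T where "T X = fst (SOME p. Q X p)" for X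
  define A where "A X = snd (SOME p. Q X p)" for X
  have Q: "Square (T X) (Pr C (A X)) (Pr C (Do m)) (r X) \<in> SqQ C" "A X \<in> Obj C" "1 \<le> Len C (A X)"
     "Par C (A X) = a (X - {m})" "in_hom C (T X) (A X) (Do m)" if X: "bsieve X" "X \<subseteq> S" "m \<in> X" for X
  proof -
    have "\<exists>p. Q X p"
      using SqQ_exists[OF e(4,2), of "r X" "a (X - {m})"] r[OF X] e(3) unfolding Q_def fst_conv snd_conv
      by (metis fst_conv snd_conv)
    then have "Q X (SOME p. Q X p)" by (rule someI_ex)
    then show "Square (T X) (Pr C (A X)) (Pr C (Do m)) (r X) \<in> SqQ C" "A X \<in> Obj C" "1 \<le> Len C (A X)"
     "Par C (A X) = a (X - {m})" "in_hom C (T X) (A X) (Do m)"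
      unfolding Q_def T_def A_def by blast+
  qed
  have PrA: "in_hom C (Pr C (A X)) (A X) (a (X - {m}))" if X: "bsieve X" "X \<subseteq> S" "m \<in> X" for X
    using Pr_hom[OF Q(2,3)[OF X]] Q(4)[OF X] by simp
  have sq: "Comp C u (T X) = Comp C (r X) (Pr C (A X))" if X: "bsieve X" "X \<subseteq> S" "m \<in> X" for X
    using SqQ_Pr_hom(3)[OF Q(1,2,3)[OF X] e(4,2)] e(1) by simp
  define a' where "a' X = (if m \<in> X then A X else a X)" for X
  define c' where "c' X x = (if m \<in> X then if x = m then T X else Comp C (c (X - {m}) x) (Pr C (A X)) else c X x)" for X x
  have ch0: "in_hom C (c (X - {m}) x) (a (X - {m})) (Do x)" if X: "bsieve X" "X \<subseteq> S" "m \<in> X" and x: "x \<in> X" "x \<noteq> m" for X x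
    using choice_hom[OF c0 S0 Xm[OF X] X0[OF X(2)]] x by auto
  have chb: "in_hom C (c ?b z) (a ?b) (Do z)" if z: "z \<in> ?b" for z
    using choice_hom[OF c0 S0 b _ z] bX[OF S m(1)] by auto

  have lims: "lim X (a' X) (c' X)" if X: "bsieve X" "X \<subseteq> S" for X
  proof (cases "m \<in> X")
    case False
    then have "X \<subseteq> ?S0" using X by auto
    from choice_lim[OF c0 S0 X(1) this] show ?thesis
      using False by (simp add: a'_def limit_cone_cong[of X "c' X" "c X"] c'_def)
  next
    case True
    note Y = X True
    have cX: "c' X m = T X" "\<And>x. x \<noteq> m \<Longrightarrow> c' X x = Comp C (c (X - {m}) x) (Pr C (A X))" "a' X = A X"
      using True by (auto simp: c'_def a'_def)
    have con: "cone C X le Do Dm (A X) (c' X)"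
      unfolding cone_def
    proof (intro conjI ballI impI)
      show "A X \<in> Obj C" by (rule Q(2)[OF Y])
      show h: "in_hom C (c' X x) (A X) (Do x)" if "x \<in> X" for x
        using comp_hom[OF ch0[OF Y that] PrA[OF Y]] Q(5)[OF Y] cX by (cases "x = m") auto
      fix x y assume xy: "x \<in> X" "y \<in> X" "le x y"
      have P: "x \<in> P" "y \<in> P" using xy bsieve_P[OF X(1)] by auto
      show "Comp C (Dm y x) (c' X y) = c' X x"
      proof (cases "y = m")
        case True
        show ?thesis
        proof (cases "x = m")
          case x: True
          then show ?thesis using True ide_comp[OF Q(5)[OF Y]] Dm_ide[OF mP] cX by simp
        next
          case False
          with True xy P have z: "x \<in> ?b" by (auto simp: bdry_def)
          have "Comp C (Dm m x) (T X) = Comp C (Comp C (c ?b x) u) (T X)" using u(3)[OF z] by simp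
          also have "\<dots> = Comp C (c ?b x) (Comp C (r X) (Pr C (A X)))"
            using comp_assoc[OF chb[OF z] u(2) Q(5)[OF Y]] sq[OF Y] by simp
          also have "\<dots> = Comp C (c (X - {m}) x) (Pr C (A X))"
            using comp_assoc[OF chb[OF z] r[OF Y] PrA[OF Y]] rc[OF Y z] by simp
          finally show ?thesis using True False cX by simp
        qed
      next
        case False
        then have xm: "x \<noteq> m" using le_m[of y] xy X by auto
        have "Comp C (Dm y x) (Comp C (c (X - {m}) y) (Pr C (A X))) = Comp C (Comp C (Dm y x) (c (X - {m}) y)) (Pr C (A X))"
          by (rule comp_assoc[OF Dm_hom[OF P xy(3)] ch0[OF Y xy(2) False] PrA[OF Y], symmetric])
        also have "Comp C (Dm y x) (c (X - {m}) y) = c (X - {m}) x"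
          using choice_comp[OF c0 S0 Xm[OF Y] X0[OF X(2)] _ P(1) xy(3)] xy(2) False by auto
        finally show ?thesis using xm False cX by simp
      qed
    qed
    have "\<exists>!w. in_hom C w b0 (A X) \<and> (\<forall>x\<in>X. Comp C (c' X x) w = dd x)" if cd: "cone C X le Do Dm b0 dd" for b0 dd
    proof -
      have d: "in_hom C (dd x) b0 (Do x)" if "x \<in> X" for x using cd that by (auto simp: cone_def)
      have dc: "Comp C (Dm y x) (dd y) = dd x" if "x \<in> X" "y \<in> X" "le x y" for x y
        using cd that by (auto simp: cone_def)
      have "cone C (X - {m}) le Do Dm b0 dd" using cd by (auto simp: cone_def)
      with choice_lim[OF c0 S0 Xm[OF Y] X0[OF X(2)]]
      have "\<exists>!v. in_hom C v b0 (a (X - {m})) \<and> (\<forall>x\<in>X - {m}. Comp C (c (X - {m}) x) v = dd x)"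
        by (auto simp: limit_cone_def)
      then obtain v where v: "in_hom C v b0 (a (X - {m}))" "\<And>x. x \<in> X - {m} \<Longrightarrow> Comp C (c (X - {m}) x) v = dd x"
        by blast
      \<comment> \<open>The two legs agree over \<open>a (bd m)\<close>: on each component of this
        limit, both reduce to the given cone.\<close>
      have "Comp C (Pr C (Do m)) (dd m) = Comp C (r X) v"
        unfolding e(1)[symmetric]
      proof (rule choice_ext[OF c0 S0 b])
        show "?b \<subseteq> ?S0" using bX[OF S m(1)] .
        show "in_hom C (Comp C u (dd m)) b0 (a ?b)" using u(2) d[OF True] by (rule comp_hom)
        show "in_hom C (Comp C (r X) v) b0 (a ?b)" using r[OF Y] v(1) by (rule comp_hom)
        fix z assume z: "z \<in> ?b"
        then have z': "z \<in> X - {m}" "le z m" using bX[OF X(1) True] by (auto simp: bdry_def)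
        have "Comp C (c ?b z) (Comp C u (dd m)) = Comp C (Dm m z) (dd m)"
          using comp_assoc[OF chb[OF z] u(2) d[OF True]] u(3)[OF z] by simp
        also have "\<dots> = dd z" using dc z' True by auto
        also have "\<dots> = Comp C (c ?b z) (Comp C (r X) v)"
          using comp_assoc[OF chb[OF z] r[OF Y] v(1)] rc[OF Y z] v(2)[OF z'(1)] by simp
        finally show "Comp C (c ?b z) (Comp C u (dd m)) = Comp C (c ?b z) (Comp C (r X) v)" .
      qed
      from SqQ_pullback[OF Q(1,2,3)[OF Y] e(4,2) d[OF True] _ this] v(1) Q(4)[OF Y]
      have pb: "\<exists>!w. in_hom C w b0 (A X) \<and> Comp C (T X) w = dd m \<and> Comp C (Pr C (A X)) w = v" by simp
      \<comment> \<open>The equations at the elements other than \<open>m\<close> amount to a single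
        equation with \<open>v\<close>, because \<open>v\<close> is determined by its components.
        This turns the limit property at \<open>X\<close> into the pullback property.\<close>
      have iff: "(\<forall>x\<in>X. Comp C (c' X x) w = dd x) \<longleftrightarrow> Comp C (T X) w = dd m \<and> Comp C (Pr C (A X)) w = v"
        if w: "in_hom C w b0 (A X)" for w
      proof -
        have as: "Comp C (c' X x) w = Comp C (c (X - {m}) x) (Comp C (Pr C (A X)) w)" if "x \<in> X" "x \<noteq> m" for x
          using comp_assoc[OF ch0[OF Y that] PrA[OF Y] w] cX(2)[OF that(2)] by simp
        show ?thesis
        proof
          assume h: "\<forall>x\<in>X. Comp C (c' X x) w = dd x"
          then have "Comp C (T X) w = dd m" using cX(1) True by auto
          moreover have "Comp C (Pr C (A X)) w = v"
          proof (rule choice_ext[OF c0 S0 Xm[OF Y] X0[OF X(2)] comp_hom[OF PrA[OF Y] w] v(1)])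
            fix x assume "x \<in> X - {m}"
            then show "Comp C (c (X - {m}) x) (Comp C (Pr C (A X)) w) = Comp C (c (X - {m}) x) v"
              using as[of x] h v(2)[of x] by auto
          qed
          ultimately show "Comp C (T X) w = dd m \<and> Comp C (Pr C (A X)) w = v" ..
        next
          assume h: "Comp C (T X) w = dd m \<and> Comp C (Pr C (A X)) w = v"
          show "\<forall>x\<in>X. Comp C (c' X x) w = dd x"
          proof
            fix x assume "x \<in> X"
            then show "Comp C (c' X x) w = dd x" using as[of x] h v(2)[of x] cX(1) by (cases "x = m") auto
          qed
        qed
      qed
      show ?thesis using pb iff by (simp cong: conj_cong)
    qed
    with con show ?thesis unfolding limit_cone_def cX(3) by blast
  qed

  have rs0: "restr a' c' Y X = restr a c Y X" if "Y \<subseteq> ?S0" "X \<subseteq> Y" for X Y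
    using that by (intro restr_map_cong) (auto simp: a'_def c'_def)
  have rsm: "restr a' c' Y (Y - {m}) = Pr C (A Y)" if Y: "bsieve Y" "Y \<subseteq> S" "m \<in> Y" for Y
  proof (rule restr_map_eqI)
    show "lim (Y - {m}) (a' (Y - {m})) (c' (Y - {m}))" using lims[OF Xm[OF Y]] Y by auto
    show "cone C Y le Do Dm (a' Y) (c' Y)" using lims[OF Y(1,2)] by (simp add: limit_cone_def)
    show "in_hom C (Pr C (A Y)) (a' Y) (a' (Y - {m}))" using PrA[OF Y] Y by (simp add: a'_def)
  qed (auto simp: c'_def Y)
  \<comment> \<open>If the element added last is not \<open>m\<close>, then \<open>m\<close> is in
    neither sieve: otherwise it would precede \<open>y\<close> while being largest. Such conditions
    are inherited from the given choice.\<close>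
  have out: "m \<notin> Y" if "Y \<subseteq> S" "Y - X = {y}" "\<forall>x\<in>X. lin x y" "y \<noteq> m" for X Y y
  proof
    assume "m \<in> Y"
    with that have "m \<in> X" by auto
    with that have "lin m y" "y \<in> S" by auto
    with m(2)[of y] bsieve_lin_antisym[OF S _ m(1), of y] \<open>y \<noteq> m\<close> show False by auto
  qed
  have "choice S a' c'"
    unfolding choice_iff[OF S]
  proof (intro conjI allI impI ballI)
    show "a' {} = ctx_one C" using choice_empty[OF c0] by (simp add: a'_def)
  next
    fix X assume "bsieve X \<and> X \<subseteq> S"
    then show "lim X (a' X) (c' X)" using lims by blast
  next
    fix x assume x: "x \<in> S"
    have "a' (dn x) = Do x \<and> (\<forall>y\<in>dn x. c' (dn x) y = Dm x y)"
    proof (cases "x = m")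
      case False
      then have nm: "m \<notin> dn x" using le_m[OF x] by (auto simp: down_def)
      then show ?thesis using choice_down[OF c0 S0, of x] x False by (auto simp: a'_def c'_def)
    next
      case True
      have D: "bsieve ?d" "?d \<subseteq> S" "m \<in> ?d" using bsieve_down[OF mP] down_sub[OF S m(1)] down_self[OF mP] .
      have "r ?d = Ide C (Par C (Do m))"
        unfolding r_def bdry_down[OF mP, symmetric]
        using choice_restr_refl[OF c0 S0 b] bX[OF S m(1)] e(3) by simp
      with Q(1)[OF D] SqQ_ide[OF e(4,2)] have "T ?d = Ide C (Do m)" "Pr C (A ?d) = Pr C (Do m)"
        by (auto dest: SqQ_unique)
      then have TA: "T ?d = Ide C (Do m)" "A ?d = Do m" using Pr_inj[OF _ Q(2)[OF D] e(4) Q(3)[OF D] e(2)] by auto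
      have bd: "?d - {m} = ?b" using bdry_down[OF mP] by simp
      have "c' ?d y = Dm m y" if y: "y \<in> ?d" for y
      proof (cases "y = m")
        case True
        then show ?thesis using TA(1) D(3) Dm_ide[OF mP] by (simp add: c'_def)
      next
        case False
        with y bd have "y \<in> ?b" by blast
        then show ?thesis using u(3)[of y] e(1) False D(3) TA(2) bd by (simp add: c'_def)
      qed
      then show ?thesis using True TA(2) D(3) by (simp add: a'_def)
    qed
    then show "a' (dn x) = Do x" "\<And>y. y \<in> dn x \<Longrightarrow> c' (dn x) y = Dm x y"
      by blast+
  next
    fix X Y y assume X: "bsieve X \<and> X \<subseteq> S" and Y: "bsieve Y \<and> Y \<subseteq> S"
      and h: "X \<subseteq> Y" "Y - X = {y}" "\<forall>x\<in>X. lin x y"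
    show "display_map_len1 C (restr a' c' Y X)"
    proof (cases "y = m")
      case True
      with h have m': "m \<in> Y" "X = Y - {m}" by auto
      then show ?thesis using rsm[of Y] Y Q(2,3)[of Y] by (auto simp: display_len1_iff)
    next
      case False
      have Y0: "Y \<subseteq> ?S0" using out[OF _ h(2,3) False] Y by auto
      then show ?thesis
        using c0 rs0[OF Y0 h(1)] X Y h unfolding choice_iff[OF S0] by (metis subset_trans)
    qed
  next
    fix X X' Y Y' y
    assume B: "bsieve X \<and> X \<subseteq> S" "bsieve X' \<and> X' \<subseteq> S" "bsieve Y \<and> Y \<subseteq> S" "bsieve Y' \<and> Y' \<subseteq> S"
      and h: "X \<subseteq> X'" "Y \<subseteq> Y'" "X \<subseteq> Y" "X' \<subseteq> Y'" "Y - X = {y}" "Y' - X' = {y}" "\<forall>x\<in>X'. lin x y"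
    show "distinguished C (Square (restr a' c' Y' Y) (restr a' c' Y' X')
          (restr a' c' Y X) (restr a' c' X' X))"
    proof (cases "y = m")
      case False
      have Y0: "Y' \<subseteq> ?S0" using out[OF _ h(6,7) False] B by auto
      have "distinguished C (Square (restr a c Y' Y) (restr a c Y' X')
          (restr a c Y X) (restr a c X' X))"
        using choice_sq[OF c0 S0 _ _ _ _ Y0 h] B by blast
      moreover have "X' \<subseteq> ?S0" "Y \<subseteq> ?S0" using Y0 h by auto
      ultimately show ?thesis using rs0 Y0 h by simp
    next
      case True
      with h have mm: "m \<in> Y" "X = Y - {m}" "m \<in> Y'" "X' = Y' - {m}" by auto
      have Y: "bsieve Y" "Y \<subseteq> S" "m \<in> Y" and Y': "bsieve Y'" "Y' \<subseteq> S" "m \<in> Y'" using B mm by auto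
      have X0: "X' \<subseteq> ?S0" "X \<subseteq> ?S0" using Y Y' mm by auto
      let ?g = "restr a c X' X"
      have g: "in_hom C ?g (a X') (Par C (A Y))"
        using choice_restr_hom[OF c0 S0 _ _ h(1) X0(1)] B Q(4)[OF Y] mm(2) by simp
      \<comment> \<open>Pull \<open>Pr C (A Y)\<close> back along \<open>?g\<close>. Composed
        horizontally with the square defining \<open>A Y\<close>, this has the same right side and
        bottom as the square defining \<open>A Y'\<close>, so \<open>B0\<close> is
        \<open>A Y'\<close> and \<open>t\<close> turns out to be the restriction map.\<close>
      obtain t B0 where t: "Square t (Pr C B0) (Pr C (A Y)) ?g \<in> SqQ C" "B0 \<in> Obj C" "1 \<le> Len C B0"
        "Par C B0 = a X'" "in_hom C t B0 (A Y)"
        using SqQ_exists[OF Q(2,3)[OF Y] g] .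
      have "Comp C (r Y) ?g = r Y'"
        unfolding r_def mm(2,4)[symmetric]
        using choice_restr_trans[OF c0 S0 b _ _ _ h(1) X0(1)] B bX[OF Y(1,3)] mm by simp
      with SqQ_hcomp[OF t(1) Q(1)[OF Y]] have "Square (Comp C (T Y) t) (Pr C B0) (Pr C (Do m)) (r Y') \<in> SqQ C"
        by simp
      with Q(1)[OF Y'] have eq: "Comp C (T Y) t = T Y'" "Pr C B0 = Pr C (A Y')" by (auto dest: SqQ_unique)
      have B0: "B0 = A Y'" using Pr_inj[OF eq(2) t(2) Q(2)[OF Y'] t(3) Q(3)[OF Y']] .
      have "restr a' c' Y' Y = t"
      proof (rule restr_map_eqI)
        show "lim Y (a' Y) (c' Y)" by (rule lims[OF Y(1,2)])
        show "Y \<subseteq> Y'" by (rule h(2))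
        show "cone C Y' le Do Dm (a' Y') (c' Y')" using lims[OF Y'(1,2)] by (simp add: limit_cone_def)
        show "in_hom C t (a' Y') (a' Y)" using t(5) B0 mm by (simp add: a'_def)
        fix x assume x: "x \<in> Y"
        show "Comp C (c' Y x) t = c' Y' x"
        proof (cases "x = m")
          case True then show ?thesis using eq mm by (simp add: c'_def)
        next
          case False
          have PA: "in_hom C (Pr C (A Y')) (A Y') (a X')" using PrA[OF Y'] mm by simp
          have g': "in_hom C ?g (a X') (a (Y - {m}))" using g Q(4)[OF Y] by simp
          have "Comp C (Comp C (c (Y - {m}) x) (Pr C (A Y))) t = Comp C (c (Y - {m}) x) (Comp C (Pr C (A Y)) t)"
            by (rule comp_assoc[OF ch0[OF Y x False] PrA[OF Y] t(5)])
          also have "Comp C (Pr C (A Y)) t = Comp C ?g (Pr C (A Y'))"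
            using SqQ_Pr_hom(3)[OF t(1-3) Q(2,3)[OF Y]] B0 by simp
          also have "Comp C (c (Y - {m}) x) (Comp C ?g (Pr C (A Y'))) = Comp C (Comp C (c (Y - {m}) x) ?g) (Pr C (A Y'))"
            by (rule comp_assoc[OF ch0[OF Y x False] g' PA, symmetric])
          also have "Comp C (c (Y - {m}) x) ?g = c X' x"
            using choice_restr_comp[OF c0 S0 _ _ h(1) X0(1), of x] B x False mm by auto
          finally show ?thesis using False mm by (simp add: c'_def)
        qed
      qed
      moreover have "restr a' c' X' X = ?g" by (rule rs0[OF X0(1) h(1)])
      moreover have "restr a' c' Y X = Pr C (A Y)" "restr a' c' Y' X' = Pr C (A Y')"
        using rsm[OF Y] rsm[OF Y'] mm by auto
      ultimately show ?thesis using SqQ_distinguished[OF t(1)] B0 by simp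
    qed
  qed
  then show ?thesis by blast
qed

text \<open>Two choices agree on every sieve, so quantifying over all of them loses nothing.\<close>

definition good :: "'p \<Rightarrow> bool" where
  "good x \<longleftrightarrow> (\<forall>a c. choice (bd x) a c \<longrightarrow>
     (\<exists>u. display_map_len1 C u \<and> in_hom C u (Do x) (a (bd x)) \<and>
        (\<forall>z\<in>bd x. Comp C (c (bd x) z) u = Dm x z)))"

text \<open>Largest elements are added one at a time. The choice found on \<open>S - {m}\<close>
  restricts to \<open>bd m\<close>, which is the situation that \<open>good m\<close>
  describes.\<close>

lemma choice_exists:
  "bsieve S \<Longrightarrow> (\<And>x. x \<in> S \<Longrightarrow> good x) \<Longrightarrow> \<exists>a c. choice S a c"
proof (induction "card S" arbitrary: S rule: less_induct)
  case less
  note S = less(2)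
  show ?case
  proof (cases "S = {}")
    case True
    \<comment> \<open>The empty cone has no components, and the terminal object is the empty
      limit.\<close>
    have "choice {} (\<lambda>X. ctx_one C) (\<lambda>X x. undefined)"
      unfolding choice_iff[OF S[unfolded True]]
      using one_obj one_terminal by (auto simp: limit_cone_def cone_def)
    then show ?thesis using True by blast
  next
    case False
    then obtain m where m: "m \<in> S" "\<And>x. x \<in> S \<Longrightarrow> lin x m" using bsieve_max[OF S] by blast
    have b: "bsieve (S - {m})" using m S by (intro bsieve_Diff_max)
    have "card (S - {m}) < card S" using m bsieve_finite[OF S] by (intro psubset_card_mono) auto
    from less(1)[OF this b] less(3) obtain a c where ac: "choice (S - {m}) a c" by auto
    have mP: "m \<in> P" using S m bsieve_P by auto
    have "choice (bd m) a c"
      by (rule choice_sub[OF ac b bsieve_bdry[OF mP] bdry_sub_Diff[OF S m(1)]])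
    with less(3)[OF m(1)] obtain u where "display_map_len1 C u" "in_hom C u (Do m) (a (bd m))"
        "\<forall>z\<in>bd m. Comp C (c (bd m) z) u = Dm m z" unfolding good_def by blast
    then show ?thesis by (intro choice_extend[OF S m ac]) auto
  qed
qed

lemma cellularI:
  assumes "\<And>x. x \<in> P \<Longrightarrow> good x"
  shows "cellular C P le lin Do Dm"
  unfolding cellular_def
  using partial_order finite_down local_lin diagram choice_exists[OF bsieve_down] assms
  by (meson bsieve_P bsieve_down)

section \<open>Lengths of limits and restriction to initial segments\<close>

lemma choice_Len:
  assumes "choice S a c" "bsieve S"
  shows "bsieve X \<Longrightarrow> X \<subseteq> S \<Longrightarrow> Len C (a X) = card X"
proof (induction "card X" arbitrary: X)
  case 0
  then have "X = {}" using bsieve_finite by auto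
  then show ?case using choice_empty[OF assms(1)] Len_one by simp
next
  case (Suc n)
  then obtain m where m: "m \<in> X" "\<And>x. x \<in> X \<Longrightarrow> lin x m" using bsieve_max[of X] by fastforce
  have b: "bsieve (X - {m})" using m Suc by (intro bsieve_Diff_max)
  have "card (X - {m}) = n" using Suc m bsieve_finite by simp
  then have "Len C (a (X - {m})) = n" using Suc b by auto
  moreover note choice_display(2,3)[OF assms Suc(3,4) m] Len_Par[OF choice_obj[OF assms Suc(3,4)]]
  ultimately show ?case using Suc(2) by simp
qed

text \<open>The largest elements of \<open>X'\<close> are removed one by one. As \<open>X\<close> is
  an initial segment, none of them is in \<open>X\<close>, so the restriction is a composite of maps
  \<open>Pr\<close>. For sieves in general the restriction need not be a display map.\<close>

lemma choice_initial_T_map: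
  assumes ac: "choice S a c" and S: "bsieve S"
  shows "bsieve X \<Longrightarrow> bsieve X' \<Longrightarrow> X \<subseteq> X' \<Longrightarrow> X' \<subseteq> S \<Longrightarrow> (\<And>x y. x \<in> X \<Longrightarrow> y \<in> X' - X \<Longrightarrow> lin x y) \<Longrightarrow>
    T_le C (a X) (a X') \<and> restr a c X' X = T_map C (a X') (a X)"
proof (induction "card X'" arbitrary: X' rule: less_induct)
  case less
  note X = less(2) and X' = less(3) and sub = less(4,5) and lin = less(6)
  have oX: "a X \<in> Obj C" using choice_obj[OF ac S X] sub by auto
  show ?case
  proof (cases "X = X'")
    case True
    then show ?thesis using choice_restr_refl[OF ac S X] sub T_le_refl[OF oX] T_map_refl[OF oX] by auto
  next
    case False
    then have "X' \<noteq> {}" using sub by auto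
    then obtain m where m: "m \<in> X'" "\<And>x. x \<in> X' \<Longrightarrow> lin x m" using bsieve_max[OF X'] by blast
    \<comment> \<open>Otherwise an element of \<open>X' - X\<close> would lie on both sides of
      \<open>m\<close> in the linear order.\<close>
    have mX: "m \<notin> X"
    proof
      assume mX: "m \<in> X"
      obtain y where y: "y \<in> X' - X" using False sub by auto
      then have "lin m y" "lin y m" using lin[OF mX y] m(2)[of y] by auto
      then show False using bsieve_lin_antisym[OF X' m(1), of y] y mX by auto
    qed
    have b: "bsieve (X' - {m})" using m X' by (intro bsieve_Diff_max)
    have "card (X' - {m}) < card X'" using m bsieve_finite[OF X'] by (intro psubset_card_mono) auto
    moreover have "X \<subseteq> X' - {m}" "X' - {m} \<subseteq> S" using sub mX by auto
    ultimately have IH: "T_le C (a X) (a (X' - {m}))" "restr a c (X' - {m}) X = T_map C (a (X' - {m})) (a X)"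
      using less(1)[of "X' - {m}"] X b lin by auto
    have oX': "a X' \<in> Obj C" using choice_obj[OF ac S X'] sub by auto
    note d = choice_display[OF ac S X' sub(2) m]
    have T: "T_le C (a (X' - {m})) (a X')" using T_le_Par[OF oX'] d(3) by simp
    have "restr a c X' X = Comp C (restr a c (X' - {m}) X) (restr a c X' (X' - {m}))"
      using choice_restr_trans[OF ac S X b X' _ _ sub(2)] \<open>X \<subseteq> X' - {m}\<close> by auto
    also have "\<dots> = Comp C (T_map C (a (X' - {m})) (a X)) (T_map C (a X') (a (X' - {m})))"
      using IH(2) d T_map_Par[OF oX' d(2)] by simp
    also have "\<dots> = T_map C (a X') (a X)" by (rule T_map_comp[OF IH(1) T])
    finally show ?thesis using T_le_trans[OF IH(1) T] by blast
  qed
qed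

end

section \<open>Boundaries of functors of several variables\<close>

lemma prod_hom_iff:
  "in_hom (prod_cat As) fs xs ys \<longleftrightarrow> length fs = length As \<and> length xs = length As \<and> length ys = length As \<and>
     (\<forall>i<length As. in_hom (As ! i) (fs ! i) (xs ! i) (ys ! i))"
proof -
  have "map2 Dom As fs = xs \<longleftrightarrow> length xs = length As \<and> (\<forall>i<length As. Dom (As ! i) (fs ! i) = xs ! i)"
    "map2 Cod As fs = ys \<longleftrightarrow> length ys = length As \<and> (\<forall>i<length As. Cod (As ! i) (fs ! i) = ys ! i)"
    if "length fs = length As"
    using that by (auto intro: nth_equalityI)
  then show ?thesis unfolding in_hom_def prod_cat_def by auto
qed

lemma prod_Obj_iff: "xs \<in> Obj (prod_cat As) \<longleftrightarrow> length xs = length As \<and> (\<forall>i<length As. xs ! i \<in> Obj (As ! i))"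
  by (simp add: prod_cat_def)

lemma prod_Arr_iff: "fs \<in> Arr (prod_cat As) \<longleftrightarrow> length fs = length As \<and> (\<forall>i<length As. fs ! i \<in> Arr (As ! i))"
  by (simp add: prod_cat_def)

lemma TP_obj_iff: "xs \<in> TP_obj As \<longleftrightarrow> xs \<in> Obj (prod_cat As) \<and> (\<forall>i<length As. 1 \<le> Len (As ! i) (xs ! i))"
  by (auto simp: TP_obj_def prod_Obj_iff T_obj_def)

text \<open>The lexicographic order on tuples of numbers. Below a fixed tuple of objects,
  \<open>TP_lex\<close> is this order applied to lengths (\<open>LX_Len_iff\<close>), so linearity
  is inherited from here.\<close>

lemma nat_lex_linear:
  fixes f g h :: "nat \<Rightarrow> nat" and n :: nat
  defines "lx \<equiv> \<lambda>f g. (\<forall>i<n. f i = g i) \<or> (\<exists>i<n. (\<forall>j<i. f j = g j) \<and> f i < g i)"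
  shows "lx f g \<or> lx g f" "lx f g \<Longrightarrow> lx g h \<Longrightarrow> lx f h" "lx f g \<Longrightarrow> lx g f \<Longrightarrow> i < n \<Longrightarrow> f i = g i"
proof -
  show "lx f g \<or> lx g f"
  proof (cases "\<forall>i<n. f i = g i")
    case False
    then obtain k where k: "k < n \<and> f k \<noteq> g k" by auto
    define i where "i = (LEAST k. k < n \<and> f k \<noteq> g k)"
    have "i < n" "f i \<noteq> g i" using LeastI[of "\<lambda>k. k < n \<and> f k \<noteq> g k", OF k] by (auto simp: i_def)
    moreover have "f j = g j" if "j < i" for j
      using not_less_Least[of j "\<lambda>k. k < n \<and> f k \<noteq> g k"] that \<open>i < n\<close> by (auto simp: i_def)
    ultimately show ?thesis unfolding lx_def by (metis nat_neq_iff)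
  qed (auto simp: lx_def)
  show "lx f h" if fg: "lx f g" and gh: "lx g h"
  proof -
    consider "\<forall>i<n. f i = g i" | i where "i < n" "\<forall>j<i. f j = g j" "f i < g i"
      using fg by (auto simp: lx_def)
    then show ?thesis
    proof cases
      case 1
      then show ?thesis using gh by (auto simp: lx_def)
    next
      case i: 2
      consider "\<forall>i<n. g i = h i" | j where "j < n" "\<forall>k<j. g k = h k" "g j < h j"
        using gh by (auto simp: lx_def)
      then show ?thesis
      proof cases
        case 1
        with i show ?thesis by (auto simp: lx_def intro!: exI[of _ i])
      next
        case 2
        with i have "\<forall>k<min i j. f k = h k" "min i j < n" by auto
        moreover have "f (min i j) < h (min i j)"
          using i 2 by (cases i j rule: linorder_cases) (auto simp: min_def)
        ultimately show ?thesis by (auto simp: lx_def simp del: min_less_iff_disj)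
      qed
    qed
  qed
  show "f i = g i" if "lx f g" "lx g f" "i < n"
    using that unfolding lx_def by (metis linorder_neqE_nat less_irrefl order_less_asym)
qed

section \<open>The product poset and its lexicographic local linearization\<close>

locale ctxs =
  fixes As :: "('o, 'm) ctxcat list"
  assumes contextuals: "\<And>A. A \<in> set As \<Longrightarrow> contextual A"
begin

lemma ctx_nth: "i < length As \<Longrightarrow> ctx (As ! i)"
  by (simp add: ctx_def contextuals)

abbreviation "LE \<equiv> TP_le As"
abbreviation "LX \<equiv> TP_lex As"
abbreviation "TP \<equiv> TP_obj As"
abbreviation "OB \<equiv> Obj (prod_cat As)"

lemma TP_OB: "xs \<in> TP \<Longrightarrow> xs \<in> OB"
  by (simp add: TP_obj_iff)

lemma OB_nth: "xs \<in> OB \<Longrightarrow> i < length As \<Longrightarrow> xs ! i \<in> Obj (As ! i)"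
  by (simp add: prod_Obj_iff)

lemma LE_refl: "xs \<in> OB \<Longrightarrow> LE xs xs"
  by (auto simp: TP_le_def prod_Obj_iff intro: ctx.T_le_refl ctx_nth)

lemma LE_trans: "LE xs ys \<Longrightarrow> LE ys zs \<Longrightarrow> LE xs zs"
  unfolding TP_le_def using ctx.T_le_trans[OF ctx_nth] by blast

lemma LE_antisym: "xs \<in> OB \<Longrightarrow> ys \<in> OB \<Longrightarrow> LE xs ys \<Longrightarrow> LE ys xs \<Longrightarrow> xs = ys"
  by (auto simp: TP_le_def prod_Obj_iff intro!: nth_equalityI ctx.T_le_antisym[OF ctx_nth])

lemma LE_TP: "xs \<in> TP \<Longrightarrow> ys \<in> OB \<Longrightarrow> LE xs ys \<Longrightarrow> ys \<in> TP"
  unfolding TP_obj_iff TP_le_def using ctx.T_le_Len[OF ctx_nth] order_trans by blast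

lemma TP_partial_order: "partial_order_on TP (rel_on TP LE)"
  unfolding partial_order_on_def preorder_on_def
  using TP_OB LE_antisym LE_trans LE_refl
  by (auto simp: rel_on_def refl_on_def trans_def antisym_def)

lemma TP_finite_down: "finite (down TP LE xs)"
proof -
  have "down TP LE xs \<subseteq> {ys. set ys \<subseteq> (\<Union>i<length As. {y. T_le (As ! i) y (xs ! i)}) \<and> length ys = length As}"
    by (clarsimp simp: down_def TP_obj_iff prod_Obj_iff TP_le_def in_set_conv_nth) blast
  moreover have "finite (\<Union>i<length As. {y. T_le (As ! i) y (xs ! i)})"
    by (auto intro!: ctx.finite_T_le ctx_nth)
  ultimately show ?thesis by (rule finite_subset[OF _ finite_lists_length_eq])
qed

text \<open>The comparability clause of \<open>TP_lex\<close> holds automatically below a common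
  bound, since the entries there lie in a chain.\<close>

lemma LX_down_iff:
  assumes "LE xs zs" "LE ys zs" "length xs = length As" "length ys = length As"
  shows "LX xs ys \<longleftrightarrow> xs = ys \<or> (\<exists>i<length As. (\<forall>j<i. xs ! j = ys ! j) \<and>
     T_le (As ! i) (xs ! i) (ys ! i) \<and> xs ! i \<noteq> ys ! i)"
  using assms ctx.T_le_total[OF ctx_nth] unfolding TP_lex_def TP_le_def by meson

lemma LX_Len_iff:
  assumes "LE xs zs" "LE ys zs" "length xs = length As" "length ys = length As"
  shows "LX xs ys \<longleftrightarrow> (\<forall>i<length As. Len (As ! i) (xs ! i) = Len (As ! i) (ys ! i)) \<or>
    (\<exists>i<length As. (\<forall>j<i. Len (As ! j) (xs ! j) = Len (As ! j) (ys ! j)) \<and>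
     Len (As ! i) (xs ! i) < Len (As ! i) (ys ! i))"
proof -
  have eq: "xs ! i = ys ! i \<longleftrightarrow> Len (As ! i) (xs ! i) = Len (As ! i) (ys ! i)" if "i < length As" for i
    using ctx.T_le_Len_eq[OF ctx_nth[OF that], of "xs ! i" "zs ! i" "ys ! i"] that assms by (auto simp: TP_le_def)
  have le: "T_le (As ! i) (xs ! i) (ys ! i) \<longleftrightarrow> Len (As ! i) (xs ! i) \<le> Len (As ! i) (ys ! i)" if "i < length As" for i
    using ctx.T_le_chain[OF ctx_nth[OF that], of "xs ! i" "zs ! i" "ys ! i"] that assms by (auto simp: TP_le_def)
  have "xs = ys \<longleftrightarrow> (\<forall>i<length As. Len (As ! i) (xs ! i) = Len (As ! i) (ys ! i))"
    using assms(3,4) eq by (auto simp: list_eq_iff_nth_eq)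
  moreover have "(\<forall>j<i. xs ! j = ys ! j) \<longleftrightarrow> (\<forall>j<i. Len (As ! j) (xs ! j) = Len (As ! j) (ys ! j))"
    if "i < length As" for i using eq that by auto
  moreover have "T_le (As ! i) (xs ! i) (ys ! i) \<and> xs ! i \<noteq> ys ! i \<longleftrightarrow> Len (As ! i) (xs ! i) < Len (As ! i) (ys ! i)"
    if "i < length As" for i using eq le that by auto
  ultimately show ?thesis unfolding LX_down_iff[OF assms] by blast
qed

lemma TP_local_linearization: "local_linearization TP LE LX"
  unfolding local_linearization_def
proof (intro conjI ballI impI)
  fix xs ys assume x: "xs \<in> TP" "ys \<in> TP" "LX xs ys"
  have cmp: "T_le (As ! j) (xs ! j) (ys ! j) \<or> T_le (As ! j) (ys ! j) (xs ! j)" if j: "j < length As" for j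
  proof -
    have r: "T_le (As ! j) (xs ! j) (xs ! j)" using ctx.T_le_refl[OF ctx_nth[OF j] OB_nth[OF TP_OB[OF x(1)] j]] .
    from x(3) show ?thesis unfolding TP_lex_def using r j by (metis linorder_neqE_nat)
  qed
  \<comment> \<open>The common upper bound takes the larger of the two entries at each index, which
    are comparable by \<open>cmp\<close>.\<close>
  define zs where "zs = map (\<lambda>i. if T_le (As ! i) (xs ! i) (ys ! i) then ys ! i else xs ! i) [0..<length As]"
  have "zs \<in> TP" using x by (auto simp: zs_def TP_obj_def)
  moreover have "LE xs zs" using LE_refl[OF TP_OB[OF x(1)]] by (auto simp: zs_def TP_le_def)
  moreover have "LE ys zs" using cmp LE_refl[OF TP_OB[OF x(2)]] by (auto simp: zs_def TP_le_def)
  ultimately show "\<exists>z\<in>TP. LE xs z \<and> LE ys z" by blast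
next
  fix zs assume z: "zs \<in> TP"
  let ?D = "down TP LE zs"
  have D: "LE xs zs" "length xs = length As" "xs \<in> OB" if "xs \<in> ?D" for xs
    using that by (auto simp: down_def TP_obj_iff prod_Obj_iff)
  let ?L = "\<lambda>xs i. Len (As ! i) (xs ! i)"
  have L: "LX xs ys \<longleftrightarrow> (\<forall>i<length As. ?L xs i = ?L ys i) \<or>
    (\<exists>i<length As. (\<forall>j<i. ?L xs j = ?L ys j) \<and> ?L xs i < ?L ys i)" if "xs \<in> ?D" "ys \<in> ?D" for xs ys
    by (rule LX_Len_iff) (use D that in auto)
  have tot: "LX xs ys \<or> LX ys xs" if "xs \<in> ?D" "ys \<in> ?D" for xs ys
    unfolding L[OF that] L[OF that(2,1)] by (rule nat_lex_linear(1))
  have tr: "LX xs ws" if "xs \<in> ?D" "ys \<in> ?D" "ws \<in> ?D" "LX xs ys" "LX ys ws" for xs ys ws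
    using that(4,5) unfolding L[OF that(1,2)] L[OF that(2,3)] L[OF that(1,3)] by (rule nat_lex_linear(2))
  have anti: "xs = ys" if "xs \<in> ?D" "ys \<in> ?D" "LX xs ys" "LX ys xs" for xs ys
  proof (rule nth_equalityI)
    show "length xs = length ys" using D that by simp
    fix i assume "i < length xs"
    then have i: "i < length As" using D that by simp
    have "?L xs i = ?L ys i"
      by (rule nat_lex_linear(3)[OF that(3)[unfolded L[OF that(1,2)]] that(4)[unfolded L[OF that(2,1)]] i])
    moreover have "T_le (As ! i) (xs ! i) (zs ! i)" "T_le (As ! i) (ys ! i) (zs ! i)"
      using D(1)[OF that(1)] D(1)[OF that(2)] i by (auto simp: TP_le_def)
    ultimately show "xs ! i = ys ! i" using ctx.T_le_Len_eq[OF ctx_nth[OF i]] by blast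
  qed
  have "refl_on ?D (rel_on ?D LX)" using tot by (auto simp: refl_on_def rel_on_def)
  moreover have "trans (rel_on ?D LX)" using tr unfolding trans_def rel_on_def by blast
  moreover have "antisym (rel_on ?D LX)" using anti unfolding antisym_def rel_on_def by blast
  moreover have "total_on ?D (rel_on ?D LX)" using tot unfolding total_on_def rel_on_def by blast
  ultimately show "linear_order_on ?D (rel_on ?D LX)"
    by (auto simp: linear_order_on_def partial_order_on_def preorder_on_def rel_on_def)
  have "LX xs ys" if xy: "xs \<in> ?D" "ys \<in> ?D" "LE xs ys" for xs ys
  proof -
    have le: "?L xs i \<le> ?L ys i" if "i < length As" for i
      using ctx.T_le_Len[OF ctx_nth[OF that]] xy(3) that by (auto simp: TP_le_def)
    \<comment> \<open>Entrywise inequality excludes the strict alternative in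
      \<open>LX ys xs\<close>, which leaves equal lengths.\<close>
    have "LX ys xs \<Longrightarrow> LX xs ys"
      unfolding L[OF xy(1,2)] L[OF xy(2,1)] using le by (metis leD)
    with tot[OF xy(1,2)] show ?thesis by blast
  qed
  then show "rel_on ?D LE \<subseteq> rel_on ?D LX" by (auto simp: rel_on_def)
qed

end

section \<open>Functors of several variables as diagrams on the product poset\<close>

locale prodfun = ctx C + ctxs As for C :: "('o, 'm) ctxcat" and As :: "('o, 'm) ctxcat list" +
  fixes Fo :: "'o list \<Rightarrow> 'o" and Fm :: "'m list \<Rightarrow> 'm"
  assumes is_fun: "is_functor (prod_cat As) C Fo Fm"
begin

lemma Fo_obj: "xs \<in> OB \<Longrightarrow> Fo xs \<in> Obj C"
  using is_fun by (simp add: is_functor_def)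

lemma Fm_hom: "in_hom (prod_cat As) fs xs ys \<Longrightarrow> in_hom C (Fm fs) (Fo xs) (Fo ys)"
  using is_fun by (auto simp: is_functor_def in_hom_def)

lemma Fm_comp:
  assumes "in_hom (prod_cat As) gs ys zs" "in_hom (prod_cat As) fs xs ys"
  shows "Comp C (Fm gs) (Fm fs) = Fm (map (\<lambda>i. Comp (As ! i) (gs ! i) (fs ! i)) [0..<length As])"
  using is_fun assms unfolding is_functor_def in_hom_def by (auto simp: prod_cat_def)

lemma Fm_ide: "xs \<in> OB \<Longrightarrow> Fm (map (\<lambda>i. Ide (As ! i) (xs ! i)) [0..<length As]) = Ide C (Fo xs)"
proof -
  assume xs: "xs \<in> OB"
  then have "map (\<lambda>i. Ide (As ! i) (xs ! i)) [0..<length As] = Ide (prod_cat As) xs"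
    by (auto simp: prod_cat_def intro!: nth_equalityI)
  then show ?thesis using is_fun xs by (simp add: is_functor_def)
qed

abbreviation "TM \<equiv> TP_fun As Fm"

lemma tmap_hom:
  assumes "LE xs ys" "xs \<in> OB" "ys \<in> OB"
  shows "in_hom (prod_cat As) (map (\<lambda>i. T_map (As ! i) (ys ! i) (xs ! i)) [0..<length As]) ys xs"
  using assms by (auto simp: prod_hom_iff prod_Obj_iff TP_le_def intro: ctx.T_map_hom ctx_nth)

lemma TM_hom: "LE xs ys \<Longrightarrow> xs \<in> OB \<Longrightarrow> ys \<in> OB \<Longrightarrow> in_hom C (TM ys xs) (Fo ys) (Fo xs)"
  unfolding TP_fun_def by (intro Fm_hom tmap_hom)

lemma TM_ide: "xs \<in> OB \<Longrightarrow> TM xs xs = Ide C (Fo xs)"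
  unfolding TP_fun_def
  by (subst Fm_ide[symmetric], assumption)
    (auto intro!: arg_cong[of _ _ Fm] ctx.T_map_refl ctx_nth simp: prod_Obj_iff)

lemma TM_comp:
  assumes "LE xs ys" "LE ys zs" "xs \<in> OB" "ys \<in> OB" "zs \<in> OB"
  shows "Comp C (TM ys xs) (TM zs ys) = TM zs xs"
  unfolding TP_fun_def Fm_comp[OF tmap_hom[OF assms(1,3,4)] tmap_hom[OF assms(2,4,5)]]
  using assms by (auto intro!: arg_cong[of _ _ Fm] ctx.T_map_comp ctx_nth simp: TP_le_def)

lemma TP_diagram: "poset_op_functor C TP LE Fo TM"
  unfolding poset_op_functor_def
  using Fo_obj TM_hom TM_ide TM_comp TP_OB by auto

sublocale celldiag C TP LE LX Fo TM
  by unfold_locales (use TP_partial_order TP_finite_down TP_local_linearization TP_diagram in auto)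

end

text \<open>A multimorphism without its condition on squares. Cellularity enters in the pointwise
  form \<open>good\<close>, to which it is equivalent by \<open>cellularI\<close> and
  \<open>cellular_good\<close>.\<close>

locale cellfun = prodfun C As Fo Fm
  for C :: "('o, 'm) ctxcat" and As :: "('o, 'm) ctxcat list" and Fo :: "'o list \<Rightarrow> 'o" and Fm :: "'m list \<Rightarrow> 'm" +
  assumes zero: "\<And>xs i. xs \<in> OB \<Longrightarrow> i < length As \<Longrightarrow> Len (As ! i) (xs ! i) = 0 \<Longrightarrow> Fo xs = ctx_one C"
    and good: "\<And>xs. xs \<in> TP \<Longrightarrow> good xs"
begin

section \<open>The boundary object and its limit cone\<close>

abbreviation "bobj \<equiv> bdry_obj As C Fo Fm"
abbreviation "bcone \<equiv> bdry_cone As C Fo Fm"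
abbreviation "bproj \<equiv> bdry_proj As C Fo Fm"
abbreviation "bmap \<equiv> bdry_map As C Fo Fm"
abbreviation "fcone \<equiv> face_cone As C Fo Fm"

lemma choice_ex: "bsieve S \<Longrightarrow> \<exists>a c. choice S a c"
  by (rule choice_exists) (auto intro: good bsieve_P)

text \<open>The boundary is described through all choices on \<open>dn xs\<close>; by uniqueness, a
  choice on any bounded sieve containing \<open>bd xs\<close> computes it as well.\<close>

lemma bdry_choice:
  assumes xs: "xs \<in> TP" and ac: "choice S a c" "bsieve S" and sub: "bd xs \<subseteq> S"
  shows "bobj xs = a (bd xs)" "zs \<in> bd xs \<Longrightarrow> bcone xs zs = c (bd xs) zs"
proof -
  have b: "bsieve (bd xs)" "bsieve (dn xs)" "bd xs \<subseteq> dn xs"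
    using bsieve_bdry bsieve_down xs bdry_down by auto
  have u: "a' (bd xs) = a (bd xs)" "\<forall>z\<in>bd xs. c' (bd xs) z = c (bd xs) z" if "choice (dn xs) a' c'" for a' c'
    using choice_unique[OF that ac(1) b(2) ac(2) b(1,3) sub] by auto
  obtain a' c' where ac': "choice (dn xs) a' c'" using choice_ex[OF b(2)] by blast
  show "bobj xs = a (bd xs)"
    unfolding bdry_obj_def cell_obj_def using ac' u by (intro the_equality) blast+
  show "bcone xs zs = c (bd xs) zs" if "zs \<in> bd xs"
    unfolding bdry_cone_def cell_cone_def using ac' u that by (intro the_equality) blast+
qed

lemma bdry_spec:
  assumes xs: "xs \<in> TP"
  shows Fo_Len: "1 \<le> Len C (Fo xs)"
    and bdry_obj_Par: "bobj xs = Par C (Fo xs)"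
    and bdry_lim: "lim (bd xs) (Par C (Fo xs)) (bcone xs)"
    and bdry_cone_Pr: "zs \<in> bd xs \<Longrightarrow> Comp C (bcone xs zs) (Pr C (Fo xs)) = TM xs zs"
proof -
  have b: "bsieve (bd xs)" "bsieve (dn xs)" "bd xs \<subseteq> dn xs" "xs \<in> dn xs"
    using bsieve_bdry bsieve_down xs bdry_down down_self by auto
  obtain a c where ac: "choice (dn xs) a c" using choice_ex[OF b(2)] by blast
  note bc = bdry_choice[OF xs ac b(2,3)]
  note d = choice_display_down[OF ac b(2,4)]
  show "1 \<le> Len C (Fo xs)" "bobj xs = Par C (Fo xs)" using d bc by auto
  show "lim (bd xs) (Par C (Fo xs)) (bcone xs)"
    unfolding d(3) by (subst limit_cone_cong[where c' = "c (bd xs)"]) (use bc(2) choice_lim[OF ac b(2,1,3)] in auto)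
  show "Comp C (bcone xs zs) (Pr C (Fo xs)) = TM xs zs" if "zs \<in> bd xs"
    using choice_restr_comp[OF ac b(2,1,2,3) _ that] bc(2)[OF that] d(1) choice_down(2)[OF ac b(2,4)] that b(3)
    by auto
qed

lemma bdry_ext:
  assumes "xs \<in> TP" "in_hom C u b (Par C (Fo xs))" "in_hom C v b (Par C (Fo xs))"
    "\<And>z. z \<in> bd xs \<Longrightarrow> Comp C (bcone xs z) u = Comp C (bcone xs z) v"
  shows "u = v"
  using lim_ext[OF bdry_lim[OF assms(1)] _ assms(2-4)] by (auto simp: bdry_def)

text \<open>The limit property allows only one map with these components, and \<open>Pr\<close> has
  them. The condition on squares thereby concerns squares between maps \<open>Pr\<close>.\<close>

lemma bdry_proj_Pr:
  assumes xs: "xs \<in> TP"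
  shows "bproj xs = Pr C (Fo xs)"
  unfolding bdry_proj_def bdry_obj_Par[OF xs]
proof (rule the_equality)
  show "in_hom C (Pr C (Fo xs)) (Fo xs) (Par C (Fo xs)) \<and>
    (\<forall>zs\<in>bd xs. Comp C (bcone xs zs) (Pr C (Fo xs)) = TM xs zs)"
    using Pr_hom[OF Fo_obj[OF TP_OB[OF xs]] Fo_Len[OF xs]] bdry_cone_Pr[OF xs] by blast
  then show "u = Pr C (Fo xs)" if "in_hom C u (Fo xs) (Par C (Fo xs)) \<and>
    (\<forall>zs\<in>bd xs. Comp C (bcone xs zs) u = TM xs zs)" for u
    using that by - (rule bdry_ext[OF xs], auto)
qed

text \<open>The limit cone of the boundary, extended to all objects strictly below \<open>xs\<close>: where some entry
  has length 0 the value of the functor is the terminal object.\<close>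

definition econe :: "'o list \<Rightarrow> 'o list \<Rightarrow> 'm" where
  "econe xs zs = (if zs \<in> TP then bcone xs zs else to_one C (bobj xs))"

lemma Fo_one: "zs \<in> OB \<Longrightarrow> zs \<notin> TP \<Longrightarrow> Fo zs = ctx_one C"
proof -
  assume zs: "zs \<in> OB" "zs \<notin> TP"
  then obtain i where "i < length As" "Len (As ! i) (zs ! i) = 0" by (force simp: TP_obj_iff)
  with zero zs show ?thesis by blast
qed

lemma Par_Fo_obj: "xs \<in> TP \<Longrightarrow> Par C (Fo xs) \<in> Obj C"
  by (intro Par_obj Fo_obj TP_OB)

lemma econe_hom:
  assumes "xs \<in> TP" "zs \<in> OB" "LE zs xs" "zs \<noteq> xs"
  shows "in_hom C (econe xs zs) (Par C (Fo xs)) (Fo zs)"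
proof (cases "zs \<in> TP")
  case True
  then have "zs \<in> bd xs" using assms by (auto simp: bdry_def)
  with True bdry_lim[OF assms(1)] show ?thesis by (auto simp: econe_def limit_cone_def cone_def)
next
  case False
  then show ?thesis
    using to_one_hom[OF Par_Fo_obj[OF assms(1)]] Fo_one[OF assms(2)] bdry_obj_Par[OF assms(1)]
    by (simp add: econe_def)
qed

lemma LE_neq: "LE zs' zs \<Longrightarrow> LE zs xs \<Longrightarrow> zs \<noteq> xs \<Longrightarrow> zs \<in> OB \<Longrightarrow> xs \<in> OB \<Longrightarrow> zs' \<noteq> xs"
  using LE_antisym by blast

lemma hom_to_nonTP: "zs \<in> OB \<Longrightarrow> zs \<notin> TP \<Longrightarrow> in_hom C f a (Fo zs) \<Longrightarrow> in_hom C g a (Fo zs) \<Longrightarrow> f = g"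
  using to_one_unique Fo_one by metis

lemma econe_comp:
  assumes xs: "xs \<in> TP" and zs: "zs \<in> OB" "LE zs xs" "zs \<noteq> xs" and zs': "zs' \<in> OB" "LE zs' zs"
  shows "Comp C (TM zs zs') (econe xs zs) = econe xs zs'"
proof (cases "zs' \<in> TP")
  case True
  have zsTP: "zs \<in> TP" by (rule LE_TP[OF True zs(1) zs'(2)])
  have "zs \<in> bd xs" "zs' \<in> bd xs"
    using zs zsTP True LE_trans[OF zs'(2) zs(2)] LE_neq[OF zs'(2) zs(2,3,1) TP_OB[OF xs]] by (auto simp: bdry_def)
  then show ?thesis
    using bdry_lim[OF xs] zsTP True zs'(2) by (auto simp: econe_def limit_cone_def cone_def)
next
  case False
  have "in_hom C (Comp C (TM zs zs') (econe xs zs)) (Par C (Fo xs)) (Fo zs')"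
    using TM_hom[OF zs'(2,1) zs(1)] econe_hom[OF xs zs] by (rule comp_hom)
  moreover have "in_hom C (econe xs zs') (Par C (Fo xs)) (Fo zs')"
    by (rule econe_hom[OF xs zs'(1) LE_trans[OF zs'(2) zs(2)] LE_neq[OF zs'(2) zs(2,3,1) TP_OB[OF xs]]])
  ultimately show ?thesis by (rule hom_to_nonTP[OF zs'(1) False])
qed

lemma econe_Pr:
  assumes "xs \<in> TP" "zs \<in> OB" "LE zs xs" "zs \<noteq> xs"
  shows "Comp C (econe xs zs) (Pr C (Fo xs)) = TM xs zs"
proof (cases "zs \<in> TP")
  case True
  then have "zs \<in> bd xs" using assms by (auto simp: bdry_def)
  with True bdry_cone_Pr[OF assms(1)] show ?thesis by (simp add: econe_def)
next
  case False
  have "in_hom C (Comp C (econe xs zs) (Pr C (Fo xs))) (Fo xs) (Fo zs)"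
    using econe_hom[OF assms] Pr_hom[OF Fo_obj[OF TP_OB[OF assms(1)]] Fo_Len[OF assms(1)]] by (rule comp_hom)
  then show ?thesis using hom_to_nonTP[OF assms(2) False] TM_hom[OF assms(3,2) TP_OB[OF assms(1)]] by blast
qed

section \<open>Faces of a tuple and maps between boundaries\<close>

definition face :: "'o list \<Rightarrow> nat set \<Rightarrow> 'o list" where
  "face xs I = pick (length As) I xs (map2 Par As xs)"

lemma face_cone_econe: "fcone xs I = econe xs (face xs I)"
  by (simp add: face_cone_def econe_def face_def Let_def)

lemma face_length [simp]: "length (face xs I) = length As"
  by (simp add: face_def pick_def)

lemma face_nth: "length xs = length As \<Longrightarrow> i < length As \<Longrightarrow>
    face xs I ! i = (if i \<in> I then Par (As ! i) (xs ! i) else xs ! i)"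
  by (simp add: face_def pick_def)

lemma OB_length: "xs \<in> OB \<Longrightarrow> length xs = length As"
  by (simp add: prod_Obj_iff)

lemma face_OB: "xs \<in> OB \<Longrightarrow> face xs I \<in> OB"
  by (auto simp: prod_Obj_iff face_nth intro: ctx.Par_obj ctx_nth)

lemma face_LE: "xs \<in> OB \<Longrightarrow> LE (face xs I) xs"
  by (auto simp: TP_le_def OB_length OB_nth face_nth intro: ctx.T_le_Par ctx.T_le_refl ctx_nth)

lemma face_antimono: "xs \<in> OB \<Longrightarrow> I \<subseteq> J \<Longrightarrow> LE (face xs J) (face xs I)"
  by (auto simp: TP_le_def OB_length OB_nth face_nth intro!: ctx.T_le_Par ctx.T_le_refl ctx_nth ctx.Par_obj)

lemma Par_neq: "xs \<in> TP \<Longrightarrow> i < length As \<Longrightarrow> Par (As ! i) (xs ! i) \<noteq> xs ! i"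
  using ctx.Len_Par[OF ctx_nth, of i "xs ! i"] by (auto simp: TP_obj_iff prod_Obj_iff)

lemma face_neq: "xs \<in> TP \<Longrightarrow> i \<in> I \<Longrightarrow> i < length As \<Longrightarrow> face xs I \<noteq> xs"
  using Par_neq[of xs i] face_nth[of xs i I] OB_length[OF TP_OB] by auto

text \<open>For \<open>zs\<close> below \<open>xs\<close>, these are the directions of descent. The
  face of \<open>xs\<close> in these directions is still above \<open>zs\<close>
  (\<open>LE_face_dif\<close>), so the boundary cone at \<open>zs\<close> factors through
  it.\<close>

definition dif :: "'o list \<Rightarrow> 'o list \<Rightarrow> nat set" where
  "dif zs xs = {i. i < length As \<and> zs ! i \<noteq> xs ! i}"

lemma dif_nonempty: "zs \<in> OB \<Longrightarrow> xs \<in> OB \<Longrightarrow> zs \<noteq> xs \<Longrightarrow> dif zs xs \<noteq> {}"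
  unfolding dif_def by (auto simp: prod_Obj_iff list_eq_iff_nth_eq)

lemma dif_face: "xs \<in> TP \<Longrightarrow> I \<subseteq> {..<length As} \<Longrightarrow> dif (face xs I) xs = I"
  using Par_neq face_nth[OF OB_length[OF TP_OB]] by (auto simp: dif_def split: if_splits)

lemma LE_face_dif: "xs \<in> OB \<Longrightarrow> LE zs xs \<Longrightarrow> LE zs (face xs (dif zs xs))"
  unfolding TP_le_def by (auto simp: OB_length face_nth dif_def intro: ctx.T_le_ParI ctx_nth)

lemma dif_antimono: "LE zs' zs \<Longrightarrow> LE zs xs \<Longrightarrow> dif zs xs \<subseteq> dif zs' xs"
  using ctx.T_le_antisym[OF ctx_nth] by (force simp: dif_def TP_le_def)

lemma pick_hom:
  assumes "length xs = length As" "length ys = length As"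
    "\<And>i. i < length As \<Longrightarrow> in_hom (As ! i) (fs0 ! i) (xs ! i) (ys ! i)"
    "\<And>i. i < length As \<Longrightarrow> in_hom (As ! i) (fs1 ! i) (Par (As ! i) (xs ! i)) (Par (As ! i) (ys ! i))"
  shows "in_hom (prod_cat As) (pick (length As) I fs0 fs1) (face xs I) (face ys I)"
  using assms by (auto simp: prod_hom_iff face_nth pick_def)

text \<open>Entrywise: at an index of \<open>J\<close> outside \<open>I\<close> this is the
  commutativity of the given square; at the other indices the display maps are identities.\<close>

lemma pick_naturality:
  assumes xy: "xs \<in> TP" "ys \<in> TP"
    and f: "\<And>i. i < length As \<Longrightarrow> in_hom (As ! i) (fs0 ! i) (xs ! i) (ys ! i)"
      "\<And>i. i < length As \<Longrightarrow> in_hom (As ! i) (fs1 ! i) (Par (As ! i) (xs ! i)) (Par (As ! i) (ys ! i))"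
      "\<And>i. i < length As \<Longrightarrow> Comp (As ! i) (Pr (As ! i) (ys ! i)) (fs0 ! i) = Comp (As ! i) (fs1 ! i) (Pr (As ! i) (xs ! i))"
    and IJ: "I \<subseteq> J"
  shows "Comp C (TM (face ys I) (face ys J)) (Fm (pick (length As) I fs0 fs1)) =
    Comp C (Fm (pick (length As) J fs0 fs1)) (TM (face xs I) (face xs J))"
proof -
  have o: "xs \<in> OB" "ys \<in> OB" using xy TP_OB by auto
  have l: "length xs = length As" "length ys = length As" using o OB_length by auto
  have ph: "in_hom (prod_cat As) (pick (length As) I fs0 fs1) (face xs I) (face ys I)" for I
    by (rule pick_hom[OF l f(1,2)])
  note th = tmap_hom[OF face_antimono face_OB face_OB]
  have L: "1 \<le> Len (As ! i) (xs ! i)" "1 \<le> Len (As ! i) (ys ! i)" if "i < length As" for i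
    using xy that by (auto simp: TP_obj_iff)
  have eq: "Comp (As ! i) (T_map (As ! i) (face ys I ! i) (face ys J ! i)) (pick (length As) I fs0 fs1 ! i) =
    Comp (As ! i) (pick (length As) J fs0 fs1 ! i) (T_map (As ! i) (face xs I ! i) (face xs J ! i))"
    if i: "i < length As" for i
  proof -
    interpret A: ctx "As ! i" by (rule ctx_nth[OF i])
    have xi: "xs ! i \<in> Obj (As ! i)" "ys ! i \<in> Obj (As ! i)" using o i OB_nth by auto
    note F = f[OF i]
    show ?thesis
      using IJ xi A.Par_obj[OF xi(1)] A.Par_obj[OF xi(2)] L[OF i] F(3) A.comp_ide[OF F(1)] A.comp_ide[OF F(2)]
        A.ide_comp[OF F(1)] A.ide_comp[OF F(2)] i
      by (auto simp: face_nth l pick_def A.T_map_refl A.T_map_Par)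
  qed
  show ?thesis
    unfolding TP_fun_def Fm_comp[OF th[OF o(2) IJ o(2) o(2)] ph] Fm_comp[OF ph th[OF o(1) IJ o(1) o(1)]]
    using eq by (auto intro!: arg_cong[of _ _ Fm])
qed

text \<open>Every element strictly below \<open>ys\<close> is below a proper face, and its cone
  component factors through that face. The limit over the boundary is therefore detected by the
  faces alone, as in the description of F[bd ys] as a limit over nonempty sets of indices.\<close>

lemma face_cone_ext:
  assumes ys: "ys \<in> TP" and u: "in_hom C u b (Par C (Fo ys))" "in_hom C v b (Par C (Fo ys))"
    and eq: "\<And>I. I \<subseteq> {..<length As} \<Longrightarrow> I \<noteq> {} \<Longrightarrow>
      Comp C (fcone ys I) u = Comp C (fcone ys I) v"
  shows "u = v"
proof (rule bdry_ext[OF ys u])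
  fix z assume z: "z \<in> bd ys"
  then have z': "z \<in> TP" "LE z ys" "z \<noteq> ys" "z \<in> OB" using TP_OB by (auto simp: bdry_def)
  define I where "I = dif z ys"
  have o: "ys \<in> OB" by (rule TP_OB[OF ys])
  have I: "I \<subseteq> {..<length As}" "I \<noteq> {}" using dif_nonempty[OF z'(4) o z'(3)] by (auto simp: I_def dif_def)
  then obtain i where i: "i \<in> I" "i < length As" by auto
  note fc = face_OB[OF o, of I] face_LE[OF o, of I] face_neq[OF ys i]
  have zI: "LE z (face ys I)" unfolding I_def by (rule LE_face_dif[OF o z'(2)])
  have "bcone ys z = Comp C (TM (face ys I) z) (fcone ys I)"
    using econe_comp[OF ys fc z'(4) zI] z'(1) by (simp add: face_cone_econe) (simp add: econe_def)
  moreover have "Comp C (Comp C (TM (face ys I) z) (fcone ys I)) w =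
      Comp C (TM (face ys I) z) (Comp C (fcone ys I) w)" if "in_hom C w b (Par C (Fo ys))" for w
    using comp_assoc[OF TM_hom[OF zI z'(4) fc(1)] econe_hom[OF ys fc] that] by (simp add: face_cone_econe)
  ultimately show "Comp C (bcone ys z) u = Comp C (bcone ys z) v"
    using eq[OF I] u by simp
qed

text \<open>The definition of \<open>bdry_map\<close> is a definite description, so existence must
  be supplied. Equations on faces are extended to a cone over the whole boundary, whose mediating
  map is the one described; uniqueness is \<open>face_cone_ext\<close>.\<close>

lemma bdry_map_spec:
  assumes xy: "xs \<in> TP" "ys \<in> TP"
    and f: "\<And>i. i < length As \<Longrightarrow> in_hom (As ! i) (fs0 ! i) (xs ! i) (ys ! i)"
      "\<And>i. i < length As \<Longrightarrow> in_hom (As ! i) (fs1 ! i) (Par (As ! i) (xs ! i)) (Par (As ! i) (ys ! i))"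
      "\<And>i. i < length As \<Longrightarrow> Comp (As ! i) (Pr (As ! i) (ys ! i)) (fs0 ! i) = Comp (As ! i) (fs1 ! i) (Pr (As ! i) (xs ! i))"
  shows bdry_map_hom: "in_hom C (bmap xs ys fs0 fs1) (Par C (Fo xs)) (Par C (Fo ys))"
    and bdry_map_comp: "I \<subseteq> {..<length As} \<Longrightarrow> I \<noteq> {} \<Longrightarrow>
      Comp C (fcone ys I) (bmap xs ys fs0 fs1) =
      Comp C (Fm (pick (length As) I fs0 fs1)) (fcone xs I)"
proof -
  let ?p = "\<lambda>I. Fm (pick (length As) I fs0 fs1)"
  have o: "xs \<in> OB" "ys \<in> OB" using xy TP_OB by auto
  have l: "length xs = length As" "length ys = length As" using o OB_length by auto
  have ph: "in_hom C (?p I) (Fo (face xs I)) (Fo (face ys I))" for I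
    by (rule Fm_hom[OF pick_hom[OF l f(1,2)]])
  have fx: "face xs I \<in> OB" "LE (face xs I) xs" "face xs I \<noteq> xs"
    and fy: "face ys I \<in> OB" "LE (face ys I) ys" "face ys I \<noteq> ys"
    if I: "I \<subseteq> {..<length As}" "I \<noteq> {}" for I
    using I face_OB o face_LE face_neq xy by (blast | metis ex_in_conv lessThan_iff subsetD)+
  \<comment> \<open>The component at \<open>z\<close> goes through the face in the directions of
    descent: project, apply the given maps, restrict to \<open>z\<close>.\<close>
  define d where "d z = Comp C (TM (face ys (dif z ys)) z) (Comp C (?p (dif z ys)) (econe xs (face xs (dif z ys))))" for z
  have zz: "z \<in> TP" "z \<in> OB" "LE z ys" "z \<noteq> ys" "dif z ys \<subseteq> {..<length As}" "dif z ys \<noteq> {}" "LE z (face ys (dif z ys))"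
    if "z \<in> bd ys" for z
    using that TP_OB[of z] dif_nonempty[of z ys] o LE_face_dif[OF o(2), of z] by (auto simp: bdry_def dif_def)
  have ec: "in_hom C (Comp C (?p I) (econe xs (face xs I))) (Par C (Fo xs)) (Fo (face ys I))"
    if I: "I \<subseteq> {..<length As}" "I \<noteq> {}" for I
    by (rule comp_hom[OF ph econe_hom[OF xy(1) fx[OF I]]])
  have "cone C (bd ys) LE Fo TM (Par C (Fo xs)) d"
    unfolding cone_def
  proof (intro conjI ballI impI)
    show "Par C (Fo xs) \<in> Obj C" by (rule Par_Fo_obj[OF xy(1)])
    show "in_hom C (d z) (Par C (Fo xs)) (Fo z)" if "z \<in> bd ys" for z
      unfolding d_def using zz[OF that] by (intro comp_hom[OF TM_hom ec] face_OB o)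
    fix z w assume z: "z \<in> bd ys" and w: "w \<in> bd ys" and zw: "LE z w"
    note Z = zz[OF z] and W = zz[OF w]
    let ?I = "dif z ys" and ?J = "dif w ys"
    have JI: "?J \<subseteq> ?I" by (rule dif_antimono[OF zw W(3)])
    note fJ = fy(1)[OF W(5,6)] and fI = fy(1)[OF Z(5,6)]
    note IJ = face_antimono[OF o(2) JI]
    have "Comp C (TM w z) (d w) = Comp C (Comp C (TM w z) (TM (face ys ?J) w)) (Comp C (?p ?J) (econe xs (face xs ?J)))"
      unfolding d_def
      by (rule comp_assoc[OF TM_hom[OF zw Z(2) W(2)] TM_hom[OF W(7,2) fJ] ec[OF W(5,6)], symmetric])
    also have "Comp C (TM w z) (TM (face ys ?J) w) = Comp C (TM (face ys ?I) z) (TM (face ys ?J) (face ys ?I))"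
      using TM_comp[OF zw W(7) Z(2) W(2) fJ] TM_comp[OF Z(7) IJ Z(2) fI fJ] by simp
    also have "Comp C \<dots> (Comp C (?p ?J) (econe xs (face xs ?J))) =
        Comp C (TM (face ys ?I) z) (Comp C (TM (face ys ?J) (face ys ?I)) (Comp C (?p ?J) (econe xs (face xs ?J))))"
      by (rule comp_assoc[OF TM_hom[OF Z(7,2) fI] TM_hom[OF IJ fI fJ] ec[OF W(5,6)]])
    also have "Comp C (TM (face ys ?J) (face ys ?I)) (Comp C (?p ?J) (econe xs (face xs ?J))) =
        Comp C (Comp C (TM (face ys ?J) (face ys ?I)) (?p ?J)) (econe xs (face xs ?J))"
      by (rule comp_assoc[OF TM_hom[OF IJ fI fJ] ph econe_hom[OF xy(1) fx[OF W(5,6)]], symmetric])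
    also have "Comp C (TM (face ys ?J) (face ys ?I)) (?p ?J) = Comp C (?p ?I) (TM (face xs ?J) (face xs ?I))"
      by (rule pick_naturality[OF xy f JI])
    also have "Comp C \<dots> (econe xs (face xs ?J)) = Comp C (?p ?I) (Comp C (TM (face xs ?J) (face xs ?I)) (econe xs (face xs ?J)))"
      by (rule comp_assoc[OF ph TM_hom[OF face_antimono[OF o(1) JI] fx(1)[OF Z(5,6)] fx(1)[OF W(5,6)]]
            econe_hom[OF xy(1) fx[OF W(5,6)]]])
    also have "Comp C (TM (face xs ?J) (face xs ?I)) (econe xs (face xs ?J)) = econe xs (face xs ?I)"
      by (rule econe_comp[OF xy(1) fx[OF W(5,6)] fx(1)[OF Z(5,6)] face_antimono[OF o(1) JI]])
    finally show "Comp C (TM w z) (d w) = d z" unfolding d_def .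
  qed
  with bdry_lim[OF xy(2)] obtain u where u: "in_hom C u (Par C (Fo xs)) (Par C (Fo ys))"
    "\<And>z. z \<in> bd ys \<Longrightarrow> Comp C (bcone ys z) u = d z"
    unfolding limit_cone_def by blast
  have uI: "Comp C (fcone ys I) u = Comp C (?p I) (fcone xs I)"
    if I: "I \<subseteq> {..<length As}" "I \<noteq> {}" for I
  proof (cases "face ys I \<in> TP")
    case True
    then have "face ys I \<in> bd ys" using fy[OF I] by (auto simp: bdry_def)
    moreover have "dif (face ys I) ys = I" by (rule dif_face[OF xy(2) I(1)])
    ultimately show ?thesis
      using u(2)[of "face ys I"] True TM_ide[OF fy(1)[OF I]] ide_comp[OF ec[OF I]]
      by (simp add: face_cone_econe d_def) (simp add: econe_def)
  next
    case False
    \<comment> \<open>An entry of the face has length 0, so both sides are maps into the terminal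
      object.\<close>
    show ?thesis unfolding face_cone_econe
      by (rule hom_to_nonTP[OF fy(1)[OF I] False comp_hom[OF econe_hom[OF xy(2) fy[OF I]] u(1)] ec[OF I]])
  qed
  have "bmap xs ys fs0 fs1 = u"
    unfolding bdry_map_def bdry_obj_Par[OF xy(1)] bdry_obj_Par[OF xy(2)]
  proof (rule the_equality)
    show "in_hom C u (Par C (Fo xs)) (Par C (Fo ys)) \<and>
      (\<forall>I. I \<subseteq> {..<length As} \<longrightarrow> I \<noteq> {} \<longrightarrow> Comp C (fcone ys I) u =
        Comp C (?p I) (fcone xs I))" using u(1) uI by blast
    show "v = u" if "in_hom C v (Par C (Fo xs)) (Par C (Fo ys)) \<and>
      (\<forall>I. I \<subseteq> {..<length As} \<longrightarrow> I \<noteq> {} \<longrightarrow> Comp C (fcone ys I) v =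
        Comp C (?p I) (fcone xs I))" for v
      using that uI by - (rule face_cone_ext[OF xy(2) _ u(1)], auto)
  qed
  with u(1) uI show "in_hom C (bmap xs ys fs0 fs1) (Par C (Fo xs)) (Par C (Fo ys))"
    "I \<subseteq> {..<length As} \<Longrightarrow> I \<noteq> {} \<Longrightarrow>
      Comp C (fcone ys I) (bmap xs ys fs0 fs1) =
      Comp C (?p I) (fcone xs I)" by auto
qed

lemma bdry_map_eqI:
  assumes xy: "xs \<in> TP" "ys \<in> TP" and u: "in_hom C u (Par C (Fo xs)) (Par C (Fo ys))"
    and uI: "\<And>I. I \<subseteq> {..<length As} \<Longrightarrow> I \<noteq> {} \<Longrightarrow> Comp C (fcone ys I) u =
        Comp C (Fm (pick (length As) I fs0 fs1)) (fcone xs I)"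
  shows "bmap xs ys fs0 fs1 = u"
  unfolding bdry_map_def bdry_obj_Par[OF xy(1)] bdry_obj_Par[OF xy(2)]
proof (rule the_equality)
  show "v = u" if "in_hom C v (Par C (Fo xs)) (Par C (Fo ys)) \<and>
      (\<forall>I. I \<subseteq> {..<length As} \<longrightarrow> I \<noteq> {} \<longrightarrow> Comp C (fcone ys I) v =
        Comp C (Fm (pick (length As) I fs0 fs1)) (fcone xs I))" for v
    using that uI by - (rule face_cone_ext[OF xy(2) _ u], auto)
qed (use u uI in auto)

end

section \<open>Initial segments below a tuple\<close>

context cellfun
begin

text \<open>One choice on \<open>dn xs\<close> is fixed so that the limits over initial segments
  become functions. By \<open>choice_unique\<close> their values do not depend on it.\<close>

definition chosen :: "'o list \<Rightarrow> ('o list set \<Rightarrow> 'o) \<times> ('o list set \<Rightarrow> 'o list \<Rightarrow> 'm)" where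
  "chosen xs = (SOME p. choice (dn xs) (fst p) (snd p))"

definition seg :: "'o list \<Rightarrow> 'o list \<Rightarrow> 'o list set" where
  "seg xs u = {v \<in> dn xs. LX v u}"

definition seg_obj :: "'o list \<Rightarrow> 'o list \<Rightarrow> 'o" where
  "seg_obj xs u = fst (chosen xs) (seg xs u)"

definition seg_proj :: "'o list \<Rightarrow> 'o list \<Rightarrow> 'm" where
  "seg_proj xs u = snd (chosen xs) (seg xs u) u"

text \<open>The bottom of the canonical square over \<open>Pr C (Fo u)\<close> whose top is
  \<open>seg_proj xs u\<close>; see \<open>seg_proj_square\<close>.\<close>

definition seg_base :: "'o list \<Rightarrow> 'o list \<Rightarrow> 'm" where
  "seg_base xs u = restr (fst (chosen xs)) (snd (chosen xs)) (seg xs u - {u}) (bd u)"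

context
  fixes xs assumes xs: "xs \<in> TP"
begin

lemma chosen: "choice (dn xs) (fst (chosen xs)) (snd (chosen xs))"
proof -
  obtain a c where "choice (dn xs) a c" using choice_ex[OF bsieve_down[OF xs]] by blast
  then have "\<exists>p. choice (dn xs) (fst p) (snd p)" by auto
  then show ?thesis unfolding chosen_def by (rule someI_ex)
qed

lemma dn_bsieve: "bsieve (dn xs)"
  by (rule bsieve_down[OF xs])

lemma xs_dn: "xs \<in> dn xs"
  by (rule down_self[OF xs])

lemma dn_TP: "u \<in> dn xs \<Longrightarrow> u \<in> TP"
  by (simp add: down_def)

lemma seg_sub: "seg xs u \<subseteq> dn xs"
  by (auto simp: seg_def)

lemma seg_bsieve: "u \<in> dn xs \<Longrightarrow> bsieve (seg xs u)"
proof (rule bsieve_subI[OF dn_bsieve _ seg_sub])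
  assume u: "u \<in> dn xs"
  show "sieve TP LE (seg xs u)"
    unfolding sieve_def
  proof (intro conjI ballI impI)
    show "seg xs u \<subseteq> TP" using seg_sub dn_TP by blast
    fix v w assume v: "v \<in> seg xs u" and w: "w \<in> TP" "LE w v"
    then have v': "v \<in> dn xs" "LX v u" by (auto simp: seg_def)
    have w': "w \<in> dn xs" by (rule bsieve_closed[OF dn_bsieve v'(1) w])
    have "LX w v" by (rule bsieve_le_lin[OF dn_bsieve w' v'(1) w(2)])
    then show "w \<in> seg xs u"
      using bsieve_lin_trans[OF dn_bsieve w' v'(1) u _ v'(2)] w' by (simp add: seg_def)
  qed
qed

lemma seg_self: "u \<in> dn xs \<Longrightarrow> u \<in> seg xs u"
  using bsieve_lin_refl[OF dn_bsieve] by (simp add: seg_def)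

lemma seg_max: "v \<in> seg xs u \<Longrightarrow> LX v u"
  by (simp add: seg_def)

lemma seg_xs: "seg xs xs = dn xs"
  using bsieve_le_lin[OF dn_bsieve _ xs_dn] by (auto simp: seg_def down_def)

lemma seg_mono: "u \<in> dn xs \<Longrightarrow> v \<in> dn xs \<Longrightarrow> LX v u \<Longrightarrow> seg xs v \<subseteq> seg xs u"
  using bsieve_lin_trans[OF dn_bsieve] unfolding seg_def by blast

lemma seg_initial: "u \<in> dn xs \<Longrightarrow> v \<in> dn xs \<Longrightarrow> x \<in> seg xs v \<Longrightarrow> y \<in> seg xs u - seg xs v \<Longrightarrow> LX x y"
  using bsieve_lin_total[OF dn_bsieve, of y v] bsieve_lin_trans[OF dn_bsieve, of x v y]
  unfolding seg_def by blast

lemma seg_obj_obj: "u \<in> dn xs \<Longrightarrow> seg_obj xs u \<in> Obj C"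
  unfolding seg_obj_def by (rule choice_obj[OF chosen dn_bsieve seg_bsieve seg_sub])

lemma seg_obj_Len_card: "u \<in> dn xs \<Longrightarrow> Len C (seg_obj xs u) = card (seg xs u)"
  unfolding seg_obj_def by (rule choice_Len[OF chosen dn_bsieve seg_bsieve seg_sub])

lemma seg_obj_Len: "u \<in> dn xs \<Longrightarrow> 1 \<le> Len C (seg_obj xs u)"
  unfolding seg_obj_def by (rule choice_display(2)[OF chosen dn_bsieve seg_bsieve seg_sub seg_self seg_max])

lemma seg_obj_Par: "u \<in> dn xs \<Longrightarrow> Par C (seg_obj xs u) = fst (chosen xs) (seg xs u - {u})"
  unfolding seg_obj_def by (rule choice_display(3)[OF chosen dn_bsieve seg_bsieve seg_sub seg_self seg_max])

lemma seg_proj_hom: "u \<in> dn xs \<Longrightarrow> in_hom C (seg_proj xs u) (seg_obj xs u) (Fo u)"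
  unfolding seg_obj_def seg_proj_def by (rule choice_hom[OF chosen dn_bsieve seg_bsieve seg_sub seg_self])

lemma seg_obj_self: "seg_obj xs xs = Fo xs"
  unfolding seg_obj_def seg_xs by (rule choice_down(1)[OF chosen dn_bsieve xs_dn])

lemma seg_proj_self: "seg_proj xs xs = Ide C (Fo xs)"
  unfolding seg_proj_def seg_xs using choice_down(2)[OF chosen dn_bsieve xs_dn xs_dn] Dm_ide[OF xs] by simp

lemma seg_obj_LX:
  assumes "u \<in> dn xs" "v \<in> dn xs" "LX v u"
  shows "T_le C (seg_obj xs v) (seg_obj xs u)"
    and "restr (fst (chosen xs)) (snd (chosen xs)) (seg xs u) (seg xs v) = T_map C (seg_obj xs u) (seg_obj xs v)"
  using choice_initial_T_map[OF chosen dn_bsieve seg_bsieve[OF assms(2)] seg_bsieve[OF assms(1)]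
      seg_mono[OF assms] seg_sub seg_initial[OF assms(1,2)]]
  unfolding seg_obj_def by blast+

lemma seg_obj_le: "u \<in> dn xs \<Longrightarrow> T_le C (seg_obj xs u) (Fo xs)"
  using seg_obj_LX(1)[OF xs_dn, of u] bsieve_le_lin[OF dn_bsieve _ xs_dn] seg_obj_self by (auto simp: down_def)

text \<open>The length of the limit counts the elements of the segment, and two segments are nested;
  equal size makes them equal, hence also their largest elements.\<close>

lemma seg_obj_inj: "u \<in> dn xs \<Longrightarrow> v \<in> dn xs \<Longrightarrow> Len C (seg_obj xs u) = Len C (seg_obj xs v) \<Longrightarrow> u = v"
proof -
  have *: "u = v" if uv: "u \<in> dn xs" "v \<in> dn xs" "Len C (seg_obj xs u) = Len C (seg_obj xs v)" "LX u v" for u v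
  proof -
    have "seg xs u = seg xs v"
      using seg_mono[OF uv(2,1,4)] bsieve_finite[OF seg_bsieve[OF uv(2)]] seg_obj_Len_card uv by (metis card_subset_eq)
    then have "LX v u" using seg_self[OF uv(2)] seg_max by auto
    then show ?thesis using bsieve_lin_antisym[OF dn_bsieve] uv by blast
  qed
  then show "u \<in> dn xs \<Longrightarrow> v \<in> dn xs \<Longrightarrow> Len C (seg_obj xs u) = Len C (seg_obj xs v) \<Longrightarrow> u = v"
    using bsieve_lin_total[OF dn_bsieve, of u v] *[of u v] *[of v u] by metis
qed

lemma seg_obj_LX_iff:
  assumes "u \<in> dn xs" "v \<in> dn xs"
  shows "T_le C (seg_obj xs v) (seg_obj xs u) \<longleftrightarrow> LX v u"
proof
  assume T: "T_le C (seg_obj xs v) (seg_obj xs u)"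
  show "LX v u"
  proof (rule ccontr)
    assume n: "\<not> LX v u"
    then have "LX u v" using bsieve_lin_total[OF dn_bsieve assms] by blast
    then have "Len C (seg_obj xs u) = Len C (seg_obj xs v)"
      using T_le_Len[OF T] T_le_Len[OF seg_obj_LX(1)[OF assms(2,1)]] by simp
    then show False using seg_obj_inj[OF assms] n bsieve_lin_refl[OF dn_bsieve assms(1)] by simp
  qed
qed (rule seg_obj_LX(1)[OF assms])

text \<open>Counting: the lengths of the segment limits are pairwise distinct and lie between 1 and
  the size of \<open>dn xs\<close>, so every value occurs, and below \<open>Fo xs\<close> the length
  determines the object.\<close>

lemma seg_obj_surj:
  assumes "T_le C b (Fo xs)" "1 \<le> Len C b"
  shows "\<exists>u\<in>dn xs. seg_obj xs u = b"
proof -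
  let ?L = "\<lambda>u. Len C (seg_obj xs u)"
  have fin: "finite (dn xs)" by (rule bsieve_finite[OF dn_bsieve])
  have L: "Len C (Fo xs) = card (dn xs)" using seg_obj_Len_card[OF xs_dn] seg_obj_self seg_xs by simp
  have "inj_on ?L (dn xs)" using seg_obj_inj by (auto simp: inj_on_def)
  then have "card (?L ` dn xs) = card {1..card (dn xs)}" by (simp add: card_image)
  moreover have "?L ` dn xs \<subseteq> {1..card (dn xs)}"
    using seg_obj_Len T_le_Len[OF seg_obj_le] L by auto
  ultimately have "?L ` dn xs = {1..card (dn xs)}" by (intro card_subset_eq) auto
  moreover have "Len C b \<in> {1..card (dn xs)}" using assms T_le_Len[OF assms(1)] L by auto
  ultimately have "Len C b \<in> ?L ` dn xs" by blast
  then obtain u where u: "u \<in> dn xs" "?L u = Len C b" by auto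
  then show ?thesis using T_le_Len_eq[OF seg_obj_le assms(1)] by auto
qed

text \<open>Both sides are the component at \<open>v\<close> of the limit cone over
  \<open>seg xs u\<close>.\<close>

lemma seg_proj_naturality:
  assumes "u \<in> dn xs" "v \<in> TP" "LE v u"
  shows "Comp C (seg_proj xs v) (T_map C (seg_obj xs u) (seg_obj xs v)) = Comp C (TM u v) (seg_proj xs u)"
proof -
  have v: "v \<in> dn xs" by (rule bsieve_closed[OF dn_bsieve assms])
  have lx: "LX v u" by (rule bsieve_le_lin[OF dn_bsieve v assms(1,3)])
  have "Comp C (seg_proj xs v) (T_map C (seg_obj xs u) (seg_obj xs v)) = snd (chosen xs) (seg xs u) v"
    unfolding seg_proj_def seg_obj_LX(2)[OF assms(1) v lx, symmetric]
    by (rule choice_restr_comp[OF chosen dn_bsieve seg_bsieve[OF v] seg_bsieve[OF assms(1)] seg_mono[OF assms(1) v lx] seg_sub seg_self[OF v]])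
  also have "\<dots> = Comp C (TM u v) (seg_proj xs u)"
    unfolding seg_proj_def
    by (rule choice_comp[OF chosen dn_bsieve seg_bsieve seg_sub seg_self assms(2,3), OF assms(1,1), symmetric])
  finally show ?thesis .
qed

text \<open>This is \<open>choice_square\<close> for the segment, whose restriction to
  \<open>dn u\<close> is the projection to \<open>u\<close> because the cone of \<open>dn u\<close>
  at \<open>u\<close> is an identity. It makes F[seg] -> F(u) the top of an element of
  \<open>SqQ C\<close>, to which a condition on squares can be applied.\<close>

lemma seg_proj_square:
  assumes u: "u \<in> dn xs"
  shows "Square (seg_proj xs u) (Pr C (seg_obj xs u)) (Pr C (Fo u)) (seg_base xs u) \<in> SqQ C"
proof -
  have uTP: "u \<in> TP" by (rule dn_TP[OF u])
  have sub: "dn u \<subseteq> seg xs u" by (rule down_sub[OF seg_bsieve[OF u] seg_self[OF u]])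
  have uu: "u \<in> dn u" by (rule down_self[OF uTP])
  note ch = chosen dn_bsieve
  have h: "in_hom C (restr (fst (chosen xs)) (snd (chosen xs)) (seg xs u) (dn u)) (seg_obj xs u) (Fo u)"
    using choice_restr_hom[OF ch bsieve_down[OF uTP] seg_bsieve[OF u] sub seg_sub] choice_down(1)[OF ch u]
    by (simp add: seg_obj_def)
  have "restr (fst (chosen xs)) (snd (chosen xs)) (seg xs u) (dn u) = seg_proj xs u"
    using choice_restr_comp[OF ch bsieve_down[OF uTP] seg_bsieve[OF u] sub seg_sub uu]
      choice_down(2)[OF ch u uu] Dm_ide[OF uTP] ide_comp[OF h] by (simp add: seg_proj_def)
  then show ?thesis
    using choice_square[OF ch seg_bsieve[OF u] seg_sub seg_self[OF u] seg_max] by (simp add: seg_obj_def seg_base_def)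
qed

lemma cone_seg_Diff:
  assumes u: "u \<in> dn xs" and v: "v \<in> bd u"
  shows "T_le C (seg_obj xs v) (Par C (seg_obj xs u))"
    and "snd (chosen xs) (seg xs u - {u}) v = Comp C (seg_proj xs v) (T_map C (Par C (seg_obj xs u)) (seg_obj xs v))"
proof -
  have v': "v \<in> TP" "LE v u" "v \<noteq> u" using v by (auto simp: bdry_def)
  have vd: "v \<in> dn xs" by (rule bsieve_closed[OF dn_bsieve u v'(1,2)])
  have lx: "LX v u" by (rule bsieve_le_lin[OF dn_bsieve vd u v'(2)])
  have "u \<notin> seg xs v" using bsieve_lin_antisym[OF dn_bsieve vd u lx] v'(3) by (auto simp: seg_def)
  then have sub: "seg xs v \<subseteq> seg xs u - {u}" using seg_mono[OF u vd lx] by auto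
  have b: "bsieve (seg xs u - {u})" by (rule bsieve_Diff_max[OF seg_bsieve[OF u] seg_self[OF u] seg_max])
  have sub': "seg xs u - {u} \<subseteq> dn xs" using seg_sub by blast
  have "T_le C (fst (chosen xs) (seg xs v)) (fst (chosen xs) (seg xs u - {u})) \<and>
    restr (fst (chosen xs)) (snd (chosen xs)) (seg xs u - {u}) (seg xs v) =
    T_map C (fst (chosen xs) (seg xs u - {u})) (fst (chosen xs) (seg xs v))"
    by (rule choice_initial_T_map[OF chosen dn_bsieve seg_bsieve[OF vd] b sub sub'])
      (auto intro: seg_initial[OF u vd])
  then have T: "T_le C (seg_obj xs v) (Par C (seg_obj xs u))"
    "restr (fst (chosen xs)) (snd (chosen xs)) (seg xs u - {u}) (seg xs v) = T_map C (Par C (seg_obj xs u)) (seg_obj xs v)"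
    unfolding seg_obj_Par[OF u] by (auto simp: seg_obj_def)
  show "T_le C (seg_obj xs v) (Par C (seg_obj xs u))" by (rule T(1))
  show "snd (chosen xs) (seg xs u - {u}) v = Comp C (seg_proj xs v) (T_map C (Par C (seg_obj xs u)) (seg_obj xs v))"
    unfolding seg_proj_def T(2)[symmetric]
    by (rule choice_restr_comp[OF chosen dn_bsieve seg_bsieve[OF vd] b sub sub' seg_self[OF vd], symmetric])
qed

text \<open>Both sides are the component at \<open>v\<close> of the limit cone over
  \<open>seg xs u - {u}\<close>, once factored through \<open>bd u\<close> and once through the
  segment of \<open>v\<close>.\<close>

lemma seg_base_comp:
  assumes u: "u \<in> dn xs" and v: "v \<in> bd u"
  shows "Comp C (bcone u v) (seg_base xs u) = Comp C (seg_proj xs v) (T_map C (Par C (seg_obj xs u)) (seg_obj xs v))"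
proof -
  have uTP: "u \<in> TP" by (rule dn_TP[OF u])
  have b: "bsieve (seg xs u - {u})" by (rule bsieve_Diff_max[OF seg_bsieve[OF u] seg_self[OF u] seg_max])
  have sub: "bd u \<subseteq> seg xs u - {u}" "seg xs u - {u} \<subseteq> dn xs"
    using bdry_sub_Diff[OF seg_bsieve[OF u] seg_self[OF u]] seg_sub by auto
  have "bcone u v = snd (chosen xs) (bd u) v"
    using bdry_choice(2)[OF uTP chosen dn_bsieve _ v] sub by blast
  then show ?thesis
    unfolding cone_seg_Diff(2)[OF assms, symmetric] seg_base_def
    using choice_restr_comp[OF chosen dn_bsieve bsieve_bdry[OF uTP] b sub v] by simp
qed

lemma bdry_cone_pj:
  assumes v: "v \<in> bd xs"
  shows "bcone xs v = Comp C (seg_proj xs v) (T_map C (Par C (Fo xs)) (seg_obj xs v))"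
    and "T_le C (seg_obj xs v) (Par C (Fo xs))"
  using cone_seg_Diff[OF xs_dn v] bdry_choice(2)[OF xs chosen dn_bsieve _ v] bdry_down[OF xs]
  by (auto simp: seg_obj_self seg_xs)

end

end

text \<open>The multimorphism condition on squares, with the boundary projections replaced by
  \<open>Pr\<close> and distinguishedness by membership in \<open>SqQ C\<close>. It is equivalent to
  \<open>multimorphism\<close> for contextual categories.\<close>

locale multi = cellfun +
  assumes sq: "\<And>xs ys fs0 fs1. xs \<in> TP \<Longrightarrow> ys \<in> TP \<Longrightarrow> length fs0 = length As \<Longrightarrow> length fs1 = length As \<Longrightarrow>
    (\<And>i. i < length As \<Longrightarrow> Square (fs0 ! i) (Pr (As ! i) (xs ! i)) (Pr (As ! i) (ys ! i)) (fs1 ! i) \<in> SqQ (As ! i)) \<Longrightarrow>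
    Square (Fm fs0) (Pr C (Fo xs)) (Pr C (Fo ys)) (bmap xs ys fs0 fs1) \<in> SqQ C"

section \<open>Equivalence with the definition of multimorphism\<close>

lemma (in prodfun) cellular_good:
  assumes c: "cellular C TP LE LX Fo TM" and xs: "xs \<in> TP"
  shows "good xs"
  unfolding good_def
proof (intro allI impI)
  fix a c assume ac: "choice (bd xs) a c"
  from c xs obtain a' c' where ac': "choice (dn xs) a' c'" unfolding cellular_def by blast
  have b: "bsieve (dn xs)" "bsieve (bd xs)" "bd xs \<subseteq> dn xs" "xs \<in> dn xs"
    using bsieve_bdry bsieve_down xs bdry_down down_self by auto
  have eq: "a' (bd xs) = a (bd xs)" "\<And>z. z \<in> bd xs \<Longrightarrow> c' (bd xs) z = c (bd xs) z"
    using choice_unique[OF ac' ac b(1,2,2,3)] by auto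
  note d = choice_display_down[OF ac' b(1,4)]
  show "\<exists>u. display_map_len1 C u \<and> in_hom C u (Fo xs) (a (bd xs)) \<and>
        (\<forall>z\<in>bd xs. Comp C (c (bd xs) z) u = TM xs z)"
  proof (intro exI conjI ballI)
    show "display_map_len1 C (Pr C (Fo xs))" using Do_obj[OF xs] d(2) by (auto simp: display_len1_iff)
    show "in_hom C (Pr C (Fo xs)) (Fo xs) (a (bd xs))" using Pr_hom[OF Do_obj[OF xs] d(2)] d(3) eq(1) by simp
    fix z assume z: "z \<in> bd xs"
    show "Comp C (c (bd xs) z) (Pr C (Fo xs)) = TM xs z"
      using choice_restr_comp[OF ac' b(1,2,1,3) _ z] d(1) eq(2)[OF z] choice_down(2)[OF ac' b(1,4)] z b(3) by auto
  qed
qed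

lemma multimorphism_imp_multi:
  assumes C: "contextual C" and As: "\<And>A. A \<in> set As \<Longrightarrow> contextual A" and m: "multimorphism As C Fo Fm"
  shows "multi C As Fo Fm"
proof -
  interpret prodfun C As Fo Fm
    by unfold_locales (use C As m in \<open>auto simp: multimorphism_def\<close>)
  interpret cellfun C As Fo Fm
  proof unfold_locales
    show "Fo xs = ctx_one C" if "xs \<in> OB" "i < length As" "Len (As ! i) (xs ! i) = 0" for xs i
      using m that unfolding multimorphism_def by blast
    show "good xs" if "xs \<in> TP" for xs
      using m that unfolding multimorphism_def by (intro cellular_good) auto
  qed
  show ?thesis
  proof unfold_locales
    fix xs ys fs0 fs1 assume xy: "xs \<in> TP" "ys \<in> TP" and l: "length fs0 = length As" "length fs1 = length As"
      and q: "\<And>i. i < length As \<Longrightarrow> Square (fs0 ! i) (Pr (As ! i) (xs ! i)) (Pr (As ! i) (ys ! i)) (fs1 ! i) \<in> SqQ (As ! i)"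
    define ss where "ss = map (\<lambda>i. Square (fs0 ! i) (Pr (As ! i) (xs ! i)) (Pr (As ! i) (ys ! i)) (fs1 ! i)) [0..<length As]"
    have h: "in_hom (As ! i) (fs0 ! i) (xs ! i) (ys ! i)" if i: "i < length As" for i
    proof -
      interpret A: ctx "As ! i" by (rule ctx_nth[OF i])
      show ?thesis by (rule A.SqQ_Pr_hom(1)[OF q[OF i]]) (use xy i in \<open>auto simp: TP_obj_iff OB_nth\<close>)
    qed
    have lxy: "length xs = length As" "length ys = length As" using xy TP_OB OB_length by auto
    have *: "map sq_top ss = fs0" "map sq_bot ss = fs1" "map2 Dom As fs0 = xs" "map2 Cod As fs0 = ys"
      using h l lxy by (auto simp: ss_def in_hom_def intro!: nth_equalityI)
    have "length ss = length As" "\<forall>i<length As. ss ! i \<in> SqQ (As ! i)" using q by (auto simp: ss_def)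
    with m have "distinguished C (Square (Fm fs0) (bproj xs) (bproj ys)
              (bmap xs ys fs0 fs1))"
      unfolding multimorphism_def Let_def using * by blast
    then show "Square (Fm fs0) (Pr C (Fo xs)) (Pr C (Fo ys)) (bmap xs ys fs0 fs1) \<in> SqQ C"
      unfolding bdry_proj_Pr[OF xy(1)] bdry_proj_Pr[OF xy(2)]
      by (rule distinguished_SqQ) (use xy Fo_obj TP_OB Fo_Len in auto)
  qed
qed

lemma (in multi) multimorphism: "multimorphism As C Fo Fm"
  unfolding multimorphism_def
proof (intro conjI allI impI ballI)
  show "is_functor (prod_cat As) C Fo Fm" by (rule is_fun)
  show "Fo xs = ctx_one C" if "xs \<in> OB" "\<exists>i<length As. Len (As ! i) (xs ! i) = 0" for xs
    using zero that by blast
  show "cellular C TP LE LX Fo TM" by (rule cellularI[OF good])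
  fix ss assume ss: "length ss = length As" "\<forall>i<length As. ss ! i \<in> SqQ (As ! i)"
  define xs where "xs = map2 Dom As (map sq_top ss)"
  define ys where "ys = map2 Cod As (map sq_top ss)"
  have *: "xs ! i \<in> Obj (As ! i) \<and> ys ! i \<in> Obj (As ! i) \<and> 1 \<le> Len (As ! i) (xs ! i) \<and> 1 \<le> Len (As ! i) (ys ! i) \<and>
    Square (map sq_top ss ! i) (Pr (As ! i) (xs ! i)) (Pr (As ! i) (ys ! i)) (map sq_bot ss ! i) \<in> SqQ (As ! i)"
    if i: "i < length As" for i
  proof -
    interpret A: ctx "As ! i" by (rule ctx_nth[OF i])
    obtain t l r b where s: "ss ! i = Square t l r b" by (cases "ss ! i")
    have q: "Square t l r b \<in> SqQ (As ! i)" using ss(2) i s by auto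
    from q obtain a e where "l = Pr (As ! i) a" "r = Pr (As ! i) e" "a \<in> Obj (As ! i)" "e \<in> Obj (As ! i)"
      "1 \<le> Len (As ! i) a" "1 \<le> Len (As ! i) e" "in_hom (As ! i) t a e"
      by (rule A.SqQ_cases)
    then show ?thesis using q i ss(1) s by (auto simp: xs_def ys_def in_hom_def)
  qed
  have xy: "xs \<in> TP" "ys \<in> TP" using * ss(1) by (auto simp: TP_obj_iff prod_Obj_iff xs_def ys_def)
  have "Square (Fm (map sq_top ss)) (Pr C (Fo xs)) (Pr C (Fo ys)) (bmap xs ys (map sq_top ss) (map sq_bot ss)) \<in> SqQ C"
    by (rule sq[OF xy]) (use * ss(1) in auto)
  then show "let fs0 = map sq_top ss; fs1 = map sq_bot ss; xs = map2 Dom As fs0; ys = map2 Cod As fs0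
         in distinguished C (Square (Fm fs0) (bproj xs) (bproj ys)
              (bmap xs ys fs0 fs1))"
    unfolding Let_def xs_def[symmetric] ys_def[symmetric] bdry_proj_Pr[OF xy(1)] bdry_proj_Pr[OF xy(2)]
    by (rule SqQ_distinguished)
qed

section \<open>Composition\<close>

definition off :: "'a list list \<Rightarrow> nat \<Rightarrow> nat" where
  "off Ass i = length (concat (take i Ass))"

lemma off_0 [simp]: "off Ass 0 = 0"
  by (simp add: off_def)

lemma off_Cons_Suc [simp]: "off (A # Ass) (Suc i) = length A + off Ass i"
  by (simp add: off_def)

lemma off_Suc: "i < length Ass \<Longrightarrow> off Ass (Suc i) = off Ass i + length (Ass ! i)"
  by (simp add: off_def take_Suc_conv_app_nth)

lemma off_mono: "i < j \<Longrightarrow> j < length Ass \<Longrightarrow> off Ass i + length (Ass ! i) \<le> off Ass j"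
proof (induction j)
  case (Suc j)
  then show ?case by (cases "i = j") (auto simp: off_Suc)
qed simp

lemma length_split_by [simp]: "length (split_by Ass xs) = length Ass"
  by (induction Ass xs rule: split_by.induct) auto

lemma length_split_by_nth:
  "length xs = length (concat Ass) \<Longrightarrow> i < length Ass \<Longrightarrow> length (split_by Ass xs ! i) = length (Ass ! i)"
  by (induction Ass xs arbitrary: i rule: split_by.induct) (auto simp: nth_Cons split: nat.splits)

lemma off_less: "i < length Ass \<Longrightarrow> j < length (Ass ! i) \<Longrightarrow> off Ass i + j < length (concat Ass)"
proof (induction Ass arbitrary: i)
  case (Cons A Ass)
  then show ?case by (cases i) (auto simp: add.assoc)
qed simp

lemma concat_nth_off: "i < length Ass \<Longrightarrow> j < length (Ass ! i) \<Longrightarrow> concat Ass ! (off Ass i + j) = Ass ! i ! j"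
proof (induction Ass arbitrary: i)
  case (Cons A Ass)
  then show ?case by (cases i) (auto simp: nth_append)
qed simp

lemma split_by_nth:
  "length xs = length (concat Ass) \<Longrightarrow> i < length Ass \<Longrightarrow> j < length (Ass ! i) \<Longrightarrow>
   split_by Ass xs ! i ! j = xs ! (off Ass i + j)"
proof (induction Ass xs arbitrary: i rule: split_by.induct)
  case (2 A Ass xs)
  then show ?case by (cases i) (auto simp: add.assoc)
qed simp

lemma off_exhaust:
  "k < length (concat Ass) \<Longrightarrow> \<exists>i j. i < length Ass \<and> j < length (Ass ! i) \<and> k = off Ass i + j"
proof (induction Ass arbitrary: k)
  case (Cons A Ass)
  show ?case
  proof (cases "k < length A")
    case True
    then show ?thesis by (intro exI[of _ 0] exI[of _ k]) auto
  next
    case False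
    then have "k - length A < length (concat Ass)" using Cons.prems by auto
    then obtain i j where "i < length Ass" "j < length (Ass ! i)" "k - length A = off Ass i + j"
      using Cons.IH by blast
    then show ?thesis using False by (intro exI[of _ "Suc i"] exI[of _ j]) auto
  qed
qed simp

lemma all_concat_iff:
  "(\<forall>k<length (concat Ass). P k) \<longleftrightarrow> (\<forall>i<length Ass. \<forall>j<length (Ass ! i). P (off Ass i + j))"
  using off_exhaust off_less by metis

lemma concat_split_by: "length xs = length (concat Ass) \<Longrightarrow> concat (split_by Ass xs) = xs"
  by (induction Ass xs rule: split_by.induct) auto

lemma split_by_concat:
  "length xss = length Ass \<Longrightarrow> (\<And>i. i < length Ass \<Longrightarrow> length (xss ! i) = length (Ass ! i)) \<Longrightarrow>
   split_by Ass (concat xss) = xss"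
proof (induction Ass arbitrary: xss)
  case (Cons A Ass)
  then obtain x xs where "xss = x # xs" by (cases xss) auto
  moreover have "length x = length A" using Cons.prems(2)[of 0] calculation by simp
  moreover have "split_by Ass (concat xs) = xs"
    using Cons.IH[of xs] Cons.prems(1) Cons.prems(2)[of "Suc i" for i] calculation by auto
  ultimately show ?case by simp
qed simp

lemma split_by_eq_iff:
  assumes "length xs = length (concat Ass)" "length ys = length (concat Ass)"
  shows "xs = ys \<longleftrightarrow> (\<forall>i<length Ass. split_by Ass xs ! i = split_by Ass ys ! i)"
  using concat_split_by[OF assms(1)] concat_split_by[OF assms(2)]
  by (metis nth_equalityI length_split_by)

lemma length_concat_split:
  "length xss = length Ass \<Longrightarrow> (\<And>i. i < length Ass \<Longrightarrow> length (xss ! i) = length (Ass ! i)) \<Longrightarrow>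
   length (concat xss) = length (concat Ass)"
proof -
  assume "length xss = length Ass" "\<And>i. i < length Ass \<Longrightarrow> length (xss ! i) = length (Ass ! i)"
  then have "map length xss = map length Ass" by (auto intro: nth_equalityI)
  then show ?thesis by (simp add: length_concat)
qed

lemma split_by_map:
  assumes "i < length Ass"
  shows "split_by Ass (map f [0..<length (concat Ass)]) ! i = map (\<lambda>j. f (off Ass i + j)) [0..<length (Ass ! i)]"
  using assms by (intro nth_equalityI) (auto simp: length_split_by_nth split_by_nth off_less)

section \<open>Products over a concatenated list, block by block\<close>

lemma prod_concat_Obj_iff:
  "xs \<in> Obj (prod_cat (concat Ass)) \<longleftrightarrow> length xs = length (concat Ass) \<and>
    (\<forall>i<length Ass. split_by Ass xs ! i \<in> Obj (prod_cat (Ass ! i)))"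
  unfolding prod_Obj_iff all_concat_iff
  by (auto simp: length_split_by_nth split_by_nth concat_nth_off simp del: length_concat)

lemma prod_concat_hom_iff:
  "in_hom (prod_cat (concat Ass)) fs xs ys \<longleftrightarrow> length fs = length (concat Ass) \<and>
    length xs = length (concat Ass) \<and> length ys = length (concat Ass) \<and>
    (\<forall>i<length Ass. in_hom (prod_cat (Ass ! i)) (split_by Ass fs ! i) (split_by Ass xs ! i) (split_by Ass ys ! i))"
  unfolding prod_hom_iff all_concat_iff
  by (auto simp: length_split_by_nth split_by_nth concat_nth_off simp del: length_concat)

lemma TP_concat_iff:
  "xs \<in> TP_obj (concat Ass) \<longleftrightarrow> length xs = length (concat Ass) \<and>
    (\<forall>i<length Ass. split_by Ass xs ! i \<in> TP_obj (Ass ! i))"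
  unfolding TP_obj_def mem_Collect_eq all_concat_iff
  by (auto simp: length_split_by_nth split_by_nth concat_nth_off simp del: length_concat)

lemma TP_le_concat_iff:
  "length xs = length (concat Ass) \<Longrightarrow> length ys = length (concat Ass) \<Longrightarrow>
   TP_le (concat Ass) xs ys \<longleftrightarrow> (\<forall>i<length Ass. TP_le (Ass ! i) (split_by Ass xs ! i) (split_by Ass ys ! i))"
  unfolding TP_le_def all_concat_iff
  by (auto simp: split_by_nth concat_nth_off simp del: length_concat)

lemma pick_concat:
  assumes "length xs = length (concat Ass)" "length ys = length (concat Ass)" "i < length Ass"
  shows "split_by Ass (pick (length (concat Ass)) J xs ys) ! i =
    pick (length (Ass ! i)) {j. off Ass i + j \<in> J} (split_by Ass xs ! i) (split_by Ass ys ! i)"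
  unfolding pick_def split_by_map[OF assms(3)] using assms by (auto simp: split_by_nth)

lemma is_functorI:
  assumes "\<And>a. a \<in> Obj C \<Longrightarrow> Fo a \<in> Obj D"
    "\<And>f a b. in_hom C f a b \<Longrightarrow> in_hom D (Fm f) (Fo a) (Fo b)"
    "\<And>a. a \<in> Obj C \<Longrightarrow> Fm (Ide C a) = Ide D (Fo a)"
    "\<And>f g a b c. in_hom C f a b \<Longrightarrow> in_hom C g b c \<Longrightarrow> Fm (Comp C g f) = Comp D (Fm g) (Fm f)"
  shows "is_functor C D Fo Fm"
  using assms unfolding is_functor_def in_hom_def by blast

lemma (in ctxs) prod_hom_OB:
  assumes "in_hom (prod_cat As) fs xs ys"
  shows "xs \<in> OB" "ys \<in> OB"
  using assms ctx.in_hom_obj[OF ctx_nth] by (auto simp: prod_hom_iff prod_Obj_iff)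

text \<open>The composite is prescribed only on the objects and arrows of the product category, so
  that the extensional functions of \<open>Fun_comp\<close> are an instance.\<close>

locale prodcomp = G: prodfun C Bs Go Gm
  for C :: "('o, 'm) ctxcat" and Bs :: "('o, 'm) ctxcat list" and Go :: "'o list \<Rightarrow> 'o" and Gm :: "'m list \<Rightarrow> 'm" +
  fixes Ass :: "('o, 'm) ctxcat list list" and Fos :: "nat \<Rightarrow> 'o list \<Rightarrow> 'o" and Fms :: "nat \<Rightarrow> 'm list \<Rightarrow> 'm"
    and Ho :: "'o list \<Rightarrow> 'o" and Hm :: "'m list \<Rightarrow> 'm"
  assumes len: "length Ass = length Bs"
    and Fp: "\<And>i. i < length Bs \<Longrightarrow> prodfun (Bs ! i) (Ass ! i) (Fos i) (Fms i)"
    and Ho: "\<And>xs. xs \<in> Obj (prod_cat (concat Ass)) \<Longrightarrow>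
      Ho xs = Go (map (\<lambda>i. Fos i (split_by Ass xs ! i)) [0..<length Bs])"
    and Hm: "\<And>fs. fs \<in> Arr (prod_cat (concat Ass)) \<Longrightarrow>
      Hm fs = Gm (map (\<lambda>i. Fms i (split_by Ass fs ! i)) [0..<length Bs])"
begin

section \<open>The composite functor\<close>

abbreviation "n \<equiv> length Bs"
abbreviation "N \<equiv> length (concat Ass)"
abbreviation blk :: "nat \<Rightarrow> 'x list \<Rightarrow> 'x list" where "blk i xs \<equiv> split_by Ass xs ! i"
abbreviation tup :: "(nat \<Rightarrow> 'x) \<Rightarrow> 'x list" where "tup f \<equiv> map f [0..<n]"

lemma Bctx: "i < n \<Longrightarrow> ctx (Bs ! i)"
  by (rule G.ctx_nth)

lemma tup_hom:
  "(\<And>i. i < n \<Longrightarrow> in_hom (Bs ! i) (f i) (x i) (y i)) \<Longrightarrow> in_hom (prod_cat Bs) (tup f) (tup x) (tup y)"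
  by (auto simp: prod_hom_iff)

lemma Gm_comp:
  "(\<And>i. i < n \<Longrightarrow> in_hom (Bs ! i) (g i) (y i) (z i)) \<Longrightarrow> (\<And>i. i < n \<Longrightarrow> in_hom (Bs ! i) (f i) (x i) (y i)) \<Longrightarrow>
   Comp C (Gm (tup g)) (Gm (tup f)) = Gm (tup (\<lambda>i. Comp (Bs ! i) (g i) (f i)))"
  by (subst G.Fm_comp[OF tup_hom tup_hom]) (auto intro!: arg_cong[of _ _ Gm])

lemma Gm_cong: "(\<And>i. i < n \<Longrightarrow> f i = g i) \<Longrightarrow> Gm (tup f) = Gm (tup g)"
  by (auto intro!: arg_cong[of _ _ Gm])

lemma tup_OB: "(\<And>i. i < n \<Longrightarrow> x i \<in> Obj (Bs ! i)) \<Longrightarrow> tup x \<in> G.OB"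
  by (simp add: prod_Obj_iff)

lemma Gm_tup_ide: "(\<And>i. i < n \<Longrightarrow> x i \<in> Obj (Bs ! i)) \<Longrightarrow> Gm (tup (\<lambda>i. Ide (Bs ! i) (x i))) = Ide C (Go (tup x))"
proof -
  assume "\<And>i. i < n \<Longrightarrow> x i \<in> Obj (Bs ! i)"
  from G.Fm_ide[OF tup_OB, OF this] have "Gm (tup (\<lambda>i. Ide (Bs ! i) (tup x ! i))) = Ide C (Go (tup x))" .
  moreover have "Gm (tup (\<lambda>i. Ide (Bs ! i) (tup x ! i))) = Gm (tup (\<lambda>i. Ide (Bs ! i) (x i)))"
    by (rule Gm_cong) simp
  ultimately show ?thesis by simp
qed

definition Y :: "'o list \<Rightarrow> 'o list" where "Y xs = tup (\<lambda>i. Fos i (blk i xs))"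

lemma Y_nth [simp]: "i < n \<Longrightarrow> Y xs ! i = Fos i (blk i xs)"
  by (simp add: Y_def)

lemma length_Y [simp]: "length (Y xs) = n"
  by (simp add: Y_def)

lemma Ho_Y: "xs \<in> Obj (prod_cat (concat Ass)) \<Longrightarrow> Ho xs = Go (Y xs)"
  by (simp add: Ho Y_def)

lemma blk_OB: "xs \<in> Obj (prod_cat (concat Ass)) \<Longrightarrow> i < n \<Longrightarrow> blk i xs \<in> Obj (prod_cat (Ass ! i))"
  by (simp add: prod_concat_Obj_iff len)

lemma blk_hom:
  "in_hom (prod_cat (concat Ass)) fs xs ys \<Longrightarrow> i < n \<Longrightarrow>
   in_hom (prod_cat (Ass ! i)) (blk i fs) (blk i xs) (blk i ys)"
  by (simp add: prod_concat_hom_iff len)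

lemma F_obj: "i < n \<Longrightarrow> x \<in> Obj (prod_cat (Ass ! i)) \<Longrightarrow> Fos i x \<in> Obj (Bs ! i)"
  by (rule prodfun.Fo_obj[OF Fp])

lemma F_hom: "i < n \<Longrightarrow> in_hom (prod_cat (Ass ! i)) f x y \<Longrightarrow> in_hom (Bs ! i) (Fms i f) (Fos i x) (Fos i y)"
  by (rule prodfun.Fm_hom[OF Fp])

lemma Y_OB: "xs \<in> Obj (prod_cat (concat Ass)) \<Longrightarrow> Y xs \<in> G.OB"
  unfolding Y_def by (intro tup_OB F_obj blk_OB)

lemma Y_hom:
  "in_hom (prod_cat (concat Ass)) fs xs ys \<Longrightarrow>
   in_hom (prod_cat Bs) (tup (\<lambda>i. Fms i (blk i fs))) (Y xs) (Y ys)"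
  unfolding Y_def by (intro tup_hom F_hom blk_hom)

lemma concat_contextual: "A \<in> set (concat Ass) \<Longrightarrow> contextual A"
  using prodfun.axioms(2)[OF Fp] len by (fastforce simp: ctxs_def in_set_conv_nth)

lemma H_functor: "is_functor (prod_cat (concat Ass)) C Ho Hm"
proof (rule is_functorI)
  fix xs assume xs: "xs \<in> Obj (prod_cat (concat Ass))"
  then show "Ho xs \<in> Obj C" using G.Fo_obj[OF Y_OB] by (simp add: Ho_Y)
  have l: "length xs = N" using xs by (simp add: prod_Obj_iff)
  have ide: "Ide (prod_cat (concat Ass)) xs = map (\<lambda>k. Ide (concat Ass ! k) (xs ! k)) [0..<N]"
    using l by (auto simp: prod_cat_def intro!: nth_equalityI)
  have bl: "blk i (Ide (prod_cat (concat Ass)) xs) = map (\<lambda>j. Ide (Ass ! i ! j) (blk i xs ! j)) [0..<length (Ass ! i)]"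
    if "i < n" for i
    using that l by (simp add: ide split_by_map len concat_nth_off split_by_nth)
  have "Ide (prod_cat (concat Ass)) xs \<in> Arr (prod_cat (concat Ass))"
    unfolding ide using xs in_hom_arr[OF ctx.ide_hom[unfolded ctx_def, OF concat_contextual[OF nth_mem]]]
    by (auto simp: prod_Arr_iff prod_Obj_iff simp del: length_concat)
  then have "Hm (Ide (prod_cat (concat Ass)) xs) = Gm (tup (\<lambda>i. Ide (Bs ! i) (Fos i (blk i xs))))"
    unfolding Hm[OF \<open>_ \<in> Arr _\<close>] using bl prodfun.Fm_ide[OF Fp blk_OB[OF xs]]
    by (intro Gm_cong) simp
  then show "Hm (Ide (prod_cat (concat Ass)) xs) = Ide C (Ho xs)"
    using Gm_tup_ide[OF F_obj[OF _ blk_OB[OF xs]]] by (simp add: Ho_Y[OF xs] Y_def)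
next
  fix f a b assume f: "in_hom (prod_cat (concat Ass)) f a b"
  then have "a \<in> Obj (prod_cat (concat Ass))" "b \<in> Obj (prod_cat (concat Ass))"
    using ctxs.prod_hom_OB[OF ctxs.intro[OF concat_contextual]] by blast+
  then show "in_hom C (Hm f) (Ho a) (Ho b)"
    using G.Fm_hom[OF Y_hom[OF f]] Hm[OF in_hom_arr[OF f]] by (simp add: Ho_Y)
next
  fix f g a b c assume f: "in_hom (prod_cat (concat Ass)) f a b" and g: "in_hom (prod_cat (concat Ass)) g b c"
  let ?gf = "Comp (prod_cat (concat Ass)) g f"
  have l: "length f = N" "length g = N" using f g by (simp_all add: prod_hom_iff)
  have gf: "?gf = map (\<lambda>k. Comp (concat Ass ! k) (g ! k) (f ! k)) [0..<N]"
    by (simp add: prod_cat_def)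
  have bl: "blk i ?gf = map (\<lambda>j. Comp (Ass ! i ! j) (blk i g ! j) (blk i f ! j)) [0..<length (Ass ! i)]"
    if "i < n" for i
    using that l by (simp add: gf split_by_map len concat_nth_off split_by_nth)
  have arr: "?gf \<in> Arr (prod_cat (concat Ass))"
    unfolding gf prod_Arr_iff
  proof (intro conjI allI impI)
    fix k assume k: "k < N"
    have "in_hom (concat Ass ! k) (f ! k) (a ! k) (b ! k)" "in_hom (concat Ass ! k) (g ! k) (b ! k) (c ! k)"
      using f g k by (simp_all add: prod_hom_iff)
    from ctx.comp_hom[OF ctx.intro[OF concat_contextual[OF nth_mem[OF k]]] this(2,1)] k
    show "map (\<lambda>k. Comp (concat Ass ! k) (g ! k) (f ! k)) [0..<N] ! k \<in> Arr (concat Ass ! k)"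
      by (simp add: in_hom_def)
  qed simp
  have "Hm ?gf = Gm (tup (\<lambda>i. Comp (Bs ! i) (Fms i (blk i g)) (Fms i (blk i f))))"
    unfolding Hm[OF arr] using bl prodfun.Fm_comp[OF Fp blk_hom[OF g] blk_hom[OF f]]
    by (intro Gm_cong) simp
  also have "\<dots> = Comp C (Hm g) (Hm f)"
    unfolding Hm[OF in_hom_arr[OF g]] Hm[OF in_hom_arr[OF f]]
    using Gm_comp[OF F_hom[OF _ blk_hom[OF g]] F_hom[OF _ blk_hom[OF f]]] by simp
  finally show "Hm ?gf = Comp C (Hm g) (Hm f)" .
qed

sublocale H: prodfun C "concat Ass" Ho Hm
  by unfold_locales (use concat_contextual H_functor in auto)

lemma blk_TP: "xs \<in> H.TP \<Longrightarrow> i < n \<Longrightarrow> blk i xs \<in> TP_obj (Ass ! i)"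
  by (simp add: TP_concat_iff len)

lemma OB_len: "xs \<in> H.OB \<Longrightarrow> length xs = N"
  by (simp add: prod_Obj_iff)

lemma blk_LE: "H.LE xs ys \<Longrightarrow> xs \<in> H.OB \<Longrightarrow> ys \<in> H.OB \<Longrightarrow> i < n \<Longrightarrow> TP_le (Ass ! i) (blk i xs) (blk i ys)"
  by (simp add: TP_le_concat_iff len OB_len del: length_concat)

lemma TM_blk:
  assumes "H.LE ys xs" "xs \<in> H.OB" "ys \<in> H.OB"
  shows "H.TM xs ys = Gm (tup (\<lambda>i. TP_fun (Ass ! i) (Fms i) (blk i xs) (blk i ys)))"
  unfolding TP_fun_def Hm[OF in_hom_arr[OF H.tmap_hom[OF assms(1,3,2)]]]
proof (rule Gm_cong)
  fix i assume i: "i < n"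
  show "Fms i (blk i (map (\<lambda>i. T_map (concat Ass ! i) (xs ! i) (ys ! i)) [0..<N])) =
    Fms i (map (\<lambda>j. T_map (Ass ! i ! j) (blk i xs ! j) (blk i ys ! j)) [0..<length (Ass ! i)])"
    using assms i by (auto intro!: arg_cong[of _ _ "Fms i"] simp: split_by_map len concat_nth_off split_by_nth OB_len
        simp del: length_concat)
qed

lemma blk_mem_down:
  assumes "xs \<in> H.TP" "u \<in> H.dn xs" "i < n"
  shows "blk i u \<in> down (TP_obj (Ass ! i)) (TP_le (Ass ! i)) (blk i xs)"
  using assms blk_TP[of u i] blk_LE[of u xs i] H.TP_OB by (auto simp: down_def)

text \<open>Lexicographic orders are associative: the first differing position of two tuples lies in
  the first differing block and is the first differing position there.\<close>

lemma LX_blk_iff: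
  assumes xs: "xs \<in> H.TP" and u: "u \<in> H.dn xs" and v: "v \<in> H.dn xs"
  shows "H.LX u v \<longleftrightarrow> u = v \<or> (\<exists>i<n. (\<forall>j<i. blk j u = blk j v) \<and> TP_lex (Ass ! i) (blk i u) (blk i v) \<and> blk i u \<noteq> blk i v)"
proof -
  have D: "H.LE u xs" "H.LE v xs" "u \<in> H.OB" "v \<in> H.OB" using u v H.TP_OB by (auto simp: down_def)
  have L: "length u = N" "length v = N" using D OB_len by auto
  have blkL: "TP_lex (Ass ! i) (blk i u) (blk i v) \<longleftrightarrow> blk i u = blk i v \<or>
    (\<exists>k<length (Ass ! i). (\<forall>j<k. blk i u ! j = blk i v ! j) \<and>
     T_le (Ass ! i ! k) (blk i u ! k) (blk i v ! k) \<and> blk i u ! k \<noteq> blk i v ! k)" if i: "i < n" for i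
  proof -
    interpret F: prodfun "Bs ! i" "Ass ! i" "Fos i" "Fms i" by (rule Fp[OF i])
    show ?thesis
      using F.LX_down_iff[of "blk i u" "blk i xs" "blk i v"] i L D blk_LE[OF D(1,3) H.TP_OB[OF xs] i]
        blk_LE[OF D(2,4) H.TP_OB[OF xs] i] by (simp add: length_split_by_nth len del: length_concat)
  qed
  have nth: "blk i u ! j = u ! (off Ass i + j)" "blk i v ! j = v ! (off Ass i + j)"
    if "i < n" "j < length (Ass ! i)" for i j using that L by (simp_all add: split_by_nth len)
  have ble: "blk i u = blk i v \<longleftrightarrow> (\<forall>j<length (Ass ! i). u ! (off Ass i + j) = v ! (off Ass i + j))" if "i < n" for i
    using that L nth by (auto simp: list_eq_iff_nth_eq length_split_by_nth len simp del: length_concat)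
  have pre: "(\<forall>k'<off Ass i + k. u ! k' = v ! k') \<longleftrightarrow>
      (\<forall>j<i. blk j u = blk j v) \<and> (\<forall>j<k. blk i u ! j = blk i v ! j)" if i: "i < n" "k < length (Ass ! i)" for i k
  proof
    assume a: "\<forall>k'<off Ass i + k. u ! k' = v ! k'"
    have "blk j u = blk j v" if "j < i" for j
      using that i a off_mono[OF that, of Ass] by (subst ble) (auto simp: len)
    moreover have "\<forall>j<k. blk i u ! j = blk i v ! j" using a i nth by auto
    ultimately show "(\<forall>j<i. blk j u = blk j v) \<and> (\<forall>j<k. blk i u ! j = blk i v ! j)" by blast
  next
    assume a: "(\<forall>j<i. blk j u = blk j v) \<and> (\<forall>j<k. blk i u ! j = blk i v ! j)"
    show "\<forall>k'<off Ass i + k. u ! k' = v ! k'"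
    proof (intro allI impI)
      fix k' assume k': "k' < off Ass i + k"
      then have "k' < N" using off_less[of i Ass k] i len by simp
      then obtain i' j' where ij: "i' < length Ass" "j' < length (Ass ! i')" "k' = off Ass i' + j'"
        using off_exhaust by blast
      have "\<not> i < i'" using off_mono[of i i' Ass] ij k' i by auto
      then consider "i' < i" | "i' = i" "j' < k" using k' ij by fastforce
      then show "u ! k' = v ! k'"
      proof cases
        case 1
        then have "blk i' u = blk i' v" using a by blast
        then show ?thesis using ble[of i'] ij len by auto
      next
        case 2
        then show ?thesis using a nth[OF i(1), of j'] ij by auto
      qed
    qed
  qed
  have "(\<exists>k<N. (\<forall>j<k. u ! j = v ! j) \<and> T_le (concat Ass ! k) (u ! k) (v ! k) \<and> u ! k \<noteq> v ! k) \<longleftrightarrow>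
    (\<exists>i<n. \<exists>k<length (Ass ! i). (\<forall>j<off Ass i + k. u ! j = v ! j) \<and>
       T_le (Ass ! i ! k) (blk i u ! k) (blk i v ! k) \<and> blk i u ! k \<noteq> blk i v ! k)" (is "?A \<longleftrightarrow> ?B")
  proof
    assume ?A
    then obtain k where k: "k < N" "\<forall>j<k. u ! j = v ! j" "T_le (concat Ass ! k) (u ! k) (v ! k)" "u ! k \<noteq> v ! k"
      by blast
    obtain i j where "i < length Ass" "j < length (Ass ! i)" "k = off Ass i + j" using off_exhaust[OF k(1)] by blast
    with k show ?B using nth[of i j] len by (intro exI[of _ i] conjI exI[of _ j]) (auto simp: concat_nth_off)
  next
    assume ?B
    then obtain i k where k: "i < n" "k < length (Ass ! i)" "\<forall>j<off Ass i + k. u ! j = v ! j"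
       "T_le (Ass ! i ! k) (blk i u ! k) (blk i v ! k)" "blk i u ! k \<noteq> blk i v ! k" by blast
    then show ?A using nth[OF k(1,2)] off_less[of i Ass k] len
      by (intro exI[of _ "off Ass i + k"]) (auto simp: concat_nth_off simp del: length_concat)
  qed
  also have "?B \<longleftrightarrow> (\<exists>i<n. (\<forall>j<i. blk j u = blk j v) \<and> TP_lex (Ass ! i) (blk i u) (blk i v) \<and> blk i u \<noteq> blk i v)"
  proof -
    have "(\<exists>k<length (Ass ! i). (\<forall>j<off Ass i + k. u ! j = v ! j) \<and>
       T_le (Ass ! i ! k) (blk i u ! k) (blk i v ! k) \<and> blk i u ! k \<noteq> blk i v ! k) \<longleftrightarrow>
      (\<forall>j<i. blk j u = blk j v) \<and> TP_lex (Ass ! i) (blk i u) (blk i v) \<and> blk i u \<noteq> blk i v" if i: "i < n" for i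
    proof -
      let ?R = "\<exists>k<length (Ass ! i). (\<forall>j<k. blk i u ! j = blk i v ! j) \<and>
         T_le (Ass ! i ! k) (blk i u ! k) (blk i v ! k) \<and> blk i u ! k \<noteq> blk i v ! k"
      have "?R \<Longrightarrow> blk i u \<noteq> blk i v" by auto
      then have "TP_lex (Ass ! i) (blk i u) (blk i v) \<and> blk i u \<noteq> blk i v \<longleftrightarrow> ?R"
        unfolding blkL[OF i] by blast
      then show ?thesis using pre[OF i] by blast
    qed
    then show ?thesis by blast
  qed
  finally show ?thesis unfolding H.LX_down_iff[OF D(1,2) L] by simp
qed

end

locale compfun = prodcomp C Bs Go Gm Ass Fos Fms Ho Hm + G: multi C Bs Go Gm
  for C :: "('o, 'm) ctxcat" and Bs Go Gm Ass Fos Fms Ho Hm +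
  assumes F: "\<And>i. i < length Bs \<Longrightarrow> multi (Bs ! i) (Ass ! i) (Fos i) (Fms i)"
begin

lemma Fc: "i < n \<Longrightarrow> cellfun (Bs ! i) (Ass ! i) (Fos i) (Fms i)"
  using F by (simp add: multi_def)

lemma Y_TP: "xs \<in> H.TP \<Longrightarrow> Y xs \<in> G.TP"
  unfolding TP_obj_iff[of _ Bs] using Y_OB[OF H.TP_OB] cellfun.Fo_Len[OF Fc blk_TP] by simp

end

context compfun
begin

section \<open>Elements below x and tuples of initial segments\<close>

abbreviation "PH i \<equiv> cellfun.seg_obj (Bs ! i) (Ass ! i) (Fos i) (Fms i)"
abbreviation "PJ i \<equiv> cellfun.seg_proj (Bs ! i) (Ass ! i) (Fos i) (Fms i)"
abbreviation "QJ i \<equiv> cellfun.seg_base (Bs ! i) (Ass ! i) (Fos i) (Fms i)"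

text \<open>The tuple of the limits F_i[S_i], where S_i consists of the elements below x_i up to
  u_i. In general it is different from \<open>Y u\<close>; the arrows \<open>Pj x u\<close> lead
  from it to \<open>Y u\<close>.\<close>

definition Phi :: "'o list \<Rightarrow> 'o list \<Rightarrow> 'o list" where
  "Phi xs u = tup (\<lambda>i. PH i (blk i xs) (blk i u))"

definition Pj :: "'o list \<Rightarrow> 'o list \<Rightarrow> 'm list" where
  "Pj xs u = tup (\<lambda>i. PJ i (blk i xs) (blk i u))"

definition Qj :: "'o list \<Rightarrow> 'o list \<Rightarrow> 'm list" where
  "Qj xs u = tup (\<lambda>i. QJ i (blk i xs) (blk i u))"

lemma Phi_nth [simp]: "i < n \<Longrightarrow> Phi xs u ! i = PH i (blk i xs) (blk i u)"
  by (simp add: Phi_def)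

lemma length_Phi [simp]: "length (Phi xs u) = n"
  by (simp add: Phi_def)

lemma mem_bd_iff: "v \<in> H.bd u \<longleftrightarrow> v \<in> H.TP \<and> H.LE v u \<and> v \<noteq> u"
  by (simp add: bdry_def)

lemma blk_bd:
  assumes "u \<in> H.TP" "v \<in> H.bd u" "i < n" "blk i v \<noteq> blk i u"
  shows "blk i v \<in> bdry (TP_obj (Ass ! i)) (TP_le (Ass ! i)) (blk i u)"
  using assms blk_TP[of v i] blk_LE[of v u i] H.TP_OB by (auto simp: bdry_def)

lemma F_Len: "u \<in> H.TP \<Longrightarrow> i < n \<Longrightarrow> 1 \<le> Len (Bs ! i) (Fos i (blk i u))"
  by (rule cellfun.Fo_Len[OF Fc blk_TP])

context
  fixes x assumes x: "x \<in> H.TP"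
begin

lemma dn_OB: "u \<in> H.dn x \<Longrightarrow> u \<in> H.OB"
  using H.TP_OB by (auto simp: down_def)

lemma PH_obj: "u \<in> H.dn x \<Longrightarrow> i < n \<Longrightarrow> PH i (blk i x) (blk i u) \<in> Obj (Bs ! i)"
  by (rule cellfun.seg_obj_obj[OF Fc blk_TP[OF x] blk_mem_down[OF x]])

lemma PH_Len: "u \<in> H.dn x \<Longrightarrow> i < n \<Longrightarrow> 1 \<le> Len (Bs ! i) (PH i (blk i x) (blk i u))"
  by (rule cellfun.seg_obj_Len[OF Fc blk_TP[OF x] blk_mem_down[OF x]])

lemma PJ_hom:
  "u \<in> H.dn x \<Longrightarrow> i < n \<Longrightarrow> in_hom (Bs ! i) (PJ i (blk i x) (blk i u)) (PH i (blk i x) (blk i u)) (Fos i (blk i u))"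
  by (rule cellfun.seg_proj_hom[OF Fc blk_TP[OF x] blk_mem_down[OF x]])

lemma Phi_TP: "u \<in> H.dn x \<Longrightarrow> Phi x u \<in> G.TP"
  using PH_obj PH_Len by (simp add: TP_obj_iff prod_Obj_iff)

lemma Phi_self: "Phi x x = Y x"
  unfolding Phi_def Y_def using cellfun.seg_obj_self[OF Fc blk_TP[OF x]] by simp

lemma Phi_dn: "u \<in> H.dn x \<Longrightarrow> Phi x u \<in> G.dn (Y x)"
  using Phi_TP cellfun.seg_obj_le[OF Fc blk_TP[OF x] blk_mem_down[OF x]] by (simp add: down_def TP_le_def)

text \<open>In each block \<open>LE\<close> implies the linear order, which becomes the order of
  segment limits. The converse fails in general, since each block is mapped onto a chain; this
  direction is what makes preimages of sieves into sieves.\<close>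

lemma Phi_LE:
  assumes "u \<in> H.dn x" "v \<in> H.dn x" "H.LE v u"
  shows "G.LE (Phi x v) (Phi x u)"
  unfolding TP_le_def
proof (intro allI impI)
  fix i assume i: "i < n"
  interpret F: cellfun "Bs ! i" "Ass ! i" "Fos i" "Fms i" by (rule Fc[OF i])
  note b = blk_TP[OF x i] blk_mem_down[OF x assms(1) i] blk_mem_down[OF x assms(2) i]
  have "F.LE (blk i v) (blk i u)" using blk_LE[OF assms(3)] dn_OB assms i by blast
  then have "F.LX (blk i v) (blk i u)" by (rule F.bsieve_le_lin[OF F.dn_bsieve[OF b(1)] b(3,2)])
  then show "T_le (Bs ! i) (Phi x v ! i) (Phi x u ! i)" using F.seg_obj_LX(1)[OF b] i by simp
qed

lemma Phi_blk_inj: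
  assumes "u \<in> H.dn x" "v \<in> H.dn x" "i < n"
  shows "PH i (blk i x) (blk i u) = PH i (blk i x) (blk i v) \<longleftrightarrow> blk i u = blk i v"
  using cellfun.seg_obj_inj[OF Fc blk_TP[OF x] blk_mem_down[OF x assms(1)] blk_mem_down[OF x assms(2)]] assms(3) by auto

lemma Phi_inj:
  assumes "u \<in> H.dn x" "v \<in> H.dn x" "Phi x u = Phi x v"
  shows "u = v"
proof -
  have "blk i u = blk i v" if "i < n" for i
    using arg_cong[OF assms(3), of "\<lambda>l. l ! i"] Phi_blk_inj[OF assms(1,2) that] that by simp
  then show ?thesis
    using split_by_eq_iff[OF OB_len[OF dn_OB[OF assms(1)]] OB_len[OF dn_OB[OF assms(2)]]] len by simp
qed

text \<open>Each block is mapped isomorphically from its linear order onto a chain, and on both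
  sides the tuples are compared lexicographically by blocks.\<close>

lemma Phi_LX:
  assumes "u \<in> H.dn x" "v \<in> H.dn x"
  shows "G.LX (Phi x u) (Phi x v) \<longleftrightarrow> H.LX u v"
proof -
  have D: "G.LE (Phi x u) (Y x)" "G.LE (Phi x v) (Y x)"
    using Phi_dn[OF assms(1)] Phi_dn[OF assms(2)] by (auto simp: down_def)
  have "T_le (Bs ! i) (PH i (blk i x) (blk i u)) (PH i (blk i x) (blk i v)) \<longleftrightarrow> TP_lex (Ass ! i) (blk i u) (blk i v)"
    if "i < n" for i
    by (rule cellfun.seg_obj_LX_iff[OF Fc blk_TP[OF x] blk_mem_down[OF x assms(2)] blk_mem_down[OF x assms(1)], OF that that that that])
  moreover have "Phi x u = Phi x v \<longleftrightarrow> u = v" using Phi_inj[OF assms] by auto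
  moreover have "(\<forall>j<i. Phi x u ! j = Phi x v ! j) \<longleftrightarrow> (\<forall>j<i. blk j u = blk j v)" if "i < n" for i
    using Phi_blk_inj[OF assms] that by simp
  ultimately show ?thesis
    unfolding G.LX_down_iff[OF D length_Phi length_Phi] LX_blk_iff[OF x assms] using Phi_blk_inj[OF assms] by auto
qed

text \<open>Each entry of \<open>z\<close> is the limit over a segment by
  \<open>seg_obj_surj\<close>; the preimages of the entries are concatenated.\<close>

lemma Phi_surj:
  assumes z: "z \<in> G.dn (Y x)"
  shows "\<exists>u\<in>H.dn x. Phi x u = z"
proof -
  have zz: "z \<in> G.TP" "G.LE z (Y x)" "length z = n" using z G.TP_OB by (auto simp: down_def prod_Obj_iff)
  have "\<exists>u. u \<in> down (TP_obj (Ass ! i)) (TP_le (Ass ! i)) (blk i x) \<and> PH i (blk i x) u = z ! i" if i: "i < n" for i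
    using cellfun.seg_obj_surj[OF Fc[OF i] blk_TP[OF x i], of "z ! i"] zz i by (auto simp: TP_le_def TP_obj_iff)
  then obtain f where f: "\<And>i. i < n \<Longrightarrow> f i \<in> down (TP_obj (Ass ! i)) (TP_le (Ass ! i)) (blk i x)"
     "\<And>i. i < n \<Longrightarrow> PH i (blk i x) (f i) = z ! i" by metis
  have fl: "length (f i) = length (Ass ! i)" if "i < n" for i
    using f(1)[OF that] by (auto simp: down_def TP_obj_def)
  define u where "u = concat (tup f)"
  have sb: "split_by Ass u = tup f" unfolding u_def by (rule split_by_concat) (use fl len in auto)
  have l: "length u = N"
    unfolding u_def by (rule length_concat_split) (use fl len in auto)
  have b: "blk i u = f i" if "i < n" for i using that sb by simp
  have "u \<in> H.TP" using l f(1) b by (simp add: TP_concat_iff len down_def)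
  moreover have "H.LE u x" using f(1) b len by (simp add: TP_le_concat_iff[OF l OB_len[OF H.TP_OB[OF x]]] down_def)
  ultimately have "u \<in> H.dn x" by (simp add: down_def)
  moreover have "Phi x u = z" using f(2) b zz(3) by (intro nth_equalityI) auto
  ultimately show ?thesis by blast
qed

lemma Pj_hom: "u \<in> H.dn x \<Longrightarrow> in_hom (prod_cat Bs) (Pj x u) (Phi x u) (Y u)"
  unfolding Pj_def Phi_def Y_def by (rule tup_hom) (rule PJ_hom)

lemma GPj_hom: "u \<in> H.dn x \<Longrightarrow> in_hom C (Gm (Pj x u)) (Go (Phi x u)) (Go (Y u))"
  by (rule G.Fm_hom[OF Pj_hom])

lemma PJ_square:
  "u \<in> H.dn x \<Longrightarrow> i < n \<Longrightarrow> Square (PJ i (blk i x) (blk i u)) (Pr (Bs ! i) (PH i (blk i x) (blk i u)))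
     (Pr (Bs ! i) (Fos i (blk i u))) (QJ i (blk i x) (blk i u)) \<in> SqQ (Bs ! i)"
  by (rule cellfun.seg_proj_square[OF Fc blk_TP[OF x] blk_mem_down[OF x]])

abbreviation "smap u \<equiv> G.bmap (Phi x u) (Y u) (Pj x u) (Qj x u)"

text \<open>Here the condition of G on squares is used for cellularity: the squares supplied by the
  cellularity of the F_i, one in each variable, are fed into G.\<close>

lemma Pj_square:
  assumes u: "u \<in> H.dn x"
  shows "Square (Gm (Pj x u)) (Pr C (Go (Phi x u))) (Pr C (Go (Y u))) (smap u) \<in> SqQ C"
proof (rule G.sq)
  show "Phi x u \<in> G.TP" "Y u \<in> G.TP" using Phi_TP[OF u] Y_TP u by (auto simp: down_def)
  show "Square (Pj x u ! i) (Pr (Bs ! i) (Phi x u ! i)) (Pr (Bs ! i) (Y u ! i)) (Qj x u ! i) \<in> SqQ (Bs ! i)"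
    if "i < n" for i using PJ_square[OF u that] that by (simp add: Pj_def Qj_def)
qed (auto simp: Pj_def Qj_def)

text \<open>The candidate for the limit cone of H over \<open>bd x\<close>, with vertex the boundary
  of G at \<open>Y x\<close>: project to \<open>Phi x v\<close>, then pass to
  \<open>Y v\<close>.\<close>

definition comp_cone :: "'o list \<Rightarrow> 'm" where
  "comp_cone v = Comp C (Gm (Pj x v)) (G.econe (Y x) (Phi x v))"

end

section \<open>The candidate cone expressed through faces\<close>

definition bdry_comp :: "'o list \<Rightarrow> 'o list \<Rightarrow> nat \<Rightarrow> 'm" where
  "bdry_comp x v i = (if blk i v \<noteq> blk i x then bdry_cone (Ass ! i) (Bs ! i) (Fos i) (Fms i) (blk i x) (blk i v)
     else Ide (Bs ! i) (Fos i (blk i x)))"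

definition moved :: "'o list \<Rightarrow> 'o list \<Rightarrow> nat set" where
  "moved x v = {i. i < n \<and> blk i v \<noteq> blk i x}"

lemma moved_nonempty: "x \<in> H.OB \<Longrightarrow> v \<in> H.OB \<Longrightarrow> v \<noteq> x \<Longrightarrow> moved x v \<noteq> {}"
  using split_by_eq_iff[OF OB_len OB_len, of v x] len by (auto simp: moved_def)

lemma moved_sub: "moved x v \<subseteq> {..<n}"
  by (auto simp: moved_def)

lemma bd_dn: "u \<in> H.dn x \<Longrightarrow> v \<in> H.bd u \<Longrightarrow> x \<in> H.TP \<Longrightarrow> v \<in> H.dn x"
  using H.LE_trans by (auto simp: down_def bdry_def)

lemma face_Y:
  assumes u: "u \<in> H.TP" and v: "v \<in> H.bd u"
  shows "G.face (Y u) (moved u v) \<in> G.OB" "G.LE (G.face (Y u) (moved u v)) (Y u)" "G.face (Y u) (moved u v) \<noteq> Y u"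
proof -
  obtain i where "i \<in> moved u v" "i < n"
    using moved_nonempty[of u v] u v H.TP_OB moved_sub by (fastforce simp: mem_bd_iff)
  then show "G.face (Y u) (moved u v) \<in> G.OB" "G.LE (G.face (Y u) (moved u v)) (Y u)" "G.face (Y u) (moved u v) \<noteq> Y u"
    using G.face_OB G.face_LE G.face_neq Y_TP[OF u] Y_OB[OF H.TP_OB[OF u]] by auto
qed

lemma bdry_comp_hom:
  assumes u: "u \<in> H.TP" and v: "v \<in> H.bd u" and i: "i < n"
  shows "in_hom (Bs ! i) (bdry_comp u v i) (G.face (Y u) (moved u v) ! i) (Fos i (blk i v))"
proof -
  interpret F: cellfun "Bs ! i" "Ass ! i" "Fos i" "Fms i" by (rule Fc[OF i])
  show ?thesis
  proof (cases "blk i v = blk i u")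
    case True
    then show ?thesis
      using F.ide_hom[OF F_obj[OF i blk_OB[OF H.TP_OB[OF u] i]]] i by (simp add: bdry_comp_def G.face_nth moved_def)
  next
    case False
    have "blk i v \<in> F.bd (blk i u)" by (rule blk_bd[OF u v i False])
    then have "in_hom (Bs ! i) (bdry_cone (Ass ! i) (Bs ! i) (Fos i) (Fms i) (blk i u) (blk i v))
        (Par (Bs ! i) (Fos i (blk i u))) (Fos i (blk i v))"
      using F.bdry_lim[OF blk_TP[OF u i]] by (simp add: limit_cone_def cone_def)
    then show ?thesis using False i by (simp add: bdry_comp_def G.face_nth moved_def)
  qed
qed

lemma Phi_face:
  assumes x: "x \<in> H.TP" and u: "u \<in> H.dn x" and v: "v \<in> H.bd u"
  shows "G.face (Phi x u) (moved u v) \<in> G.OB" "G.LE (G.face (Phi x u) (moved u v)) (Phi x u)"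
    "G.face (Phi x u) (moved u v) \<noteq> Phi x u" "G.LE (Phi x v) (G.face (Phi x u) (moved u v))"
proof -
  have uTP: "u \<in> H.TP" using u by (simp add: down_def)
  note PT = Phi_TP[OF x u]
  obtain i where "i \<in> moved u v" "i < n"
    using moved_nonempty[of u v] uTP v H.TP_OB moved_sub by (fastforce simp: mem_bd_iff)
  then show "G.face (Phi x u) (moved u v) \<in> G.OB" "G.LE (G.face (Phi x u) (moved u v)) (Phi x u)"
    "G.face (Phi x u) (moved u v) \<noteq> Phi x u"
    using G.face_OB G.face_LE G.face_neq PT G.TP_OB by auto
  have vd: "v \<in> H.dn x" by (rule bd_dn[OF u v x])
  have le: "G.LE (Phi x v) (Phi x u)" by (rule Phi_LE[OF x u vd]) (use v in \<open>simp add: mem_bd_iff\<close>)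
  have "G.dif (Phi x v) (Phi x u) = moved u v"
    unfolding G.dif_def moved_def using Phi_blk_inj[OF x vd u] by auto
  then show "G.LE (Phi x v) (G.face (Phi x u) (moved u v))"
    using G.LE_face_dif[OF G.TP_OB[OF PT] le] by simp
qed

text \<open>The components of \<open>Pj x v\<close> composed with the display map to \<open>Phi x v\<close> from the face of \<open>Phi x u\<close>
  in the directions in which \<open>v\<close> differs from \<open>u\<close>.\<close>

definition mid :: "'o list \<Rightarrow> 'o list \<Rightarrow> 'o list \<Rightarrow> nat \<Rightarrow> 'm" where
  "mid x u v i = (if blk i v \<noteq> blk i u
     then Comp (Bs ! i) (PJ i (blk i x) (blk i v))
       (T_map (Bs ! i) (Par (Bs ! i) (PH i (blk i x) (blk i u))) (PH i (blk i x) (blk i v)))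
     else PJ i (blk i x) (blk i u))"

text \<open>\<open>Phi x v\<close> lies below the face of \<open>Phi x u\<close> in the moved
  directions, so the projection to it factors through that face; the entries of the remaining map
  are those of \<open>mid\<close>.\<close>

lemma Pj_face:
  assumes x: "x \<in> H.TP" and u: "u \<in> H.dn x" and v: "v \<in> H.bd u"
  shows "Comp C (Gm (tup (mid x u v)))
      (G.econe (Phi x u) (G.face (Phi x u) (moved u v))) =
    Comp C (Gm (Pj x v)) (G.econe (Phi x u) (Phi x v))"
proof -
  let ?f = "G.face (Phi x u) (moved u v)"
  have vd: "v \<in> H.dn x" by (rule bd_dn[OF u v x])
  note fc = Phi_face[OF assms]
  have vO: "Phi x v \<in> G.OB" by (rule G.TP_OB[OF Phi_TP[OF x vd]])
  have eq: "mid x u v i = Comp (Bs ! i) (Pj x v ! i) (T_map (Bs ! i) (?f ! i) (Phi x v ! i))" if i: "i < n" for i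
  proof -
    interpret B: ctx "Bs ! i" by (rule Bctx[OF i])
    show ?thesis
      using i B.T_map_refl[OF PH_obj[OF x u i]] B.comp_ide[OF PJ_hom[OF x u i]]
      by (simp add: mid_def G.face_nth moved_def Pj_def)
  qed
  have "Gm (tup (mid x u v)) = Comp C (Gm (Pj x v)) (G.TM ?f (Phi x v))"
    unfolding TP_fun_def G.Fm_comp[OF Pj_hom[OF x vd] G.tmap_hom[OF fc(4) vO fc(1)]]
    by (rule Gm_cong) (use eq in simp)
  then show ?thesis
    using G.comp_assoc[OF GPj_hom[OF x vd] G.TM_hom[OF fc(4) vO fc(1)] G.econe_hom[OF Phi_TP[OF x u] fc(1-3)]]
      G.econe_comp[OF Phi_TP[OF x u] fc(1-3) vO fc(4)] by simp
qed

text \<open>\<open>Pj_face\<close> for \<open>u\<close> as its own bound: an unmoved direction then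
  carries an identity, a moved one the boundary cone of F_i. In this form the candidate can be
  composed with maps of boundaries, which are described on faces.\<close>

lemma comp_cone_face:
  assumes u: "u \<in> H.TP" and v: "v \<in> H.bd u"
  shows "comp_cone u v = Comp C (Gm (tup (bdry_comp u v))) (G.econe (Y u) (G.face (Y u) (moved u v)))"
proof -
  have ud: "u \<in> H.dn u" using H.down_self[OF u] .
  have "bdry_comp u v i = mid u u v i" if i: "i < n" for i
    using cellfun.bdry_cone_pj(1)[OF Fc[OF i] blk_TP[OF u i]] blk_bd[OF u v i]
      cellfun.seg_obj_self[OF Fc[OF i] blk_TP[OF u i]] cellfun.seg_proj_self[OF Fc[OF i] blk_TP[OF u i]]
    by (simp add: bdry_comp_def mid_def)
  then have eq: "Gm (tup (bdry_comp u v)) = Gm (tup (mid u u v))" by (rule Gm_cong)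
  show ?thesis
    unfolding eq comp_cone_def[OF u] by (rule Pj_face[OF u ud v, unfolded Phi_self[OF u], symmetric])
qed

lemma Phi_neq:
  assumes x: "x \<in> H.TP" and u: "u \<in> H.dn x" and v: "v \<in> H.bd u"
  shows "Phi x v \<noteq> Phi x u" "Phi x v \<in> G.bd (Phi x u)"
proof -
  have vd: "v \<in> H.dn x" by (rule bd_dn[OF u v x])
  show "Phi x v \<noteq> Phi x u" using Phi_inj[OF x vd u] v by (auto simp: mem_bd_iff)
  then show "Phi x v \<in> G.bd (Phi x u)"
    using Phi_TP[OF x vd] Phi_LE[OF x u vd] v by (simp add: bdry_def)
qed

lemma comp_cone_hom:
  assumes u: "u \<in> H.TP" and v: "v \<in> H.bd u"
  shows "in_hom C (comp_cone u v) (Par C (Go (Y u))) (Go (Y v))"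
proof -
  have ud: "u \<in> H.dn u" using H.down_self[OF u] .
  have vd: "v \<in> H.dn u" by (rule bd_dn[OF ud v u])
  show ?thesis
    unfolding comp_cone_def[OF u]
    using GPj_hom[OF u vd] G.econe_hom[OF Y_TP[OF u]] Phi_neq[OF u ud v] Phi_self[OF u] G.TP_OB
    by (auto simp: bdry_def intro!: G.comp_hom)
qed

text \<open>\<open>smap\<close> is accessible only on faces, so \<open>comp_cone\<close> is first
  rewritten by \<open>comp_cone_face\<close>. The entries then combine to \<open>mid\<close> by
  \<open>seg_base_comp\<close>, and \<open>Pj_face\<close> returns to projections at
  \<open>Phi x v\<close>.\<close>

lemma comp_cone_smap:
  assumes x: "x \<in> H.TP" and u: "u \<in> H.dn x" and v: "v \<in> H.bd u"
  shows "Comp C (comp_cone u v) (smap x u) = Comp C (Gm (Pj x v)) (G.econe (Phi x u) (Phi x v))"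
proof -
  have uTP: "u \<in> H.TP" using u by (simp add: down_def)
  let ?I = "moved u v"
  let ?p = "pick n ?I (Pj x u) (Qj x u)"
  have I: "?I \<subseteq> {..<n}" "?I \<noteq> {}" using moved_sub moved_nonempty uTP v H.TP_OB by (auto simp: mem_bd_iff)
  note PT = Phi_TP[OF x u] and YT = Y_TP[OF uTP]
  have f: "in_hom (Bs ! i) (Pj x u ! i) (Phi x u ! i) (Y u ! i)"
    "in_hom (Bs ! i) (Qj x u ! i) (Par (Bs ! i) (Phi x u ! i)) (Par (Bs ! i) (Y u ! i))"
    "Comp (Bs ! i) (Pr (Bs ! i) (Y u ! i)) (Pj x u ! i) = Comp (Bs ! i) (Qj x u ! i) (Pr (Bs ! i) (Phi x u ! i))"
    if i: "i < n" for i
  proof -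
    interpret B: ctx "Bs ! i" by (rule Bctx[OF i])
    note S = B.SqQ_Pr_hom[OF PJ_square[OF x u i] PH_obj[OF x u i] PH_Len[OF x u i]
        F_obj[OF i blk_OB[OF H.TP_OB[OF uTP] i]] F_Len[OF uTP i]]
    then show "in_hom (Bs ! i) (Pj x u ! i) (Phi x u ! i) (Y u ! i)"
      "in_hom (Bs ! i) (Qj x u ! i) (Par (Bs ! i) (Phi x u ! i)) (Par (Bs ! i) (Y u ! i))"
      "Comp (Bs ! i) (Pr (Bs ! i) (Y u ! i)) (Pj x u ! i) = Comp (Bs ! i) (Qj x u ! i) (Pr (Bs ! i) (Phi x u ! i))"
      using i by (simp_all add: Pj_def Qj_def)
  qed
  have bmh: "in_hom C (smap x u) (Par C (Go (Phi x u))) (Par C (Go (Y u)))"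
    by (rule G.bdry_map_hom[OF PT YT f])
  have bmc: "Comp C (G.econe (Y u) (G.face (Y u) ?I)) (smap x u) = Comp C (Gm ?p) (G.econe (Phi x u) (G.face (Phi x u) ?I))"
    using G.bdry_map_comp[OF PT YT f I] by (simp add: G.face_cone_econe)
  have ph: "in_hom (prod_cat Bs) ?p (G.face (Phi x u) ?I) (G.face (Y u) ?I)"
    by (rule G.pick_hom[OF length_Phi length_Y f(1,2)])
  have kh: "in_hom (prod_cat Bs) (tup (bdry_comp u v)) (G.face (Y u) ?I) (Y v)"
    using bdry_comp_hom[OF uTP v] by (simp add: prod_hom_iff)
  note fY = face_Y[OF uTP v] and fP = Phi_face[OF x u v]
  have "Comp C (comp_cone u v) (smap x u) = Comp C (Gm (tup (bdry_comp u v))) (Comp C (Gm ?p) (G.econe (Phi x u) (G.face (Phi x u) ?I)))"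
    unfolding comp_cone_face[OF uTP v] bmc[symmetric]
    by (rule G.comp_assoc[OF G.Fm_hom[OF kh] G.econe_hom[OF YT fY] bmh])
  also have "\<dots> = Comp C (Comp C (Gm (tup (bdry_comp u v))) (Gm ?p)) (G.econe (Phi x u) (G.face (Phi x u) ?I))"
    by (rule G.comp_assoc[OF G.Fm_hom[OF kh] G.Fm_hom[OF ph] G.econe_hom[OF PT fP(1-3)], symmetric])
  also have "Comp C (Gm (tup (bdry_comp u v))) (Gm ?p) = Gm (tup (mid x u v))"
    unfolding G.Fm_comp[OF kh ph]
  proof (rule Gm_cong)
    fix i assume i: "i < n"
    interpret F: cellfun "Bs ! i" "Ass ! i" "Fos i" "Fms i" by (rule Fc[OF i])
    show "Comp (Bs ! i) (tup (bdry_comp u v) ! i) (?p ! i) = mid x u v i"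
      using i F.seg_base_comp[OF blk_TP[OF x i] blk_mem_down[OF x u i] blk_bd[OF uTP v i]]
        F.ide_comp[OF PJ_hom[OF x u i]]
      by (simp add: bdry_comp_def mid_def pick_def moved_def Pj_def Qj_def)
  qed
  finally show ?thesis unfolding Pj_face[OF x u v] .
qed

text \<open>Entrywise this is \<open>seg_proj_naturality\<close> at the end of the full segment,
  where the projection is an identity. It makes \<open>Pr C (Go (Y u))\<close> the map that
  \<open>good\<close> asks for.\<close>

lemma comp_cone_Pr:
  assumes u: "u \<in> H.TP" and v: "v \<in> H.bd u"
  shows "Comp C (comp_cone u v) (Pr C (Go (Y u))) = H.TM u v"
proof -
  have ud: "u \<in> H.dn u" using H.down_self[OF u] .
  have vd: "v \<in> H.dn u" by (rule bd_dn[OF ud v u])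
  have v': "v \<in> H.TP" "H.LE v u" using v by (auto simp: mem_bd_iff)
  have P: "Phi u v \<in> G.OB" "G.LE (Phi u v) (Y u)" "Phi u v \<noteq> Y u"
    using Phi_neq[OF u ud v] Phi_self[OF u] G.TP_OB by (auto simp: bdry_def)
  note YO = G.TP_OB[OF Y_TP[OF u]]
  have "Comp C (comp_cone u v) (Pr C (Go (Y u))) = Comp C (Gm (Pj u v)) (G.TM (Y u) (Phi u v))"
    unfolding comp_cone_def[OF u]
    using G.comp_assoc[OF GPj_hom[OF u vd] G.econe_hom[OF Y_TP[OF u] P]
        G.Pr_hom[OF G.Fo_obj[OF YO] G.Fo_Len[OF Y_TP[OF u]]]] G.econe_Pr[OF Y_TP[OF u] P] by simp
  also have "\<dots> = Gm (tup (\<lambda>i. TP_fun (Ass ! i) (Fms i) (blk i u) (blk i v)))"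
    unfolding TP_fun_def[of Bs] G.Fm_comp[OF Pj_hom[OF u vd] G.tmap_hom[OF P(2,1) YO]]
  proof (rule Gm_cong)
    fix i assume i: "i < n"
    interpret F: cellfun "Bs ! i" "Ass ! i" "Fos i" "Fms i" by (rule Fc[OF i])
    note b = blk_TP[OF u i] blk_mem_down[OF u ud i] blk_TP[OF v'(1) i] blk_LE[OF v'(2) H.TP_OB[OF v'(1)] H.TP_OB[OF u] i]
    show "Comp (Bs ! i) (Pj u v ! i) (map (\<lambda>i. T_map (Bs ! i) (Y u ! i) (Phi u v ! i)) [0..<n] ! i) =
        TP_fun (Ass ! i) (Fms i) (blk i u) (blk i v)"
      using F.seg_proj_naturality[OF b] i F.seg_obj_self[OF b(1)] F.seg_proj_self[OF b(1)]
        F.comp_ide[OF F.TM_hom[OF b(4) F.TP_OB[OF b(3)] F.TP_OB[OF b(1)]]]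
      by (simp add: Pj_def)
  qed
  also have "\<dots> = H.TM u v" by (rule TM_blk[OF v'(2) H.TP_OB[OF u] H.TP_OB[OF v'(1)], symmetric])
  finally show ?thesis .
qed

text \<open>The equality H[bd x] = G[bd (Y x)] together with its cones. It is stated for every
  choice without claiming that one exists, because the cellularity of H is to be derived from
  it.\<close>

definition bdry_agrees :: "'o list \<Rightarrow> bool" where
  "bdry_agrees x \<longleftrightarrow> (\<forall>a c. H.choice (H.bd x) a c \<longrightarrow> a (H.bd x) = Par C (Go (Y x)) \<and> (\<forall>v\<in>H.bd x. c (H.bd x) v = comp_cone x v))"

section \<open>Sieves below F(x) and their preimages\<close>

context
  fixes x a c aG cG
  assumes x: "x \<in> H.TP" and IH: "\<And>w. w \<in> H.bd x \<Longrightarrow> bdry_agrees w"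
    and ac: "H.choice (H.bd x) a c" and acG: "G.choice (G.dn (Y x)) aG cG"
begin

abbreviation "pre Z \<equiv> {u \<in> H.bd x. Phi x u \<in> Z}"

lemma bd_dn': "u \<in> H.bd x \<Longrightarrow> u \<in> H.dn x"
  by (simp add: bdry_def down_def)

lemma pre_bsieve:
  assumes Z: "G.bsieve Z"
  shows "H.bsieve (pre Z)"
proof (rule H.bsieve_subI[OF H.bsieve_bdry[OF x]])
  show "sieve H.TP H.LE (pre Z)"
    unfolding sieve_def
  proof (intro conjI ballI impI)
    show "pre Z \<subseteq> H.TP" by (auto simp: bdry_def)
    fix u v assume u: "u \<in> pre Z" and v: "v \<in> H.TP" "H.LE v u"
    have vb: "v \<in> H.bd x" by (rule H.bsieve_closed[OF H.bsieve_bdry[OF x] _ v]) (use u in auto)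
    have "G.LE (Phi x v) (Phi x u)" using Phi_LE[OF x bd_dn' bd_dn' v(2)] u vb by blast
    then have "Phi x v \<in> Z" using G.bsieve_closed[OF Z _ Phi_TP[OF x bd_dn'[OF vb]]] u by blast
    then show "v \<in> pre Z" using vb by blast
  qed
qed auto

text \<open>The square of G at the largest element of \<open>Z\<close>, followed by
  \<open>Pj_square\<close>, is the square of H at the corresponding element \<open>w\<close>. The
  inner induction supplies the left ends of the bottoms, and \<open>IH\<close> at \<open>w\<close>
  the boundary over which the squares lie.\<close>

lemma sieve_agrees:
  "G.bsieve Z \<Longrightarrow> Z \<subseteq> G.bd (Y x) \<Longrightarrow>
   a (pre Z) = aG Z \<and> (\<forall>v\<in>pre Z. c (pre Z) v = Comp C (Gm (Pj x v)) (cG Z (Phi x v)))"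
proof (induction "card Z" arbitrary: Z rule: less_induct)
  case less
  note Z = less(2) and Zsub = less(3)
  note bx = H.bsieve_bdry[OF x] and dY = G.bsieve_down[OF Y_TP[OF x]]
  have Zdn: "Z \<subseteq> G.dn (Y x)" using Zsub by (auto simp: bdry_def down_def)
  show ?case
  proof (cases "Z = {}")
    case True
    then show ?thesis using H.choice_empty[OF ac] G.choice_empty[OF acG] by simp
  next
    case False
    then obtain z where z: "z \<in> Z" "\<And>s. s \<in> Z \<Longrightarrow> G.LX s z" using G.bsieve_max[OF Z] by blast
    \<comment> \<open>By \<open>Phi_LX\<close> the element corresponding to \<open>z\<close> is the
      largest of the preimage, so removing \<open>z\<close> and \<open>w\<close> keeps sieve and
      preimage in correspondence.\<close>
    obtain w where w: "w \<in> H.dn x" "Phi x w = z" using Phi_surj[OF x] z(1) Zdn by blast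
    have "w \<noteq> x" using w(2) Phi_self[OF x] z(1) Zsub by (auto simp: bdry_def)
    with w have wb: "w \<in> H.bd x" by (auto simp: bdry_def down_def)
    have wTP: "w \<in> H.TP" using w by (simp add: down_def)
    have zTP: "z \<in> G.TP" using Phi_TP[OF x w(1)] w(2) by simp
    let ?X = "pre Z" and ?Z' = "Z - {z}"
    have X: "H.bsieve ?X" "?X \<subseteq> H.bd x" using pre_bsieve[OF Z] by auto
    have wX: "w \<in> ?X" using wb w z by auto
    have wmax: "H.LX u w" if "u \<in> ?X" for u
      using that z(2) Phi_LX[OF x bd_dn' w(1), of u] w(2) by auto
    have X': "pre ?Z' = ?X - {w}"
      using Phi_inj[OF x bd_dn' w(1)] w(2) by auto
    have Z': "G.bsieve ?Z'" by (rule G.bsieve_Diff_max[OF Z z])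
    have bX': "H.bsieve (?X - {w})" by (rule H.bsieve_Diff_max[OF X(1) wX wmax])
    have "card ?Z' < card Z" using z(1) G.bsieve_finite[OF Z] by (intro psubset_card_mono) auto
    from less(1)[OF this Z'] Zsub
    have ih: "a (?X - {w}) = aG ?Z'"
       "\<And>v. v \<in> ?X - {w} \<Longrightarrow> c (?X - {w}) v = Comp C (Gm (Pj x v)) (cG ?Z' (Phi x v))"
      unfolding X' by auto
    have bw: "H.bsieve (H.bd w)" "H.bd w \<subseteq> ?X - {w}"
      using H.bsieve_bdry[OF wTP] H.bdry_sub_Diff[OF X(1) wX] .
    have bz: "G.bsieve (G.bd z)" "G.bd z \<subseteq> ?Z'"
      using G.bsieve_bdry[OF zTP] G.bdry_sub_Diff[OF Z z(1)] .
    have Z'dn: "?Z' \<subseteq> G.dn (Y x)" using Zdn by auto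
    have "H.choice (H.bd w) a c"
      by (rule H.choice_sub[OF ac bx bw(1)]) (use bw X in auto)
    with IH[OF wb] have kw: "a (H.bd w) = Par C (Go (Y w))" "\<And>v. v \<in> H.bd w \<Longrightarrow> c (H.bd w) v = comp_cone w v"
      unfolding bdry_agrees_def by auto
    let ?rH = "restr_map C a c" and ?rG = "restr_map C aG cG"
    have zdn: "z \<in> G.dn (Y x)" using z(1) Zdn by auto
    have aGbz: "aG (G.bd z) = Par C (Go z)" using G.choice_display_down(3)[OF acG dY zdn] by simp
    have rG: "in_hom C (?rG ?Z' (G.bd z)) (aG ?Z') (Par C (Go z))"
      using G.choice_restr_hom[OF acG dY bz(1) Z' bz(2) Z'dn] aGbz by simp
    have sqH: "Square (?rH ?X (H.dn w)) (Pr C (a ?X)) (Pr C (Go (Y w))) (?rH (?X - {w}) (H.bd w)) \<in> SqQ C"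
      using H.choice_square[OF ac bx X wX wmax] Ho_Y[OF H.TP_OB[OF wTP]] by simp
    have sqG1: "Square (?rG Z (G.dn z)) (Pr C (aG Z)) (Pr C (Go z)) (?rG ?Z' (G.bd z)) \<in> SqQ C"
      by (rule G.choice_square[OF acG dY Z Zdn z])
    have sqG2: "Square (Gm (Pj x w)) (Pr C (Go z)) (Pr C (Go (Y w))) (smap x w) \<in> SqQ C"
      using Pj_square[OF x w(1)] w(2) by simp
    have bmh: "in_hom C (smap x w) (Par C (Go z)) (Par C (Go (Y w)))"
      by (rule G.SqQ_Pr_hom(2)[OF sqG2])
        (use zTP Y_TP[OF wTP] G.Fo_Len G.Fo_obj G.TP_OB in auto)
    \<comment> \<open>Tested on the components of the limit over \<open>H.bd w\<close>, which
      \<open>IH\<close> identifies with \<open>comp_cone w\<close>.\<close>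
    have bot: "?rH (?X - {w}) (H.bd w) = Comp C (smap x w) (?rG ?Z' (G.bd z))"
    proof (rule H.choice_restr_eqI[OF ac bx bw(1) bX' bw(2)])
      show "?X - {w} \<subseteq> H.bd x" by auto
      show "in_hom C (Comp C (smap x w) (?rG ?Z' (G.bd z))) (a (?X - {w})) (a (H.bd w))"
        using G.comp_hom[OF bmh rG] ih(1) kw(1) by simp
      fix v assume v: "v \<in> H.bd w"
      have vd: "v \<in> H.dn x" by (rule bd_dn[OF w(1) v x])
      have Pv: "Phi x v \<in> G.bd z" using Phi_neq(2)[OF x w(1) v] w(2) by simp
      have ec: "G.econe z (Phi x v) = cG (G.bd z) (Phi x v)"
        using G.bdry_choice(2)[OF zTP acG dY _ Pv] bz(2) Z'dn Pv by (auto simp: G.econe_def bdry_def)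
      have ech: "in_hom C (G.econe z (Phi x v)) (Par C (Go z)) (Go (Phi x v))"
        using Pv G.TP_OB by (intro G.econe_hom[OF zTP]) (auto simp: bdry_def)
      have "Comp C (c (H.bd w) v) (Comp C (smap x w) (?rG ?Z' (G.bd z))) = Comp C (Comp C (comp_cone w v) (smap x w)) (?rG ?Z' (G.bd z))"
        using G.comp_assoc[OF comp_cone_hom[OF wTP v] bmh rG] kw(2)[OF v] by simp
      also have "\<dots> = Comp C (Gm (Pj x v)) (Comp C (cG (G.bd z) (Phi x v)) (?rG ?Z' (G.bd z)))"
        using comp_cone_smap[OF x w(1) v] w(2) G.comp_assoc[OF GPj_hom[OF x vd] ech rG] ec by simp
      also have "Comp C (cG (G.bd z) (Phi x v)) (?rG ?Z' (G.bd z)) = cG ?Z' (Phi x v)"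
        by (rule G.choice_restr_comp[OF acG dY bz(1) Z' bz(2) Z'dn Pv])
      also have "Comp C (Gm (Pj x v)) (cG ?Z' (Phi x v)) = c (?X - {w}) v"
        using ih(2)[OF subsetD[OF bw(2) v]] by simp
      finally show "Comp C (c (H.bd w) v) (Comp C (smap x w) (?rG ?Z' (G.bd z))) = c (?X - {w}) v" .
    qed
    \<comment> \<open>The square of H and the composite of the two squares of G have right side
      \<open>Pr C (Go (Y w))\<close> and, by \<open>bot\<close>, the same bottom.\<close>
    note un = G.SqQ_unique[OF sqH G.SqQ_hcomp[OF sqG1 sqG2, folded bot]]
    have aX: "a ?X = aG Z"
      by (rule G.Pr_inj[OF un(2) H.choice_obj[OF ac bx X] G.choice_obj[OF acG dY Z Zdn]
            H.choice_display(2)[OF ac bx X wX wmax] G.choice_display(2)[OF acG dY Z Zdn z]])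
    have "c ?X v = Comp C (Gm (Pj x v)) (cG Z (Phi x v))" if v: "v \<in> ?X" for v
    proof (cases "v = w")
      case True
      have sub: "H.dn w \<subseteq> ?X" "G.dn z \<subseteq> Z" using H.down_sub[OF X(1) wX] G.down_sub[OF Z z(1)] .
      have ww: "w \<in> H.dn w" "z \<in> G.dn z" using H.down_self[OF wTP] G.down_self[OF zTP] .
      have "Comp C (c (H.dn w) w) (?rH ?X (H.dn w)) = c ?X w"
        by (rule H.choice_restr_comp[OF ac bx H.bsieve_down[OF wTP] X(1) sub(1) X(2) ww(1)])
      moreover have "c (H.dn w) w = Ide C (Ho w)"
        using H.choice_down(2)[OF ac bx wb ww(1)] H.Dm_ide[OF wTP] by simp
      moreover have "in_hom C (?rH ?X (H.dn w)) (a ?X) (Ho w)"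
        using H.choice_restr_hom[OF ac bx H.bsieve_down[OF wTP] X(1) sub(1) X(2)] H.choice_down(1)[OF ac bx wb] by simp
      ultimately have 1: "c ?X w = ?rH ?X (H.dn w)" using G.ide_comp by simp
      have "Comp C (cG (G.dn z) z) (?rG Z (G.dn z)) = cG Z z"
        by (rule G.choice_restr_comp[OF acG dY G.bsieve_down[OF zTP] Z sub(2) Zdn ww(2)])
      moreover have "cG (G.dn z) z = Ide C (Go z)"
        using G.choice_down(2)[OF acG dY zdn ww(2)] G.Dm_ide[OF zTP] by simp
      moreover have "in_hom C (?rG Z (G.dn z)) (aG Z) (Go z)"
        using G.choice_restr_hom[OF acG dY G.bsieve_down[OF zTP] Z sub(2) Zdn] G.choice_down(1)[OF acG dY zdn] by simp
      ultimately have 2: "cG Z z = ?rG Z (G.dn z)" using G.ide_comp by simp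
      show ?thesis using True 1 2 un(1) w(2) by simp
    next
      case False
      with v have v': "v \<in> ?X - {w}" by auto
      then have vd: "v \<in> H.dn x" using bd_dn' by auto
      have Pv: "Phi x v \<in> ?Z'" using v' X' by blast
      have "c ?X v = Comp C (c (?X - {w}) v) (?rH ?X (?X - {w}))"
        using H.choice_restr_comp[OF ac bx bX' X(1) _ X(2) v'] by auto
      also have "\<dots> = Comp C (Comp C (Gm (Pj x v)) (cG ?Z' (Phi x v))) (?rG Z ?Z')"
        using ih(2)[OF v'] H.choice_display(1)[OF ac bx X wX wmax] G.choice_display(1)[OF acG dY Z Zdn z] aX by simp
      also have "\<dots> = Comp C (Gm (Pj x v)) (Comp C (cG ?Z' (Phi x v)) (?rG Z ?Z'))"
        using Zdn by (intro G.comp_assoc[OF GPj_hom[OF x vd] G.choice_hom[OF acG dY Z' Z'dn Pv]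
              G.choice_restr_hom[OF acG dY Z' Z _ Zdn]]) auto
      also have "Comp C (cG ?Z' (Phi x v)) (?rG Z ?Z') = cG Z (Phi x v)"
        using G.choice_restr_comp[OF acG dY Z' Z _ Zdn Pv] by auto
      finally show ?thesis .
    qed
    with aX show ?thesis by blast
  qed
qed

end

text \<open>\<open>sieve_agrees\<close> for the full boundary of \<open>Y x\<close>: since
  \<open>Phi x\<close> maps \<open>H.bd x\<close> into it, the preimage is all of
  \<open>H.bd x\<close>. The outer induction is on the size of \<open>H.dn x\<close>.\<close>

lemma bdry_agrees_TP: "x \<in> H.TP \<Longrightarrow> bdry_agrees x"
proof (induction "card (H.dn x)" arbitrary: x rule: less_induct)
  case less
  note x = less(2)
  have IH: "bdry_agrees w" if w: "w \<in> H.bd x" for w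
  proof (rule less(1))
    show wTP: "w \<in> H.TP" using w by (simp add: mem_bd_iff)
    have "H.dn w \<subseteq> H.bd x" by (rule H.down_sub[OF H.bsieve_bdry[OF x] w])
    then have "H.dn w \<subset> H.dn x" using H.bdry_down[OF x] H.down_self[OF x] by blast
    then show "card (H.dn w) < card (H.dn x)" by (rule psubset_card_mono[OF H.TP_finite_down])
  qed
  show ?case
    unfolding bdry_agrees_def
  proof (intro allI impI)
    fix a c assume ac: "H.choice (H.bd x) a c"
    note YT = Y_TP[OF x]
    obtain aG cG where acG: "G.choice (G.dn (Y x)) aG cG"
      using G.choice_ex[OF G.bsieve_down[OF YT]] by blast
    have xd: "x \<in> H.dn x" by (rule H.down_self[OF x])
    have bY: "G.bd (Y x) \<subseteq> G.dn (Y x)" "Y x \<in> G.dn (Y x)" using G.bdry_down[OF YT] G.down_self[OF YT] by auto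
    have P: "Phi x v \<in> G.bd (Y x)" if "v \<in> H.bd x" for v
      using Phi_neq(2)[OF x xd that] Phi_self[OF x] by simp
    then have X: "{u \<in> H.bd x. Phi x u \<in> G.bd (Y x)} = H.bd x" by auto
    note cl = sieve_agrees[OF x IH ac acG G.bsieve_bdry[OF YT] order_refl, unfolded X]
    have "G.econe (Y x) (Phi x v) = cG (G.bd (Y x)) (Phi x v)" if v: "v \<in> H.bd x" for v
      using G.bdry_choice(2)[OF YT acG G.bsieve_down[OF YT] bY(1) P[OF v]] P[OF v]
      by (simp add: G.econe_def bdry_def)
    then show "a (H.bd x) = Par C (Go (Y x)) \<and> (\<forall>v\<in>H.bd x. c (H.bd x) v = comp_cone x v)"
      using cl G.choice_display_down(3)[OF acG G.bsieve_down[OF YT] bY(2)] by (simp add: comp_cone_def[OF x])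
  qed
qed

lemma H_good: "x \<in> H.TP \<Longrightarrow> H.good x"
  unfolding H.good_def
proof (intro allI impI)
  fix a c assume x: "x \<in> H.TP" and ac: "H.choice (H.bd x) a c"
  have k: "a (H.bd x) = Par C (Go (Y x))" "\<And>v. v \<in> H.bd x \<Longrightarrow> c (H.bd x) v = comp_cone x v"
    using bdry_agrees_TP[OF x] ac unfolding bdry_agrees_def by auto
  note YT = Y_TP[OF x]
  note o = G.Fo_obj[OF G.TP_OB[OF YT]] G.Fo_Len[OF YT]
  show "\<exists>u. display_map_len1 C u \<and> in_hom C u (Ho x) (a (H.bd x)) \<and>
        (\<forall>z\<in>H.bd x. Comp C (c (H.bd x) z) u = H.TM x z)"
    using o G.Pr_hom[OF o] k comp_cone_Pr[OF x] Ho_Y[OF H.TP_OB[OF x]]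
    by (intro exI[of _ "Pr C (Go (Y x))"]) (auto simp: G.display_len1_iff)
qed

end

context compfun
begin

section \<open>The remaining conditions on the composite\<close>

lemma H_zero:
  assumes xs: "xs \<in> H.OB" and k: "k < N" "Len (concat Ass ! k) (xs ! k) = 0"
  shows "Ho xs = ctx_one C"
proof -
  obtain i j where ij: "i < length Ass" "j < length (Ass ! i)" "k = off Ass i + j" using off_exhaust[OF k(1)] by blast
  then have i: "i < n" using len by simp
  have "Len (Ass ! i ! j) (blk i xs ! j) = 0"
    using k(2) ij OB_len[OF xs] by (simp add: split_by_nth concat_nth_off)
  then have "Fos i (blk i xs) = ctx_one (Bs ! i)" by (rule cellfun.zero[OF Fc[OF i] blk_OB[OF xs i] ij(2)])
  then have "Len (Bs ! i) (Y xs ! i) = 0" using i ctx.Len_one[OF Bctx[OF i]] by simp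
  then show ?thesis using G.zero[OF Y_OB[OF xs] i] Ho_Y[OF xs] by simp
qed

lemma H_cellfun: "cellfun C (concat Ass) Ho Hm"
  by unfold_locales (use H_zero H_good in auto)

end

sublocale compfun \<subseteq> H: cellfun C "concat Ass" Ho Hm
  by (rule H_cellfun)

context compfun
begin

lemma bdry_cone_eq_comp_cone:
  assumes x: "x \<in> H.TP" and v: "v \<in> H.bd x"
  shows "H.bcone x v = comp_cone x v"
proof -
  obtain a c where ac: "H.choice (H.bd x) a c" using H.choice_ex[OF H.bsieve_bdry[OF x]] by blast
  then show ?thesis
    using H.bdry_choice(2)[OF x ac H.bsieve_bdry[OF x] order_refl v] bdry_agrees_TP[OF x] v unfolding bdry_agrees_def by auto
qed

text \<open>A set of directions in the concatenated list is split into its part in each block and,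
  in \<open>outer\<close>, the set of blocks that it meets. A face of H in the directions
  \<open>J\<close> factors through the face of G in the directions \<open>outer J\<close>.\<close>

definition inner :: "nat set \<Rightarrow> nat \<Rightarrow> nat set" where
  "inner J i = {j. j < length (Ass ! i) \<and> off Ass i + j \<in> J}"

definition outer :: "nat set \<Rightarrow> nat set" where
  "outer J = {i. i < n \<and> inner J i \<noteq> {}}"

lemma inner_sub: "inner J i \<subseteq> {..<length (Ass ! i)}"
  by (auto simp: inner_def)

lemma outer_sub: "outer J \<subseteq> {..<n}"
  by (auto simp: outer_def)

lemma outer_nonempty:
  assumes "J \<subseteq> {..<N}" "J \<noteq> {}"
  shows "outer J \<noteq> {}"
proof -
  obtain k where "k \<in> J" "k < N" using assms by blast
  moreover then obtain i j where "i < length Ass" "j < length (Ass ! i)" "k = off Ass i + j"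
    using off_exhaust by blast
  ultimately show ?thesis using len by (auto simp: outer_def inner_def)
qed

lemma blk_pick:
  assumes "length xs = N" "length ys = N" "i < n"
  shows "blk i (pick N J xs ys) = pick (length (Ass ! i)) (inner J i) (blk i xs) (blk i ys)"
  using assms unfolding pick_concat[OF assms(1,2) assms(3)[folded len]] by (auto simp: pick_def inner_def)

lemma blk_face:
  assumes "x \<in> H.OB" "i < n"
  shows "blk i (H.face x J) = cellfun.face (Ass ! i) (blk i x) (inner J i)"
proof -
  interpret F: cellfun "Bs ! i" "Ass ! i" "Fos i" "Fms i" by (rule Fc[OF assms(2)])
  note l = OB_len[OF assms(1)]
  have "blk i (map2 Par (concat Ass) x) = map2 Par (Ass ! i) (blk i x)"
    using l assms(2) len
    by (auto intro!: nth_equalityI simp: length_split_by_nth split_by_nth concat_nth_off off_less simp del: length_concat)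
  then show ?thesis
    unfolding H.face_def F.face_def using blk_pick[of x "map2 Par (concat Ass) x" i J] l assms(2) by simp
qed

definition face_comp :: "'o list \<Rightarrow> nat set \<Rightarrow> nat \<Rightarrow> 'm" where
  "face_comp x J i = (if i \<in> outer J then face_cone (Ass ! i) (Bs ! i) (Fos i) (Fms i) (blk i x) (inner J i)
     else Ide (Bs ! i) (Fos i (blk i x)))"

lemma outer_iff: "i < n \<Longrightarrow> i \<in> outer J \<longleftrightarrow> inner J i \<noteq> {}"
  by (simp add: outer_def)

lemma blk_face_eq_iff:
  assumes x: "x \<in> H.TP" and i: "i < n"
  shows "blk i (H.face x J) = blk i x \<longleftrightarrow> i \<notin> outer J"
proof -
  interpret F: cellfun "Bs ! i" "Ass ! i" "Fos i" "Fms i" by (rule Fc[OF i])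
  note b = blk_TP[OF x i]
  have "F.face (blk i x) {} = blk i x"
    using F.OB_length[OF F.TP_OB[OF b]] by (auto intro!: nth_equalityI simp: F.face_nth)
  moreover have "F.face (blk i x) (inner J i) \<noteq> blk i x" if "i \<in> outer J"
    using F.face_neq[OF b] that by (auto simp: outer_iff[OF i] inner_def)
  ultimately show ?thesis
    unfolding blk_face[OF H.TP_OB[OF x] i] by (cases "i \<in> outer J") (auto simp: outer_iff[OF i])
qed

lemma face_comp_hom:
  assumes x: "x \<in> H.TP" and i: "i < n"
  shows "in_hom (Bs ! i) (face_comp x J i) (G.face (Y x) (outer J) ! i) (Fos i (blk i (H.face x J)))"
proof -
  interpret F: cellfun "Bs ! i" "Ass ! i" "Fos i" "Fms i" by (rule Fc[OF i])
  note b = blk_TP[OF x i]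
  show ?thesis
  proof (cases "i \<in> outer J")
    case False
    then show ?thesis
      using F.ide_hom[OF F.Fo_obj[OF F.TP_OB[OF b]]] i blk_face_eq_iff[OF x i, of J]
      by (simp add: face_comp_def G.face_nth)
  next
    case True
    have "F.face (blk i x) (inner J i) \<noteq> blk i x"
      using blk_face_eq_iff[OF x i, of J] True unfolding blk_face[OF H.TP_OB[OF x] i] by simp
    then have "in_hom (Bs ! i) (F.econe (blk i x) (F.face (blk i x) (inner J i))) (Par (Bs ! i) (Fos i (blk i x)))
       (Fos i (F.face (blk i x) (inner J i)))"
      by (intro F.econe_hom[OF b] F.face_OB F.face_LE F.TP_OB b)
    then show ?thesis
      using True i unfolding blk_face[OF H.TP_OB[OF x] i] by (simp add: face_comp_def G.face_nth F.face_cone_econe)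
  qed
qed

text \<open>If the face is in the poset, this is \<open>comp_cone_face\<close>, the moved blocks
  being \<open>outer J\<close>. Otherwise H is terminal at the face and both sides are maps into
  it.\<close>

lemma H_face_cone:
  assumes x: "x \<in> H.TP" and J: "J \<subseteq> {..<N}" "J \<noteq> {}"
  shows "H.fcone x J =
    Comp C (Gm (tup (face_comp x J))) (G.fcone (Y x) (outer J))"
proof -
  let ?v = "H.face x J"
  note xO = H.TP_OB[OF x] and YT = Y_TP[OF x]
  have vO: "?v \<in> H.OB" "H.LE ?v x" using H.face_OB[OF xO] H.face_LE[OF xO] .
  have nv: "?v \<noteq> x" using H.face_neq[OF x] J by blast
  show ?thesis
  proof (cases "?v \<in> H.TP")
    case True
    then have v: "?v \<in> H.bd x" using vO nv by (simp add: mem_bd_iff)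
    have "moved x ?v = outer J" using blk_face_eq_iff[OF x, of _ J] outer_sub by (auto simp: moved_def)
    moreover have "bdry_comp x ?v i = face_comp x J i" if i: "i < n" for i
    proof -
      interpret F: cellfun "Bs ! i" "Ass ! i" "Fos i" "Fms i" by (rule Fc[OF i])
      show ?thesis
        using blk_face_eq_iff[OF x i, of J] blk_TP[OF True i] blk_face[OF xO i, of J]
        by (simp add: bdry_comp_def face_comp_def F.face_cone_econe F.econe_def)
    qed
    then have "Gm (tup (bdry_comp x ?v)) = Gm (tup (face_comp x J))" by (rule Gm_cong)
    ultimately show ?thesis
      using comp_cone_face[OF x v] bdry_cone_eq_comp_cone[OF x v] True
      by (simp add: H.face_cone_econe G.face_cone_econe) (simp add: H.econe_def)
  next
    case False
    obtain i where "i \<in> outer J" "i < n" using outer_nonempty[OF J] outer_sub by blast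
    then have fn: "G.face (Y x) (outer J) \<noteq> Y x" by (rule G.face_neq[OF YT])
    have kh: "in_hom (prod_cat Bs) (tup (face_comp x J)) (G.face (Y x) (outer J)) (Y ?v)"
      using face_comp_hom[OF x] by (simp add: prod_hom_iff)
    have "in_hom C (Comp C (Gm (tup (face_comp x J))) (G.econe (Y x) (G.face (Y x) (outer J)))) (Par C (Go (Y x))) (Go (Y ?v))"
      by (rule G.comp_hom[OF G.Fm_hom[OF kh] G.econe_hom[OF YT G.face_OB[OF G.TP_OB[OF YT]] G.face_LE[OF G.TP_OB[OF YT]] fn]])
    then show ?thesis
      unfolding H.face_cone_econe G.face_cone_econe
      using H.hom_to_nonTP[OF vO(1) False H.econe_hom[OF x vO nv]] Ho_Y[OF vO(1)] Ho_Y[OF xO] by simp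
  qed
qed

text \<open>The conditions of the F_i give a square in each B_i whose bottom is a map of boundaries,
  and the condition of G applies to these. What remains is that the bottom obtained is the map of
  boundaries of H.\<close>

lemma H_sq:
  assumes xy: "xs \<in> H.TP" "ys \<in> H.TP" and l: "length fs0 = N" "length fs1 = N"
    and q: "\<And>k. k < N \<Longrightarrow>
      Square (fs0 ! k) (Pr (concat Ass ! k) (xs ! k)) (Pr (concat Ass ! k) (ys ! k)) (fs1 ! k) \<in> SqQ (concat Ass ! k)"
  shows "Square (Hm fs0) (Pr C (Ho xs)) (Pr C (Ho ys)) (H.bmap xs ys fs0 fs1) \<in> SqQ C"
proof -
  let ?t = "\<lambda>i. Fms i (blk i fs0)"
  let ?b = "\<lambda>i. bdry_map (Ass ! i) (Bs ! i) (Fos i) (Fms i) (blk i xs) (blk i ys) (blk i fs0) (blk i fs1)"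
  note o = H.TP_OB[OF xy(1)] H.TP_OB[OF xy(2)]
  note YT = Y_TP[OF xy(1)] Y_TP[OF xy(2)]
  have qb: "Square (blk i fs0 ! j) (Pr (Ass ! i ! j) (blk i xs ! j)) (Pr (Ass ! i ! j) (blk i ys ! j)) (blk i fs1 ! j)
      \<in> SqQ (Ass ! i ! j)" if "i < n" "j < length (Ass ! i)" for i j
    using q[OF off_less[of i Ass j]] that l OB_len[OF o(1)] OB_len[OF o(2)] len
    by (simp add: split_by_nth concat_nth_off)
  have lb: "length (blk i fs0) = length (Ass ! i)" "length (blk i fs1) = length (Ass ! i)" if "i < n" for i
    using that l len by (simp_all add: length_split_by_nth)
  have hk: "in_hom (concat Ass ! k) (fs0 ! k) (xs ! k) (ys ! k)"
     "in_hom (concat Ass ! k) (fs1 ! k) (Par (concat Ass ! k) (xs ! k)) (Par (concat Ass ! k) (ys ! k))"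
     "Comp (concat Ass ! k) (Pr (concat Ass ! k) (ys ! k)) (fs0 ! k) = Comp (concat Ass ! k) (fs1 ! k) (Pr (concat Ass ! k) (xs ! k))"
    if k: "k < N" for k
  proof -
    interpret A: ctx "concat Ass ! k" by (rule H.ctx_nth[OF k])
    have L: "xs ! k \<in> Obj (concat Ass ! k)" "1 \<le> Len (concat Ass ! k) (xs ! k)"
      "ys ! k \<in> Obj (concat Ass ! k)" "1 \<le> Len (concat Ass ! k) (ys ! k)"
      using xy k by (auto simp: TP_obj_iff prod_Obj_iff simp del: length_concat)
    show "in_hom (concat Ass ! k) (fs0 ! k) (xs ! k) (ys ! k)"
     "in_hom (concat Ass ! k) (fs1 ! k) (Par (concat Ass ! k) (xs ! k)) (Par (concat Ass ! k) (ys ! k))"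
     "Comp (concat Ass ! k) (Pr (concat Ass ! k) (ys ! k)) (fs0 ! k) = Comp (concat Ass ! k) (fs1 ! k) (Pr (concat Ass ! k) (xs ! k))"
      using A.SqQ_Pr_hom[OF q[OF k] L] by auto
  qed
  have h0: "in_hom (prod_cat (concat Ass)) fs0 xs ys"
    using hk(1) l OB_len[OF o(1)] OB_len[OF o(2)] by (simp add: prod_hom_iff del: length_concat)
  have ph: "in_hom (prod_cat (concat Ass)) (pick N J fs0 fs1) (H.face xs J) (H.face ys J)" for J
    by (rule H.pick_hom[OF OB_len[OF o(1)] OB_len[OF o(2)] hk(1,2)])
  have sqb: "Square (?t i) (Pr (Bs ! i) (Fos i (blk i xs))) (Pr (Bs ! i) (Fos i (blk i ys))) (?b i) \<in> SqQ (Bs ! i)"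
    if i: "i < n" for i
    by (rule multi.sq[OF F[OF i] blk_TP[OF xy(1) i] blk_TP[OF xy(2) i] lb[OF i] qb[OF i]])
  have Gsq: "Square (Gm (tup ?t)) (Pr C (Go (Y xs))) (Pr C (Go (Y ys)))
      (G.bmap (Y xs) (Y ys) (tup ?t) (tup ?b)) \<in> SqQ C"
    by (rule G.sq[OF YT]) (use sqb in auto)
  let ?u = "G.bmap (Y xs) (Y ys) (tup ?t) (tup ?b)"
  have f: "in_hom (Bs ! i) (tup ?t ! i) (Y xs ! i) (Y ys ! i)"
    "in_hom (Bs ! i) (tup ?b ! i) (Par (Bs ! i) (Y xs ! i)) (Par (Bs ! i) (Y ys ! i))"
    "Comp (Bs ! i) (Pr (Bs ! i) (Y ys ! i)) (tup ?t ! i) = Comp (Bs ! i) (tup ?b ! i) (Pr (Bs ! i) (Y xs ! i))"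
    if i: "i < n" for i
  proof -
    interpret B: ctx "Bs ! i" by (rule Bctx[OF i])
    note S = B.SqQ_Pr_hom[OF sqb[OF i] F_obj[OF i blk_OB[OF o(1) i]] F_Len[OF xy(1) i]
        F_obj[OF i blk_OB[OF o(2) i]] F_Len[OF xy(2) i]]
    then show "in_hom (Bs ! i) (tup ?t ! i) (Y xs ! i) (Y ys ! i)"
      "in_hom (Bs ! i) (tup ?b ! i) (Par (Bs ! i) (Y xs ! i)) (Par (Bs ! i) (Y ys ! i))"
      "Comp (Bs ! i) (Pr (Bs ! i) (Y ys ! i)) (tup ?t ! i) = Comp (Bs ! i) (tup ?b ! i) (Pr (Bs ! i) (Y xs ! i))"
      using i by simp_all
  qed
  have uh: "in_hom C ?u (Par C (Go (Y xs))) (Par C (Go (Y ys)))" by (rule G.bdry_map_hom[OF YT f])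
  \<comment> \<open>It suffices to compare on the faces of \<open>ys\<close>. There both maps factor
    through the faces of G, and the comparison splits into one equation for each block.\<close>
  have "H.bmap xs ys fs0 fs1 = ?u"
  proof (rule H.bdry_map_eqI[OF xy])
    show "in_hom C ?u (Par C (Ho xs)) (Par C (Ho ys))" using uh by (simp add: Ho_Y o)
    fix J assume J: "J \<subseteq> {..<N}" "J \<noteq> {}"
    let ?I = "outer J" and ?p = "pick n (outer J) (tup ?t) (tup ?b)"
    have I: "?I \<subseteq> {..<n}" "?I \<noteq> {}" using outer_sub outer_nonempty[OF J] .
    then obtain i0 where i0: "i0 \<in> ?I" "i0 < n" by blast
    have kh: "in_hom (prod_cat Bs) (tup (face_comp z J)) (G.face (Y z) ?I) (Y (H.face z J))" if "z \<in> H.TP" for z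
      using face_comp_hom[OF that] by (simp add: prod_hom_iff)
    have fh: "in_hom C (G.fcone (Y z) ?I) (Par C (Go (Y z))) (Go (G.face (Y z) ?I))" if z: "z \<in> H.TP" for z
      unfolding G.face_cone_econe
      by (rule G.econe_hom[OF Y_TP[OF z] G.face_OB[OF G.TP_OB[OF Y_TP[OF z]]] G.face_LE[OF G.TP_OB[OF Y_TP[OF z]]]
            G.face_neq[OF Y_TP[OF z] i0]])
    have pI: "in_hom (prod_cat Bs) ?p (G.face (Y xs) ?I) (G.face (Y ys) ?I)"
      by (rule G.pick_hom[OF length_Y length_Y f(1,2)])
    have pJ: "in_hom (prod_cat Bs) (tup (\<lambda>i. Fms i (blk i (pick N J fs0 fs1))))
        (Y (H.face xs J)) (Y (H.face ys J))" by (rule Y_hom[OF ph])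
    have "Comp C (H.fcone ys J) ?u =
        Comp C (Gm (tup (face_comp ys J))) (Comp C (G.fcone (Y ys) ?I) ?u)"
      unfolding H_face_cone[OF xy(2) J] by (rule G.comp_assoc[OF G.Fm_hom[OF kh[OF xy(2)]] fh[OF xy(2)] uh])
    also have "Comp C (G.fcone (Y ys) ?I) ?u = Comp C (Gm ?p) (G.fcone (Y xs) ?I)"
      by (rule G.bdry_map_comp[OF YT f I])
    also have "Comp C (Gm (tup (face_comp ys J))) \<dots> = Comp C (Comp C (Gm (tup (face_comp ys J))) (Gm ?p)) (G.fcone (Y xs) ?I)"
      by (rule G.comp_assoc[OF G.Fm_hom[OF kh[OF xy(2)]] G.Fm_hom[OF pI] fh[OF xy(1)], symmetric])
    also have "Comp C (Gm (tup (face_comp ys J))) (Gm ?p) =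
        Comp C (Gm (tup (\<lambda>i. Fms i (blk i (pick N J fs0 fs1))))) (Gm (tup (face_comp xs J)))"
      unfolding G.Fm_comp[OF kh[OF xy(2)] pI] G.Fm_comp[OF pJ kh[OF xy(1)]]
    proof (rule Gm_cong)
      fix i assume i: "i < n"
      interpret F: cellfun "Bs ! i" "Ass ! i" "Fos i" "Fms i" by (rule Fc[OF i])
      note b = blk_TP[OF xy(1) i] blk_TP[OF xy(2) i]
      have fb: "in_hom (Ass ! i ! j) (blk i fs0 ! j) (blk i xs ! j) (blk i ys ! j)"
         "in_hom (Ass ! i ! j) (blk i fs1 ! j) (Par (Ass ! i ! j) (blk i xs ! j)) (Par (Ass ! i ! j) (blk i ys ! j))"
         "Comp (Ass ! i ! j) (Pr (Ass ! i ! j) (blk i ys ! j)) (blk i fs0 ! j) = Comp (Ass ! i ! j) (blk i fs1 ! j) (Pr (Ass ! i ! j) (blk i xs ! j))"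
        if "j < length (Ass ! i)" for j
        using hk[OF off_less[of i Ass j]] that i l OB_len[OF o(1)] OB_len[OF o(2)] len
        by (simp_all add: split_by_nth concat_nth_off)
      have pk: "blk i (pick N J fs0 fs1) = pick (length (Ass ! i)) (inner J i) (blk i fs0) (blk i fs1)"
        by (rule blk_pick[OF l i])
      show "Comp (Bs ! i) (tup (face_comp ys J) ! i) (?p ! i) =
        Comp (Bs ! i) (tup (\<lambda>i. Fms i (blk i (pick N J fs0 fs1))) ! i) (tup (face_comp xs J) ! i)"
      proof (cases "i \<in> ?I")
        case True
        then have "inner J i \<noteq> {}" using outer_iff[OF i] by blast
        with F.bdry_map_comp[OF b fb inner_sub] True i pk show ?thesis by (simp add: face_comp_def pick_def[of n])
      next
        case False
        \<comment> \<open>\<open>J\<close> does not meet this block, so its top maps stay in place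
          and the components of the faces are identities.\<close>
        then have e: "inner J i = {}" using outer_iff[OF i] by blast
        have "pick (length (Ass ! i)) {} (blk i fs0) (blk i fs1) = blk i fs0"
          using lb[OF i] by (auto simp: pick_def intro!: nth_equalityI)
        moreover have "in_hom (Bs ! i) (?t i) (Fos i (blk i xs)) (Fos i (blk i ys))" using f(1)[OF i] i by simp
        ultimately show ?thesis using False i pk e F.ide_comp F.comp_ide by (simp add: face_comp_def pick_def[of n])
      qed
    qed
    also have "Comp C \<dots> (G.fcone (Y xs) ?I) =
        Comp C (Gm (tup (\<lambda>i. Fms i (blk i (pick N J fs0 fs1)))))
          (Comp C (Gm (tup (face_comp xs J))) (G.fcone (Y xs) ?I))"
      by (rule G.comp_assoc[OF G.Fm_hom[OF pJ] G.Fm_hom[OF kh[OF xy(1)]] fh[OF xy(1)]])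
    finally show "Comp C (H.fcone ys J) ?u =
        Comp C (Hm (pick N J fs0 fs1)) (H.fcone xs J)"
      unfolding H_face_cone[OF xy(1) J] Hm[OF in_hom_arr[OF ph]] .
  qed
  then show ?thesis using Gsq by (simp add: Ho_Y o Hm[OF in_hom_arr[OF h0]])
qed

lemma H_multi: "multi C (concat Ass) Ho Hm"
  by unfold_locales (rule H_sq)

end

section \<open>The multicategory\<close>

text \<open>The empty product of posets is a point with empty boundary. Cellularity then asks for a
  length-1 display map from the value to the terminal object, and the only square to check is an
  identity square.\<close>

lemma multi_nullary_iff:
  fixes B :: "('o, 'm) ctxcat"
  assumes B: "contextual B" and f: "is_functor (prod_cat ([] :: ('o, 'm) ctxcat list)) B Fo Fm"
  shows "multi B [] Fo Fm \<longleftrightarrow> Len B (Fo []) = 1"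
proof -
  interpret prodfun B "[]" Fo Fm
    by unfold_locales (use B f in auto)
  have OB: "OB = {[]}" and TP: "TP = {[]}" by (auto simp: prod_Obj_iff TP_obj_iff)
  have bd: "bd [] = {}" by (auto simp: bdry_def TP)
  have o: "Fo [] \<in> Obj B" by (rule Fo_obj) (simp add: OB)
  show ?thesis
  proof
    assume "multi B [] Fo Fm"
    then interpret multi B "[]" Fo Fm .
    have t: "[] \<in> TP" by (simp add: TP)
    obtain a c where ac: "choice (dn []) a c" using choice_ex[OF bsieve_down[OF t]] by blast
    have "Par B (Fo []) = ctx_one B"
      using choice_display_down(3)[OF ac bsieve_down[OF t] down_self[OF t]] choice_empty[OF ac] bd by simp
    then show "Len B (Fo []) = 1" using Len_Par[OF o] Len_one Fo_Len[OF t] by simp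
  next
    assume L: "Len B (Fo []) = 1"
    have P: "Par B (Fo []) = ctx_one B" using L by (intro Len0_one Par_obj o) (simp add: Len_Par o)
    interpret cellfun B "[]" Fo Fm
    proof unfold_locales
      fix xs assume "xs \<in> TP"
      then have xs: "xs = []" by (simp add: TP)
      show "good xs"
        unfolding good_def xs bd
      proof (intro allI impI)
        fix a c assume "choice {} a c"
        then have "a {} = ctx_one B" by (rule choice_empty)
        then show "\<exists>u. display_map_len1 B u \<and> in_hom B u (Fo []) (a {}) \<and> (\<forall>z\<in>{}. Comp B (c {} z) u = TM [] z)"
          using Pr_hom[OF o] L P iffD2[OF display_len1_iff, OF bexI[of _ "Fo []"]] o
          by (intro exI[of _ "Pr B (Fo [])"]) simp
      qed
    qed simp
    show "multi B [] Fo Fm"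
    proof unfold_locales
      fix xs ys :: "'o list" and fs0 fs1 :: "'m list"
      assume "xs \<in> TP" "ys \<in> TP" "length fs0 = length ([] :: ('o, 'm) ctxcat list)"
        "length fs1 = length ([] :: ('o, 'm) ctxcat list)"
      then have e: "xs = []" "ys = []" "fs0 = []" "fs1 = []" by (auto simp: TP)
      have t: "[] \<in> TP" by (simp add: TP)
      have "Fm [] = Ide B (Fo [])" using Fm_ide[of "[]"] by (simp add: OB)
      moreover have "bdry_map [] B Fo Fm [] [] [] [] = Ide B (Par B (Fo []))"
        by (rule bdry_map_eqI[OF t t ide_hom[OF Par_obj[OF o]]]) auto
      ultimately show "Square (Fm fs0) (Pr B (Fo xs)) (Pr B (Fo ys)) (bdry_map [] B Fo Fm xs ys fs0 fs1) \<in> SqQ B"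
        using SqQ_ide[OF o] L e by simp
    qed
  qed
qed

text \<open>In one variable F[bd x] is \<open>Par A x\<close>, and a square is sent to itself. Only
  the values on one-element lists of objects and arrows of \<open>A\<close> are prescribed.\<close>

lemma multi_identity:
  assumes A: "contextual A" and Fo: "\<And>x. x \<in> Obj A \<Longrightarrow> Fo [x] = x" and Fm: "\<And>f. f \<in> Arr A \<Longrightarrow> Fm [f] = f"
  shows "multi A [A] Fo Fm"
proof -
  interpret ctx A by unfold_locales (rule A)
  have prod_hom: "\<exists>f a b. fs = [f] \<and> xs = [a] \<and> ys = [b] \<and> in_hom A f a b" if "in_hom (prod_cat [A]) fs xs ys" for fs xs ys
    using that by (auto simp: prod_hom_iff length_Suc_conv)
  have prod_obj: "\<exists>a\<in>Obj A. xs = [a]" if "xs \<in> Obj (prod_cat [A])" for xs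
    using that by (auto simp: prod_Obj_iff length_Suc_conv)
  have "is_functor (prod_cat [A]) A Fo Fm"
  proof (rule is_functorI)
    fix xs assume "xs \<in> Obj (prod_cat [A])"
    then obtain a where a: "a \<in> Obj A" "xs = [a]" using prod_obj by blast
    then show "Fo xs \<in> Obj A" by (simp add: Fo)
    show "Fm (Ide (prod_cat [A]) xs) = Ide A (Fo xs)"
      using a ide_hom[OF a(1)] by (simp add: prod_cat_def Fo Fm in_hom_arr)
  next
    fix fs xs ys assume "in_hom (prod_cat [A]) fs xs ys"
    then obtain f a b where f: "fs = [f]" "xs = [a]" "ys = [b]" "in_hom A f a b" using prod_hom by blast
    then show "in_hom A (Fm fs) (Fo xs) (Fo ys)"
      using in_hom_obj[OF f(4)] by (simp add: Fo Fm in_hom_arr)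
  next
    fix fs gs xs ys zs assume fg: "in_hom (prod_cat [A]) fs xs ys" "in_hom (prod_cat [A]) gs ys zs"
    obtain f a b where "fs = [f]" "ys = [b]" "in_hom A f a b" using prod_hom[OF fg(1)] by blast
    moreover obtain g b' c where "gs = [g]" "ys = [b']" "in_hom A g b' c" using prod_hom[OF fg(2)] by blast
    ultimately have f: "fs = [f]" "gs = [g]" "in_hom A f a b" "in_hom A g b c" by auto
    then show "Fm (Comp (prod_cat [A]) gs fs) = Comp A (Fm gs) (Fm fs)"
      using comp_hom[OF f(4,3)] by (simp add: prod_cat_def Fm in_hom_arr)
  qed
  then interpret prodfun A "[A]" Fo Fm
    by unfold_locales (use A in auto)
  have TPD: "\<exists>x\<in>Obj A. xs = [x] \<and> 1 \<le> Len A x" if "xs \<in> TP" for xs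
    using that prod_obj TP_OB by (fastforce simp: TP_obj_iff)
  have TPI: "[x] \<in> TP" if "x \<in> Obj A" "1 \<le> Len A x" for x
    using that by (simp add: TP_obj_iff prod_Obj_iff)
  have le: "LE [b] [x] \<longleftrightarrow> T_le A b x" for b x by (simp add: TP_le_def)
  have TMeq: "TM [x] [b] = T_map A x b" if "T_le A b x" for x b
    using T_map_hom[OF that] by (simp add: TP_fun_def Fm in_hom_arr)
  have bd1: "bd [x] = {}" if "x \<in> Obj A" "Len A x = 1" for x
  proof -
    have False if "y \<in> bd [x]" for y
    proof -
      from that have y: "y \<in> TP" "LE y [x]" "y \<noteq> [x]" by (auto simp: bdry_def)
      obtain b where "y = [b]" "1 \<le> Len A b" using TPD[OF y(1)] by blast
      with y have "1 \<le> Len A b" "T_le A b x" "b \<noteq> x" by (auto simp: le)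
      with T_le_strict[of b x] \<open>Len A x = 1\<close> show False by simp
    qed
    then show ?thesis by blast
  qed
  \<comment> \<open>Above length 1 the boundary is the principal sieve of \<open>Par A x\<close>,
    where the limit is prescribed. At length 1 it is empty, and \<open>Par A x\<close> is the
    terminal object.\<close>
  have bd2: "bd [x] = dn [Par A x]" "[Par A x] \<in> bd [x]" if x: "x \<in> Obj A" "1 < Len A x" for x
  proof -
    have n: "Par A x \<noteq> x" using Len_Par[OF x(1)] x(2) by auto
    have Pt: "[Par A x] \<in> TP" by (rule TPI) (use x Par_obj Len_Par in auto)
    show Pb: "[Par A x] \<in> bd [x]" using Pt n T_le_Par[OF x(1)] by (simp add: bdry_def le)
    have xt: "[x] \<in> TP" by (rule TPI) (use x in auto)
    show "bd [x] = dn [Par A x]"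
    proof
      show "dn [Par A x] \<subseteq> bd [x]" by (rule down_sub[OF bsieve_bdry[OF xt] Pb])
      show "bd [x] \<subseteq> dn [Par A x]"
      proof
        fix y assume "y \<in> bd [x]"
        then have y: "y \<in> TP" "LE y [x]" "y \<noteq> [x]" by (auto simp: bdry_def)
        obtain b where "y = [b]" using TPD[OF y(1)] by blast
        with y have b: "y = [b]" "[b] \<in> TP" "T_le A b x" "b \<noteq> x" by (auto simp: le)
        then show "y \<in> dn [Par A x]" using T_le_ParI[OF b(3,4)] by (simp add: down_def le)
      qed
    qed
  qed
  interpret cellfun A "[A]" Fo Fm
  proof unfold_locales
    fix xs i assume "xs \<in> OB" "i < length [A]" "Len ([A] ! i) (xs ! i) = 0"
    then show "Fo xs = ctx_one A" using prod_obj[of xs] Len0_one Fo by auto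
  next
    fix xs assume "xs \<in> TP"
    then obtain x where x: "x \<in> Obj A" "xs = [x]" "1 \<le> Len A x" using TPD by blast
    have xt: "[x] \<in> TP" by (rule TPI[OF x(1,3)])
    show "good xs"
      unfolding good_def x(2)
    proof (intro allI impI)
      fix a c assume ac: "choice (bd [x]) a c"
      have "a (bd [x]) = Par A x \<and> (\<forall>z\<in>bd [x]. Comp A (c (bd [x]) z) (Pr A x) = TM [x] z)"
      proof (cases "Len A x = 1")
        case True
        then have "Par A x = ctx_one A" by (intro Len0_one Par_obj x) (simp add: Len_Par x)
        then show ?thesis using bd1[OF x(1) True] choice_empty[OF ac] by simp
      next
        case False
        with x have L: "1 < Len A x" by simp
        note b = bd2[OF x(1) L]
        note cd = choice_down[OF ac bsieve_bdry[OF xt] b(2), folded b(1)]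
        have "Comp A (TM [Par A x] z) (Pr A x) = TM [x] z" if z: "z \<in> bd [x]" for z
        proof -
          have "TM [x] [Par A x] = Pr A x" using TMeq[OF T_le_Par[OF x(1)]] T_map_Par[OF x(1,3)] by simp
          moreover have "z \<in> TP" "LE z [Par A x]" using z unfolding b(1) by (auto simp: down_def)
          ultimately show ?thesis
            using TM_comp[of z "[Par A x]" "[x]"] TP_OB xt b(2) by (auto simp: bdry_def)
        qed
        then show ?thesis using cd Fo[OF Par_obj[OF x(1)]] by simp
      qed
      then show "\<exists>u. display_map_len1 A u \<and> in_hom A u (Fo [x]) (a (bd [x])) \<and>
          (\<forall>z\<in>bd [x]. Comp A (c (bd [x]) z) u = TM [x] z)"
        using Pr_hom[OF x(1,3)] x Fo by (intro exI[of _ "Pr A x"]) (auto simp: display_len1_iff)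
    qed
  qed
  \<comment> \<open>With one variable, \<open>{0}\<close> is the only nonempty set of directions.
    Its component being an identity, the map of boundaries must be \<open>f1\<close>.\<close>
  have fcone: "face_cone [A] A Fo Fm [x] {0} = Ide A (Par A x)" if x: "x \<in> Obj A" "1 \<le> Len A x" for x
  proof -
    have xt: "[x] \<in> TP" by (rule TPI[OF x])
    have f: "face [x] {0} = [Par A x]" by (auto intro!: nth_equalityI simp: face_nth)
    show ?thesis
    proof (cases "Len A x = 1")
      case True
      then have P: "Par A x = ctx_one A" by (intro Len0_one Par_obj x) (simp add: Len_Par x)
      have "[Par A x] \<notin> TP" using P Len_one by (simp add: TP_obj_iff)
      then have "face_cone [A] A Fo Fm [x] {0} = to_one A (Par A x)"
        unfolding face_cone_econe f econe_def using bdry_obj_Par[OF xt] Fo[OF x(1)] by simp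
      then show ?thesis using to_one_unique[OF to_one_hom ide_hom] one_obj P by simp
    next
      case False
      with x have L: "1 < Len A x" by simp
      note b = bd2[OF x(1) L]
      obtain a c where ac: "choice (bd [x]) a c" using choice_ex[OF bsieve_bdry[OF xt]] by blast
      have Pt: "[Par A x] \<in> TP" using b(2) by (simp add: bdry_def)
      have "bdry_cone [A] A Fo Fm [x] [Par A x] = TM [Par A x] [Par A x]"
        using bdry_choice(2)[OF xt ac bsieve_bdry[OF xt] order_refl b(2)]
          choice_down(2)[OF ac bsieve_bdry[OF xt] b(2), folded b(1), OF b(2)] by simp
      then show ?thesis
        unfolding face_cone_econe f econe_def using Pt Dm_ide[OF Pt] Fo[OF Par_obj[OF x(1)]] by simp
    qed
  qed
  show ?thesis
  proof unfold_locales
    fix xs ys fs0 fs1 assume xy: "xs \<in> TP" "ys \<in> TP" and l: "length fs0 = length [A]" "length fs1 = length [A]"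
      and q: "\<And>i. i < length [A] \<Longrightarrow> Square (fs0 ! i) (Pr ([A] ! i) (xs ! i)) (Pr ([A] ! i) (ys ! i)) (fs1 ! i) \<in> SqQ ([A] ! i)"
    obtain x where x: "x \<in> Obj A" "xs = [x]" "1 \<le> Len A x" using TPD xy by blast
    obtain y where y: "y \<in> Obj A" "ys = [y]" "1 \<le> Len A y" using TPD xy by blast
    obtain f0 f1 where f: "fs0 = [f0]" "fs1 = [f1]" using l by (auto simp: length_Suc_conv)
    have s: "Square f0 (Pr A x) (Pr A y) f1 \<in> SqQ A" using q[of 0] x y f by simp
    note h = SqQ_Pr_hom[OF s x(1,3) y(1,3)]
    have "bdry_map [A] A Fo Fm [x] [y] [f0] [f1] = f1"
    proof (rule bdry_map_eqI)
      show "[x] \<in> TP" "[y] \<in> TP" using xy x y by auto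
      show "in_hom A f1 (Par A (Fo [x])) (Par A (Fo [y]))" using h x y Fo by simp
      fix J assume "J \<subseteq> {..<length [A]}" "J \<noteq> {}"
      then have J: "J = {0}" by auto
      show "Comp A (face_cone [A] A Fo Fm [y] J) f1 = Comp A (Fm (pick (length [A]) J [f0] [f1])) (face_cone [A] A Fo Fm [x] J)"
        using J fcone[OF x(1,3)] fcone[OF y(1,3)] ide_comp[OF h(2)] comp_ide[OF h(2)] Fm[OF in_hom_arr[OF h(2)]]
        by (simp add: pick_def)
    qed
    then show "Square (Fm fs0) (Pr A (Fo xs)) (Pr A (Fo ys)) (bdry_map [A] A Fo Fm xs ys fs0 fs1) \<in> SqQ A"
      using s x y f Fo Fm[OF in_hom_arr[OF h(1)]] by simp
  qed
qed

text \<open>Common form of the objects and of the arrows of a product category, so that the laws of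
  composition can be proved once for both parts of a functor.\<close>

definition pset :: "('c \<Rightarrow> 'x set) \<Rightarrow> 'c list \<Rightarrow> 'x list set" where
  "pset X As = {xs. length xs = length As \<and> (\<forall>i<length As. xs ! i \<in> X (As ! i))}"

lemma Obj_pset: "Obj (prod_cat As) = pset Obj As"
  by (simp add: prod_cat_def pset_def)

lemma Arr_pset: "Arr (prod_cat As) = pset Arr As"
  by (simp add: prod_cat_def pset_def)

lemma pset_concat_iff:
  "xs \<in> pset X (concat Ass) \<longleftrightarrow> length xs = length (concat Ass) \<and>
    (\<forall>i<length Ass. split_by Ass xs ! i \<in> pset X (Ass ! i))"
  unfolding pset_def mem_Collect_eq all_concat_iff
  by (auto simp: length_split_by_nth split_by_nth concat_nth_off simp del: length_concat)

definition mcmp :: "('c \<Rightarrow> 'x set) \<Rightarrow> 'c list list \<Rightarrow> ('x list \<Rightarrow> 'y) \<Rightarrow> ('x list \<Rightarrow> 'x) list \<Rightarrow> 'x list \<Rightarrow> 'y" where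
  "mcmp X Ass g fs = restrict (\<lambda>xs. g (map2 (\<lambda>f. f) fs (split_by Ass xs))) (pset X (concat Ass))"

lemma Fun_comp_mcmp:
  "Fun_comp Ass G Fs = (mcmp Obj Ass (fst G) (map fst Fs), mcmp Arr Ass (snd G) (map snd Fs))"
  by (simp add: Fun_comp_def mcmp_def Obj_pset Arr_pset zip_map1 split_def comp_def)

section \<open>Associativity of block composition\<close>

lemma map2_app_nth: "length fs = length xss \<Longrightarrow> map2 (\<lambda>f. f) fs xss = map (\<lambda>i. (fs ! i) (xss ! i)) [0..<length xss]"
  by (auto intro!: nth_equalityI)

lemma split_by_append:
  "split_by (Ass @ Bss) xs = split_by Ass (take (length (concat Ass)) xs) @ split_by Bss (drop (length (concat Ass)) xs)"
proof (induction Ass arbitrary: xs)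
  case (Cons A Ass)
  then show ?case by (simp add: drop_take add.commute)
qed simp

lemma split_by_concat_concat:
  "split_by (concat Asss) xs = concat (map2 split_by Asss (split_by (map concat Asss) xs))"
proof (induction Asss arbitrary: xs)
  case (Cons Ass Asss)
  then show ?case by (simp add: split_by_append)
qed simp

lemma map2_concat:
  "length fss = length zss \<Longrightarrow> (\<And>i. i < length fss \<Longrightarrow> length (fss ! i) = length (zss ! i)) \<Longrightarrow>
   map2 f (concat fss) (concat zss) = concat (map2 (map2 f) fss zss)"
proof (induction fss arbitrary: zss)
  case (Cons fs fss)
  obtain z zs where z: "zss = z # zs" using Cons.prems(1) by (cases zss) auto
  have "length fs = length z" using Cons.prems(2)[of 0] z by simp
  moreover have "map2 f (concat fss) (concat zs) = concat (map2 (map2 f) fss zs)"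
    using Cons.IH[of zs] Cons.prems(1) Cons.prems(2)[of "Suc i" for i] z by auto
  ultimately show ?case by (simp add: z)
qed simp

text \<open>Cutting into fine blocks is the same as cutting into coarse blocks and then cutting each
  of these. The hypothesis \<open>maps\<close> keeps the intermediate tuple inside the domain of the
  restricted function \<open>mcmp X Bss h gs\<close>, which is \<open>undefined\<close>
  elsewhere.\<close>

lemma mcmp_assoc:
  fixes h :: "'x list \<Rightarrow> 'x"
  assumes len: "length Asss = n" "length Bss = n" "length gs = n" "length fss = n"
    "\<And>i. i < n \<Longrightarrow> length (Asss ! i) = length (Bss ! i)" "\<And>i. i < n \<Longrightarrow> length (fss ! i) = length (Bss ! i)"
    and maps: "\<And>i j x. i < n \<Longrightarrow> j < length (Bss ! i) \<Longrightarrow> x \<in> pset X (Asss ! i ! j) \<Longrightarrow> (fss ! i ! j) x \<in> X (Bss ! i ! j)"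
  shows "mcmp X (concat Asss) (mcmp X Bss h gs) (concat fss) =
    mcmp X (map concat Asss) h (map (\<lambda>i. mcmp X (Asss ! i) (gs ! i) (fss ! i)) [0..<n])"
proof
  fix xs
  have cc: "concat (map concat Asss) = concat (concat Asss)" by (induction Asss) auto
  show "mcmp X (concat Asss) (mcmp X Bss h gs) (concat fss) xs =
    mcmp X (map concat Asss) h (map (\<lambda>i. mcmp X (Asss ! i) (gs ! i) (fss ! i)) [0..<n]) xs"
  proof (cases "xs \<in> pset X (concat (concat Asss))")
    case False
    then show ?thesis by (simp add: mcmp_def cc)
  next
    case True
    then have xs: "xs \<in> pset X (concat (map concat Asss))" by (simp add: cc)
    define bs where "bs = split_by (map concat Asss) xs"
    have lb: "length bs = n" by (simp add: bs_def len)
    have b: "bs ! i \<in> pset X (concat (Asss ! i))" if "i < n" for i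
      using xs[unfolded pset_concat_iff] that len unfolding bs_def by simp
    define yss where "yss = map2 (map2 (\<lambda>f. f)) fss (map2 split_by Asss bs)"
    have ly: "length yss = n" by (simp add: yss_def len lb)
    have y: "yss ! i = map2 (\<lambda>f. f) (fss ! i) (split_by (Asss ! i) (bs ! i))" if "i < n" for i
      using that by (simp add: yss_def len lb)
    have lyi: "length (yss ! i) = length (Bss ! i)" if "i < n" for i using y[OF that] len that by simp
    have e: "map2 (\<lambda>f. f) (concat fss) (split_by (concat Asss) xs) = concat yss"
      unfolding split_by_concat_concat bs_def[symmetric] yss_def
      by (rule map2_concat) (use len lb in auto)
    have sb: "split_by Bss (concat yss) = yss" by (rule split_by_concat) (use ly lyi len in auto)
    have yp: "concat yss \<in> pset X (concat Bss)"
      unfolding pset_concat_iff sb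
    proof (intro conjI allI impI)
      show "length (concat yss) = length (concat Bss)" by (rule length_concat_split) (use ly lyi len in auto)
      fix i assume "i < length Bss"
      then have i: "i < n" using len by simp
      have "(fss ! i ! j) (split_by (Asss ! i) (bs ! i) ! j) \<in> X (Bss ! i ! j)" if j: "j < length (Bss ! i)" for j
        using maps[OF i j] b[OF i] len(5)[OF i] j unfolding pset_concat_iff by simp
      then show "yss ! i \<in> pset X (Bss ! i)"
        using lyi[OF i] y[OF i] len i by (simp add: pset_def)
    qed
    have "mcmp X (concat Asss) (mcmp X Bss h gs) (concat fss) xs = h (map2 (\<lambda>f. f) gs yss)"
      using True yp sb e by (simp add: mcmp_def)
    also have "map2 (\<lambda>f. f) gs yss = map2 (\<lambda>f. f) (map (\<lambda>i. mcmp X (Asss ! i) (gs ! i) (fss ! i)) [0..<n]) bs"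
      using ly lb len y b by (auto intro!: nth_equalityI simp: mcmp_def)
    also have "h \<dots> = mcmp X (map concat Asss) h (map (\<lambda>i. mcmp X (Asss ! i) (gs ! i) (fss ! i)) [0..<n]) xs"
      using xs by (simp add: mcmp_def bs_def)
    finally show ?thesis .
  qed
qed

section \<open>Sets of functors and of multimorphisms\<close>

lemma Fun_set_iff:
  "F \<in> Fun_set As B \<longleftrightarrow> is_functor (prod_cat As) B (fst F) (snd F) \<and>
     fst F \<in> extensional (pset Obj As) \<and> snd F \<in> extensional (pset Arr As)"
  by (cases F) (simp add: Fun_set_def Obj_pset Arr_pset)

lemma Fun_set_maps:
  assumes "F \<in> Fun_set As B"
  shows "xs \<in> pset Obj As \<Longrightarrow> fst F xs \<in> Obj B" "fs \<in> pset Arr As \<Longrightarrow> snd F fs \<in> Arr B"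
  using assms unfolding Fun_set_iff is_functor_def Obj_pset Arr_pset in_hom_def by auto

lemma prodfun_Fun_set:
  "contextual B \<Longrightarrow> set As \<subseteq> {A. contextual A} \<Longrightarrow> F \<in> Fun_set As B \<Longrightarrow> prodfun B As (fst F) (snd F)"
  unfolding Fun_set_iff by unfold_locales auto

text \<open>One description for all arities: for the empty list it is
  \<open>multi_nullary_iff\<close>, otherwise the equivalence of \<open>multi\<close> with
  \<open>multimorphism\<close>. Composition can then ignore which of the lists involved are
  empty.\<close>

lemma Cont_Hom_iff:
  assumes "contextual B" "set As \<subseteq> {A. contextual A}"
  shows "F \<in> Cont_Hom As B \<longleftrightarrow> F \<in> Fun_set As B \<and> multi B As (fst F) (snd F)"
proof (cases "As = []")
  case True
  then show ?thesis
    using multi_nullary_iff[OF assms(1), of "fst F" "snd F"] by (cases F) (auto simp: Cont_Hom_def Fun_set_def)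
next
  case False
  have "multimorphism As B (fst F) (snd F) \<longleftrightarrow> multi B As (fst F) (snd F)"
    using multimorphism_imp_multi[OF assms(1)] multi.multimorphism assms(2) by blast
  with False show ?thesis by (cases F) (auto simp: Cont_Hom_def)
qed

lemma Fun_ide_eqs:
  "x \<in> Obj A \<Longrightarrow> fst (Fun_ide A) [x] = x" "f \<in> Arr A \<Longrightarrow> snd (Fun_ide A) [f] = f"
  by (simp_all add: Fun_ide_def prod_Obj_iff prod_Arr_iff)

lemma Fun_ide_Cont_Hom: "contextual A \<Longrightarrow> Fun_ide A \<in> Cont_Hom [A] A"
proof -
  assume A: "contextual A"
  have m: "multi A [A] (fst (Fun_ide A)) (snd (Fun_ide A))"
    by (rule multi_identity[OF A Fun_ide_eqs])
  then have "is_functor (prod_cat [A]) A (fst (Fun_ide A)) (snd (Fun_ide A))"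
    by (simp add: multi_def cellfun_def prodfun_def prodfun_axioms_def)
  then have "Fun_ide A \<in> Fun_set [A] A"
    unfolding Fun_set_iff by (simp add: Fun_ide_def Obj_pset Arr_pset)
  with m A show ?thesis by (simp add: Cont_Hom_iff)
qed

lemma Fun_ide_Fun_set: "contextual A \<Longrightarrow> Fun_ide A \<in> Fun_set [A] A"
  using Fun_ide_Cont_Hom[of A] Cont_Hom_iff[of A "[A]"] by simp

lemma Fun_comp_prodcomp:
  assumes "mcomposable Cont_fun Fun_set Ass Bs C g fs"
  shows "prodcomp C Bs (fst g) (snd g) Ass (\<lambda>i. fst (fs ! i)) (\<lambda>i. snd (fs ! i))
    (fst (Fun_comp Ass g fs)) (snd (Fun_comp Ass g fs))"
proof -
  from assms have c: "\<And>As. As \<in> set Ass \<Longrightarrow> set As \<subseteq> {A. contextual A}" "set Bs \<subseteq> {A. contextual A}" "contextual C"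
    and l: "length Ass = length Bs" "length fs = length Bs" and g: "g \<in> Fun_set Bs C"
    and f: "\<And>i. i < length Bs \<Longrightarrow> fs ! i \<in> Fun_set (Ass ! i) (Bs ! i)"
    by (auto simp: mcomposable_def Cont_fun_def)
  show ?thesis
  proof (rule prodcomp.intro[OF prodfun_Fun_set[OF c(3,2) g] prodcomp_axioms.intro])
    show "length Ass = length Bs" by (rule l)
    show "prodfun (Bs ! i) (Ass ! i) (fst (fs ! i)) (snd (fs ! i))" if i: "i < length Bs" for i
    proof (rule prodfun_Fun_set[OF _ c(1) f[OF i]])
      show "contextual (Bs ! i)" using c(2) nth_mem[OF i] by blast
      show "Ass ! i \<in> set Ass" using i l by simp
    qed
    show "fst (Fun_comp Ass g fs) xs = fst g (map (\<lambda>i. fst (fs ! i) (split_by Ass xs ! i)) [0..<length Bs])"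
      if "xs \<in> Obj (prod_cat (concat Ass))" for xs
      using that l by (auto simp: Fun_comp_mcmp mcmp_def Obj_pset map2_app_nth intro!: arg_cong[of _ _ "fst g"])
    show "snd (Fun_comp Ass g fs) xs = snd g (map (\<lambda>i. snd (fs ! i) (split_by Ass xs ! i)) [0..<length Bs])"
      if "xs \<in> Arr (prod_cat (concat Ass))" for xs
      using that l by (auto simp: Fun_comp_mcmp mcmp_def Arr_pset map2_app_nth intro!: arg_cong[of _ _ "snd g"])
  qed
qed

lemma Fun_comp_Fun_set:
  assumes "mcomposable Cont_fun Fun_set Ass Bs C g fs"
  shows "Fun_comp Ass g fs \<in> Fun_set (concat Ass) C"
  using prodcomp.H_functor[OF Fun_comp_prodcomp[OF assms]]
  unfolding Fun_set_iff by (simp add: Fun_comp_mcmp mcmp_def)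

lemma Fun_comp_Cont_Hom:
  assumes m: "mcomposable Cont_fun Cont_Hom Ass Bs C g fs"
  shows "Fun_comp Ass g fs \<in> Cont_Hom (concat Ass) C"
proof -
  from m have c: "\<And>As. As \<in> set Ass \<Longrightarrow> set As \<subseteq> {A. contextual A}" "set Bs \<subseteq> {A. contextual A}" "contextual C"
    and l: "length Ass = length Bs" and gc: "g \<in> Cont_Hom Bs C"
    and fc: "\<And>i. i < length Bs \<Longrightarrow> fs ! i \<in> Cont_Hom (Ass ! i) (Bs ! i)"
    by (auto simp: mcomposable_def Cont_fun_def)
  have g: "g \<in> Fun_set Bs C" "multi C Bs (fst g) (snd g)" using gc c(2,3) by (auto simp: Cont_Hom_iff)
  have f: "fs ! i \<in> Fun_set (Ass ! i) (Bs ! i)" "multi (Bs ! i) (Ass ! i) (fst (fs ! i)) (snd (fs ! i))"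
    if i: "i < length Bs" for i
  proof -
    have "contextual (Bs ! i)" using c(2) nth_mem[OF i] by blast
    moreover have "set (Ass ! i) \<subseteq> {A. contextual A}" by (rule c(1)) (use i l in simp)
    ultimately have "contextual (Bs ! i)" "set (Ass ! i) \<subseteq> {A. contextual A}" .
    with fc[OF i] show "fs ! i \<in> Fun_set (Ass ! i) (Bs ! i)" "multi (Bs ! i) (Ass ! i) (fst (fs ! i)) (snd (fs ! i))"
      by (auto simp: Cont_Hom_iff)
  qed
  have mF: "mcomposable Cont_fun Fun_set Ass Bs C g fs"
    using m g(1) f(1) by (auto simp: mcomposable_def)
  have "multi C (concat Ass) (fst (Fun_comp Ass g fs)) (snd (Fun_comp Ass g fs))"
    by (rule compfun.H_multi[OF compfun.intro[OF Fun_comp_prodcomp[OF mF] g(2) compfun_axioms.intro[OF f(2)]]])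
  moreover have "set (concat Ass) \<subseteq> {A. contextual A}" using c(1) by auto
  ultimately show ?thesis using Fun_comp_Fun_set[OF mF] c(3) by (simp only: Cont_Hom_iff)
qed

lemma extensional_eqI: "f \<in> extensional S \<Longrightarrow> (\<And>x. x \<in> S \<Longrightarrow> g x = f x) \<Longrightarrow> restrict g S = f"
  by (auto simp: extensional_def restrict_def)

lemma Fun_comp_ide_left:
  assumes f: "f \<in> Fun_set As B"
  shows "Fun_comp [As] (Fun_ide B) [f] = f"
proof -
  have "mcmp Obj [As] (fst (Fun_ide B)) (map fst [f]) = fst f"
    unfolding mcmp_def
    by (rule extensional_eqI) (use f Fun_set_maps[OF f] in \<open>auto simp: Fun_set_iff Fun_ide_eqs pset_def\<close>)
  moreover have "mcmp Arr [As] (snd (Fun_ide B)) (map snd [f]) = snd f"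
    unfolding mcmp_def
    by (rule extensional_eqI) (use f Fun_set_maps[OF f] in \<open>auto simp: Fun_set_iff Fun_ide_eqs pset_def\<close>)
  ultimately show ?thesis by (simp add: Fun_comp_mcmp)
qed

lemma split_by_singletons: "length xs = length As \<Longrightarrow> split_by (map (\<lambda>A. [A]) As) xs = map (\<lambda>x. [x]) xs"
proof (induction As arbitrary: xs)
  case (Cons A As)
  then show ?case by (cases xs) auto
qed simp

lemma Fun_comp_ide_right:
  assumes f: "f \<in> Fun_set As B"
  shows "Fun_comp (map (\<lambda>A. [A]) As) f (map Fun_ide As) = f"
proof -
  have cs: "concat (map (\<lambda>A. [A]) As) = As" by (induction As) auto
  have "mcmp Obj (map (\<lambda>A. [A]) As) (fst f) (map fst (map Fun_ide As)) = fst f"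
    unfolding mcmp_def cs
  proof (rule extensional_eqI)
    show "fst f \<in> extensional (pset Obj As)" using f by (simp add: Fun_set_iff)
    fix xs assume "xs \<in> pset Obj As"
    then have "map2 (\<lambda>f. f) (map fst (map Fun_ide As)) (map (\<lambda>x. [x]) xs) = xs" "length xs = length As"
      by (auto simp: pset_def Fun_ide_eqs intro!: nth_equalityI)
    then show "fst f (map2 (\<lambda>f. f) (map fst (map Fun_ide As)) (split_by (map (\<lambda>A. [A]) As) xs)) = fst f xs"
      by (simp add: split_by_singletons)
  qed
  moreover have "mcmp Arr (map (\<lambda>A. [A]) As) (snd f) (map snd (map Fun_ide As)) = snd f"
    unfolding mcmp_def cs
  proof (rule extensional_eqI)
    show "snd f \<in> extensional (pset Arr As)" using f by (simp add: Fun_set_iff)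
    fix xs assume "xs \<in> pset Arr As"
    then have "map2 (\<lambda>f. f) (map snd (map Fun_ide As)) (map (\<lambda>x. [x]) xs) = xs" "length xs = length As"
      by (auto simp: pset_def Fun_ide_eqs intro!: nth_equalityI)
    then show "snd f (map2 (\<lambda>f. f) (map snd (map Fun_ide As)) (split_by (map (\<lambda>A. [A]) As) xs)) = snd f xs"
      by (simp add: split_by_singletons)
  qed
  ultimately show ?thesis by (simp add: Fun_comp_mcmp)
qed

lemma Fun_comp_assoc:
  assumes h: "mcomposable Cont_fun Fun_set Bss Cs D h gs"
    and l: "length Asss = length Cs" "length fss = length Cs"
    and g: "\<And>i. i < length Cs \<Longrightarrow> mcomposable Cont_fun Fun_set (Asss ! i) (Bss ! i) (Cs ! i) (gs ! i) (fss ! i)"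
  shows "Fun_comp (concat Asss) (Fun_comp Bss h gs) (concat fss) =
        Fun_comp (map concat Asss) h (map (\<lambda>i. Fun_comp (Asss ! i) (gs ! i) (fss ! i)) [0..<length Cs])"
proof -
  have len: "length Bss = length Cs" "length gs = length Cs" using h by (auto simp: mcomposable_def)
  have lens: "length (Asss ! i) = length (Bss ! i)" "length (fss ! i) = length (Bss ! i)" if "i < length Cs" for i
    using g[OF that] by (auto simp: mcomposable_def)
  have fs: "fss ! i ! j \<in> Fun_set (Asss ! i ! j) (Bss ! i ! j)" if "i < length Cs" "j < length (Bss ! i)" for i j
    using g[OF that(1)] that(2) by (auto simp: mcomposable_def)
  have 1: "mcmp Obj (concat Asss) (mcmp Obj Bss (fst h) (map fst gs)) (concat (map (map fst) fss)) =
     mcmp Obj (map concat Asss) (fst h) (map (\<lambda>i. mcmp Obj (Asss ! i) (map fst gs ! i) (map (map fst) fss ! i)) [0..<length Cs])"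
    by (rule mcmp_assoc) (use l len lens Fun_set_maps(1)[OF fs] in auto)
  have 2: "mcmp Arr (concat Asss) (mcmp Arr Bss (snd h) (map snd gs)) (concat (map (map snd) fss)) =
     mcmp Arr (map concat Asss) (snd h) (map (\<lambda>i. mcmp Arr (Asss ! i) (map snd gs ! i) (map (map snd) fss ! i)) [0..<length Cs])"
    by (rule mcmp_assoc) (use l len lens Fun_set_maps(2)[OF fs] in auto)
  have 3: "map (\<lambda>i. mcmp Obj (Asss ! i) (map fst gs ! i) (map (map fst) fss ! i)) [0..<length Cs] =
      map (\<lambda>i. mcmp Obj (Asss ! i) (fst (gs ! i)) (map fst (fss ! i))) [0..<length Cs]"
    "map (\<lambda>i. mcmp Arr (Asss ! i) (map snd gs ! i) (map (map snd) fss ! i)) [0..<length Cs] =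
      map (\<lambda>i. mcmp Arr (Asss ! i) (snd (gs ! i)) (map snd (fss ! i))) [0..<length Cs]"
    using len l by auto
  show ?thesis
    using 1 2 unfolding 3 by (simp add: Fun_comp_mcmp map_concat comp_def)
qed

lemma multicategory_Cont_fun: "multicategory (Cont_fun :: (('o, 'm) ctxcat, ('o, 'm) nfun) multicat)"
proof -
  let ?M = "Cont_fun :: (('o, 'm) ctxcat, ('o, 'm) nfun) multicat"
  have sel: "MObj ?M = {A. contextual A}" "MHom ?M = Fun_set" "MIde ?M = Fun_ide"
    "MComp ?M = (\<lambda>Ass Bs C. Fun_comp Ass)"
    by (auto simp: Cont_fun_def)
  show ?thesis
    unfolding multicategory_def closed_under_mcomp_def sel
  proof (intro conjI allI impI ballI)
    show "Fun_ide A \<in> Fun_set [A] A" if "A \<in> {A. contextual A}" for A :: "('o, 'm) ctxcat"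
      using that by (simp add: Fun_ide_Fun_set)
  qed (simp_all add: Fun_comp_Fun_set Fun_comp_ide_left Fun_comp_ide_right Fun_comp_assoc)
qed

theorem theorem6p8:
  shows "closed_under_mcomp (Cont_fun :: (('o, 'm) ctxcat, ('o, 'm) nfun) multicat) Cont_Hom \<and>
         sub_multicategory (Cont_fun :: (('o, 'm) ctxcat, ('o, 'm) nfun) multicat) Cont_Hom"
proof -
  have "closed_under_mcomp (Cont_fun :: (('o, 'm) ctxcat, ('o, 'm) nfun) multicat) Cont_Hom"
    unfolding closed_under_mcomp_def
  proof (intro allI impI)
    fix Ass Bs C fs and g :: "('o, 'm) nfun"
    assume "mcomposable Cont_fun Cont_Hom Ass Bs C g fs"
    from Fun_comp_Cont_Hom[OF this] show "MComp Cont_fun Ass Bs C g fs \<in> Cont_Hom (concat Ass) C"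
      by (simp add: Cont_fun_def)
  qed
  moreover have "Cont_Hom As B \<subseteq> Fun_set As B" for As and B :: "('o, 'm) ctxcat"
    by (auto simp: Cont_Hom_def)
  ultimately show ?thesis
    using multicategory_Cont_fun Fun_ide_Cont_Hom by (auto simp: sub_multicategory_def Cont_fun_def)
qed

end
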